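(* Let $p$ be a prime and $\mathbb F$ a field of characteristic $p$. Suppose $\lambda$ is a partition and $T$ is a magic $\lambda$-tableau, and write $\hat\Theta_T$ as a linear combination $\sum_S a_S\hat\Theta_S$ of semistandard homomorphisms (the sum being over semistandard $\lambda$-tableaux $S$ of type $\lambda^{\mathrm{rest}}$, with $a_S\in\mathbb F$). Then $a_{\operatorname{Re}(\lambda)}=\pm1$, and for any $S$ with $a_S\ne0$ we have $S\trianglerighteq\operatorname{Re}(\lambda)$.
   Context: Nodes are elements $(r,c)\in\mathbb N^2$; partitions and compositions are identified with Young diagrams $\{(r,c):c\le\lambda_r\}$, row $1$ at the top. For $l\ge0$ the $l$th ramp is the set of nodes $(r,c)$ with $c-1+(p-1)(r-1)=l$. The $p$-restrictisation $\lambda^{\mathrm{rest}}$ of a partition $\lambda$ is the partition obtained by moving all nodes of $\lambda$ in each ramp as far to the left within that ramp as possible. Tableaux and homomorphisms. Let $\lambda,\mu$ be compositions of $n$. A $\lambda$-tableau of type $\mu$ is a function $T$ from the Young diagram of $\lambda$ to $\mathbb N$ taking each value $i$ exactly $\mu_i$ times; $T_{x,y}$ is the entry in node $(x,y)$. $T$ is row-standard if entries weakly increase along rows, and semistandard if also entries strictly increase down columns. $M^\lambda$ is the Young permutation module of $\mathbb F\mathfrak S_n$ (basis the $\lambda$-tabloids). For a row-standard $\lambda$-tableau $T$ of type $\mu$, $\Theta_T:M^\lambda\to M^\mu$ is James's homomorphism: fixing a bijective filling $t$ of $\lambda$ by $1,\dots,n$, $\Theta_T$ is the $\mathbb F\mathfrak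 S_n$-homomorphism sending the tabloid of $t$ to the sum, over all distinct tableaux $T_1$ obtained from $T$ by permuting entries within rows, of the $\mu$-tabloid in which $j$ lies in row $k$ whenever $T_1$ has entry $k$ at the node where $t$ has entry $j$. If $\lambda$ is a partition, $\hat\Theta_T$ is the restriction of $\Theta_T$ to the Specht module $S^\lambda\subseteq M^\lambda$. If $T$ is semistandard, $\hat\Theta_T$ is called a semistandard homomorphism. (The semistandard homomorphisms form a basis of the space of homomorphisms $S^\lambda\to M^\mu$ extending to $M^\lambda$.) Dominance. For row-standard tableaux $T,U$ of the same shape and type, $T\trianglerighteq U$ ($T$ dominates $U$) if for all $l,r$ the number of entries $\le l$ in rows $1,\dots,r$ of $T$ is at least the corresponding number for $U$. $\operatorname{Re}(\lambda)$ is the $\lambda$-tableau (of type $\lambda^{\mathrm{rest}}$) in which the $(x,y)$-entry is $x$ plus the number of nodes below $(x,y)$ in the same ramp which are not nodes of $\lambda$. Magic tableaux. Let $\operatorname{full}(\lambda)$ be the number of ramps all of whose nodes are nodes of $\lambda$ (these are ramps $0,\dots,\operatorname{full}(\lambda)-1$). A positive integer $m$ is nice for $\lambda$ if row $m$ contains a node of the first non-full ramp (ramp $\operatorname{full}(\lambda)$) that is not a node of $\lambda$; then $\lambda_m+(m-1)(p-1)=\operatorname{full}(\lambda)$. For a nice $m$, define the partition $\lambda^\circ$ by $\lambda^\circ_i=\lambda_i-p+1$ for $i<m$ and $\lambda^\circ_i=\lambda_{i+1}$ for $i\ge m$. Given a $\lambda^\circ$-tableau $U$, define the $\lambda$-tableau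 $U^+$ by $U^+_{x,y}=1$ if $x<m$ and $y<p$; $U^+_{x,y}=U_{x,y-p+1}+1$ if $x<m$ and $y\ge p$; $U^+_{x,y}=1$ if $x=m$; $U^+_{x,y}=U_{x-1,y}+1$ if $x>m$. Magic tableaux are defined recursively: the unique tableau of the empty partition is magic; for $\lambda\ne\varnothing$, a magic $\lambda$-tableau is any tableau of the form $U^+$ where, for some nice value $m$ for $\lambda$, $U$ is a magic $\lambda^\circ$-tableau. *)

theory Defs
  imports Complex_Main "HOL-Computational_Algebra.Primes" "HOL-Library.FuncSet" "HOL-Library.Function_Algebras" "HOL-Combinatorics.Permutations"
begin


text \<open>
  Rows, columns and tableau entries are numbered from 1.  A composition is a finitely supported
  function on the positive integers, totalised by the value 0 at the argument 0.
\<close>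

definition is_composition :: "(nat \<Rightarrow> nat) \<Rightarrow> bool" where
  "is_composition lam \<longleftrightarrow> lam 0 = 0 \<and> finite {i. lam i \<noteq> 0}"

definition is_partition :: "(nat \<Rightarrow> nat) \<Rightarrow> bool" where
  "is_partition lam \<longleftrightarrow> is_composition lam \<and> (\<forall>i\<ge>1. lam (Suc i) \<le> lam i)"

definition diagram :: "(nat \<Rightarrow> nat) \<Rightarrow> (nat \<times> nat) set" where
  "diagram lam = {(r, c). 1 \<le> r \<and> 1 \<le> c \<and> c \<le> lam r}"

text \<open>
  The library has no type of functions on a Young diagram; a tableau takes the value 0, which is
  not a legal entry, outside its diagram, so that equality of tableaux is equality of functions.
\<close>

type_synonym tableau = "nat \<times> nat \<Rightarrow> nat"

definition tableau_of_type :: "(nat \<Rightarrow> nat) \<Rightarrow> (nat \<Rightarrow> nat) \<Rightarrow> tableau \<Rightarrow> bool" where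
  "tableau_of_type lam mu T \<longleftrightarrow>
     (\<forall>z\<in>diagram lam. 1 \<le> T z) \<and> (\<forall>z. z \<notin> diagram lam \<longrightarrow> T z = 0) \<and>
     (\<forall>i\<ge>1. card {z \<in> diagram lam. T z = i} = mu i)"

definition row_standard :: "(nat \<Rightarrow> nat) \<Rightarrow> tableau \<Rightarrow> bool" where
  "row_standard lam T \<longleftrightarrow>
     (\<forall>x y y'. (x, y) \<in> diagram lam \<longrightarrow> (x, y') \<in> diagram lam \<longrightarrow> y \<le> y' \<longrightarrow> T (x, y) \<le> T (x, y'))"

definition column_strict :: "(nat \<Rightarrow> nat) \<Rightarrow> tableau \<Rightarrow> bool" where
  "column_strict lam T \<longleftrightarrow>
     (\<forall>x x' y. (x, y) \<in> diagram lam \<longrightarrow> (x', y) \<in> diagram lam \<longrightarrow> x < x' \<longrightarrow> T (x, y) < T (x', y))"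

definition semistandard :: "(nat \<Rightarrow> nat) \<Rightarrow> tableau \<Rightarrow> bool" where
  "semistandard lam T \<longleftrightarrow> row_standard lam T \<and> column_strict lam T"

definition semistandard_tableaux :: "(nat \<Rightarrow> nat) \<Rightarrow> (nat \<Rightarrow> nat) \<Rightarrow> tableau set" where
  "semistandard_tableaux lam mu = {S. tableau_of_type lam mu S \<and> semistandard lam S}"

definition dominates :: "(nat \<Rightarrow> nat) \<Rightarrow> tableau \<Rightarrow> tableau \<Rightarrow> bool" where
  "dominates lam T U \<longleftrightarrow>
     (\<forall>l r. card {(x, y) \<in> diagram lam. x \<le> r \<and> U (x, y) \<le> l}
          \<le> card {(x, y) \<in> diagram lam. x \<le> r \<and> T (x, y) \<le> l})"



definition csize :: "(nat \<Rightarrow> nat) \<Rightarrow> nat" where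
  "csize lam = card (diagram lam)"

text \<open>Bijective fillings; their values outside the diagram are never used.\<close>

definition filling :: "(nat \<Rightarrow> nat) \<Rightarrow> tableau \<Rightarrow> bool" where
  "filling lam t \<longleftrightarrow> bij_betw t (diagram lam) {1..csize lam}"

text \<open>
  A tabloid, i.e. a row-equivalence class of bijective fillings, is represented by the function
  sending each row number to the (unordered) set of entries of that row.
\<close>

type_synonym tabloid = "nat \<Rightarrow> nat set"

definition tabloid_of :: "(nat \<Rightarrow> nat) \<Rightarrow> tableau \<Rightarrow> tabloid" where
  "tabloid_of lam t = (\<lambda>k. t ` {z \<in> diagram lam. fst z = k})"

definition tabloids :: "(nat \<Rightarrow> nat) \<Rightarrow> tabloid set" where
  "tabloids lam = {tabloid_of lam t | t. filling lam t}"

text \<open>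
  The module \<open>M\<^sup>\<lambda>\<close>: formal linear combinations of tabloids, as coefficient functions
  vanishing outside the tabloids of shape \<open>\<lambda>\<close>.
\<close>

type_synonym 'f tvec = "tabloid \<Rightarrow> 'f"

definition tscale :: "'f::field \<Rightarrow> 'f tvec \<Rightarrow> 'f tvec" (infixr "*\<^sub>t" 75) where
  "c *\<^sub>t v = (\<lambda>X. c * v X)"

interpretation tvec: vector_space "tscale :: 'f::field \<Rightarrow> 'f tvec \<Rightarrow> 'f tvec"
  by unfold_locales (auto simp: tscale_def fun_eq_iff algebra_simps)

definition single :: "tabloid \<Rightarrow> 'f::field tvec" where
  "single X = (\<lambda>Y. if Y = X then 1 else 0)"

definition perm_module :: "(nat \<Rightarrow> nat) \<Rightarrow> 'f::field tvec set" where
  "perm_module lam = {v. \<forall>X. X \<notin> tabloids lam \<longrightarrow> v X = 0}"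

text \<open>
  The symmetric group of degree \<open>n\<close> (permutations \<open>s\<close> with \<open>s permutes {1..n}\<close>) acts by
  \<open>s {t} = {s \<circ> t}\<close>; on coefficient functions this is \<open>(s v) X = v (s\<^sup>-\<^sup>1 X)\<close>.
\<close>

definition act_tabloid :: "(nat \<Rightarrow> nat) \<Rightarrow> tabloid \<Rightarrow> tabloid" where
  "act_tabloid s X = (\<lambda>k. s ` X k)"

definition act :: "(nat \<Rightarrow> nat) \<Rightarrow> 'f::field tvec \<Rightarrow> 'f tvec" where
  "act s v = (\<lambda>X. v (act_tabloid (inv s) X))"

definition column_stabiliser :: "(nat \<Rightarrow> nat) \<Rightarrow> tableau \<Rightarrow> (nat \<Rightarrow> nat) set" where
  "column_stabiliser lam t = {s. s permutes {1..csize lam} \<and>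
     (\<forall>z\<in>diagram lam. \<exists>z'\<in>diagram lam. snd z' = snd z \<and> s (t z) = t z')}"

definition polytabloid :: "(nat \<Rightarrow> nat) \<Rightarrow> tableau \<Rightarrow> 'f::field tvec" where
  "polytabloid lam t =
     (\<Sum>s\<in>column_stabiliser lam t. of_int (sign s) *\<^sub>t act s (single (tabloid_of lam t)))"

definition specht :: "(nat \<Rightarrow> nat) \<Rightarrow> 'f::field tvec set" where
  "specht lam = tvec.span {polytabloid lam t | t. filling lam t}"



definition row_rearrangements :: "(nat \<Rightarrow> nat) \<Rightarrow> tableau \<Rightarrow> tableau set" where
  "row_rearrangements lam T =
     {T \<circ> p | p. p permutes diagram lam \<and> (\<forall>z\<in>diagram lam. fst (p z) = fst z)}"

text \<open>The tabloid in which \<open>j\<close> lies in row \<open>k\<close> iff \<open>T\<close> has entry \<open>k\<close> where \<open>t\<close> has entry \<open>j\<close>.\<close>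

definition transfer_tabloid :: "(nat \<Rightarrow> nat) \<Rightarrow> tableau \<Rightarrow> tableau \<Rightarrow> tabloid" where
  "transfer_tabloid lam t T = (\<lambda>k. t ` {z \<in> diagram lam. T z = k})"

definition Theta_filling :: "(nat \<Rightarrow> nat) \<Rightarrow> tableau \<Rightarrow> tableau \<Rightarrow> 'f::field tvec" where
  "Theta_filling lam T t = (\<Sum>T1\<in>row_rearrangements lam T. single (transfer_tabloid lam t T1))"

text \<open>
  Linear extension of \<open>{t} \<mapsto> Theta_filling lam T t\<close>.  The choice of a filling in each tabloid is
  immaterial (\<open>Theta_single\<close>), and the result is a homomorphism of modules for the symmetric
  group (\<open>Theta_add\<close>, \<open>Theta_scale\<close>, \<open>Theta_act\<close>) from \<open>M\<^sup>\<lambda>\<close> to \<open>M\<^sup>\<mu>\<close> (\<open>Theta_in_perm_module\<close>).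
\<close>

definition Theta :: "(nat \<Rightarrow> nat) \<Rightarrow> tableau \<Rightarrow> 'f::field tvec \<Rightarrow> 'f tvec" where
  "Theta lam T v =
     (\<Sum>X\<in>tabloids lam. v X *\<^sub>t Theta_filling lam T (SOME t. filling lam t \<and> tabloid_of lam t = X))"

definition Theta_hat :: "(nat \<Rightarrow> nat) \<Rightarrow> tableau \<Rightarrow> 'f::field tvec \<Rightarrow> 'f tvec" where
  "Theta_hat lam T = restrict (Theta lam T) (specht lam)"



definition ramp :: "nat \<Rightarrow> nat \<Rightarrow> (nat \<times> nat) set" where
  "ramp p l = {(r, c). 1 \<le> r \<and> 1 \<le> c \<and> (c - 1) + (p - 1) * (r - 1) = l}"

text \<open>
  The node \<open>(r, c)\<close> of ramp \<open>l\<close> is occupied after moving all nodes to the left iff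
  fewer positions of the ramp lie strictly to the left of it than there are nodes to be placed.
\<close>

definition rest_diagram :: "nat \<Rightarrow> (nat \<Rightarrow> nat) \<Rightarrow> (nat \<times> nat) set" where
  "rest_diagram p lam = (\<Union>l. {(r, c) \<in> ramp p l.
     card {z \<in> ramp p l. snd z < c} < card (ramp p l \<inter> diagram lam)})"

definition restrictisation :: "nat \<Rightarrow> (nat \<Rightarrow> nat) \<Rightarrow> (nat \<Rightarrow> nat)" where
  "restrictisation p lam = (\<lambda>r. card {c. (r, c) \<in> rest_diagram p lam})"

definition Re_tableau :: "nat \<Rightarrow> (nat \<Rightarrow> nat) \<Rightarrow> tableau" where
  "Re_tableau p lam = (\<lambda>(x, y). if (x, y) \<in> diagram lam
     then x + card {(x', y'). x < x' \<and> (\<exists>l. (x, y) \<in> ramp p l \<and> (x', y') \<in> ramp p l)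
                    \<and> (x', y') \<notin> diagram lam}
     else 0)"



definition full :: "nat \<Rightarrow> (nat \<Rightarrow> nat) \<Rightarrow> nat" where
  "full p lam = card {l. ramp p l \<subseteq> diagram lam}"

definition nice :: "nat \<Rightarrow> (nat \<Rightarrow> nat) \<Rightarrow> nat \<Rightarrow> bool" where
  "nice p lam m \<longleftrightarrow> (\<exists>c. (m, c) \<in> ramp p (full p lam) \<and> (m, c) \<notin> diagram lam)"

text \<open>
  For a partition and a nice \<open>m\<close>, each part in a row \<open>i\<close> with \<open>1 \<le> i < m\<close> is at least \<open>p - 1\<close>,
  so the subtraction does not truncate there.
\<close>

definition circ :: "nat \<Rightarrow> nat \<Rightarrow> (nat \<Rightarrow> nat) \<Rightarrow> (nat \<Rightarrow> nat)" where
  "circ p m lam = (\<lambda>i. if i < m then lam i - (p - 1) else lam (i + 1))"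

definition tplus :: "nat \<Rightarrow> nat \<Rightarrow> (nat \<Rightarrow> nat) \<Rightarrow> tableau \<Rightarrow> tableau" where
  "tplus p m lam U = (\<lambda>(x, y).
     if (x, y) \<notin> diagram lam then 0
     else if x < m then (if y < p then 1 else U (x, y - (p - 1)) + 1)
     else if x = m then 1
     else U (x - 1, y) + 1)"

inductive magic :: "nat \<Rightarrow> (nat \<Rightarrow> nat) \<Rightarrow> tableau \<Rightarrow> bool" for p where
  magic_empty: "magic p (\<lambda>_. 0) (\<lambda>_. 0)"
| magic_plus: "is_partition lam \<Longrightarrow> lam \<noteq> (\<lambda>_. 0) \<Longrightarrow> nice p lam m \<Longrightarrow>
    magic p (circ p m lam) U \<Longrightarrow> magic p lam (tplus p m lam U)"



lemma finite_diagram: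
  assumes "is_composition lam" shows "finite (diagram lam)"
proof -
  have "diagram lam \<subseteq> (SIGMA r:{i. lam i \<noteq> 0}. {1..lam r})"
    by (auto simp: diagram_def)
  moreover have "finite (SIGMA r:{i. lam i \<noteq> 0}. {1..lam r})"
    using assms by (auto simp: is_composition_def)
  ultimately show ?thesis by (rule finite_subset)
qed

lemma finite_semistandard_tableaux:
  assumes "is_composition lam"
  shows "finite (semistandard_tableaux lam mu)"
proof (cases "semistandard_tableaux lam mu = {}")
  case False
  then obtain S0 where S0: "tableau_of_type lam mu S0"
    by (auto simp: semistandard_tableaux_def)
  have fin: "finite (diagram lam)" by (rule finite_diagram[OF assms])
  have sub: "S z \<in> S0 ` diagram lam"
    if S: "tableau_of_type lam mu S" and z: "z \<in> diagram lam" for S z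
  proof -
    have ge: "S z \<ge> 1" using S z by (auto simp: tableau_of_type_def)
    have "z \<in> {w \<in> diagram lam. S w = S z}" using z by simp
    moreover have "finite {w \<in> diagram lam. S w = S z}" using fin by simp
    ultimately have "card {w \<in> diagram lam. S w = S z} \<noteq> 0" by (metis card_0_eq empty_iff)
    moreover have "card {w \<in> diagram lam. S w = S z} = mu (S z)"
      using S ge unfolding tableau_of_type_def by blast
    moreover have "card {w \<in> diagram lam. S0 w = S z} = mu (S z)"
      using S0 ge unfolding tableau_of_type_def by blast
    ultimately have "card {w \<in> diagram lam. S0 w = S z} \<noteq> 0" by simp
    then have "{w \<in> diagram lam. S0 w = S z} \<noteq> {}" by force
    then obtain w where "w \<in> diagram lam" "S0 w = S z" by blast
    then show ?thesis by (metis imageI)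
  qed
  have "semistandard_tableaux lam mu \<subseteq>
      {S. \<forall>z. (z \<in> diagram lam \<longrightarrow> S z \<in> S0 ` diagram lam) \<and> (z \<notin> diagram lam \<longrightarrow> S z = 0)}"
    using sub by (auto simp: semistandard_tableaux_def tableau_of_type_def)
  moreover have "finite \<dots>"
    by (rule finite_set_of_finite_funs) (use fin in auto)
  ultimately show ?thesis by (rule finite_subset)
qed simp

lemma finite_tabloids:
  assumes "is_composition lam" shows "finite (tabloids lam)"
proof -
  have "tabloids lam \<subseteq> {X :: tabloid. \<forall>k. (k \<in> fst ` diagram lam \<longrightarrow> X k \<in> Pow {1..csize lam}) \<and>
                              (k \<notin> fst ` diagram lam \<longrightarrow> X k = {})}"
    by (force simp: tabloids_def tabloid_of_def filling_def bij_betw_def)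
  moreover have "finite {X :: tabloid. \<forall>k. (k \<in> fst ` diagram lam \<longrightarrow> X k \<in> Pow {1..csize lam}) \<and>
                              (k \<notin> fst ` diagram lam \<longrightarrow> X k = {})}"
    by (rule finite_set_of_finite_funs) (use finite_diagram[OF assms] in auto)
  ultimately show ?thesis by (rule finite_subset)
qed

lemma Theta_filling_cong:
  assumes t: "filling lam t" and t': "filling lam t'" and eq: "tabloid_of lam t = tabloid_of lam t'"
  shows "Theta_filling lam T t = Theta_filling lam T t'"
proof -
  let ?D = "diagram lam"
  have bt: "bij_betw t ?D {1..csize lam}" and bt': "bij_betw t' ?D {1..csize lam}"
    using t t' by (auto simp: filling_def)
  define q where "q z = (if z \<in> ?D then inv_into ?D t' (t z) else z)" for z
  have qD: "q z \<in> ?D" and t'q: "t' (q z) = t z" if "z \<in> ?D" for z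
  proof -
    have "t z \<in> t' ` ?D" using bt bt' that by (auto simp: bij_betw_def)
    then show "q z \<in> ?D" "t' (q z) = t z"
      using that by (auto simp: q_def inv_into_into f_inv_into_f)
  qed
  have bq: "bij_betw q ?D ?D"
  proof -
    have "bij_betw (inv_into ?D t' \<circ> t) ?D ?D"
      by (rule bij_betw_trans[OF bt bij_betw_inv_into[OF bt']])
    then show ?thesis by (rule bij_betw_cong[THEN iffD1, rotated]) (simp add: q_def)
  qed
  have pq: "q permutes ?D" by (rule bij_imp_permutes[OF bq]) (simp add: q_def)
  have rq: "fst (q z) = fst z" if z: "z \<in> ?D" for z
  proof -
    have "t z \<in> tabloid_of lam t (fst z)" using z by (auto simp: tabloid_of_def)
    then have "t z \<in> tabloid_of lam t' (fst z)" using eq by simp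
    then obtain w where w: "w \<in> ?D" "fst w = fst z" "t' w = t z" by (auto simp: tabloid_of_def)
    then have "w = q z"
      using bt' t'q[OF z] qD[OF z] by (metis bij_betw_def inj_onD)
    with w show ?thesis by simp
  qed
  have pqi: "inv q permutes ?D" by (rule permutes_inv[OF pq])
  have iq: "inv q (q z) = z" "q (inv q z) = z" for z
    using permutes_inverses[OF pq] by auto
  have iqD: "inv q z \<in> ?D" if "z \<in> ?D" for z using that permutes_in_image[OF pqi] by blast
  have rqi: "fst (inv q z) = fst z" if z: "z \<in> ?D" for z
    using rq[OF iqD[OF z]] iq by simp
  have tr: "transfer_tabloid lam t T1 = transfer_tabloid lam t' (T1 \<circ> inv q)" for T1 :: tableau
  proof
    fix k
    show "transfer_tabloid lam t T1 k = transfer_tabloid lam t' (T1 \<circ> inv q) k"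
    proof
      show "transfer_tabloid lam t T1 k \<subseteq> transfer_tabloid lam t' (T1 \<circ> inv q) k"
      proof
        fix j assume "j \<in> transfer_tabloid lam t T1 k"
        then obtain z where z: "z \<in> ?D" "T1 z = k" "j = t z" by (auto simp: transfer_tabloid_def)
        then have "q z \<in> {w \<in> ?D. (T1 \<circ> inv q) w = k}" "j = t' (q z)"
          using qD t'q iq by auto
        then show "j \<in> transfer_tabloid lam t' (T1 \<circ> inv q) k"
          unfolding transfer_tabloid_def by blast
      qed
      show "transfer_tabloid lam t' (T1 \<circ> inv q) k \<subseteq> transfer_tabloid lam t T1 k"
      proof
        fix j assume "j \<in> transfer_tabloid lam t' (T1 \<circ> inv q) k"
        then obtain z where z: "z \<in> ?D" "T1 (inv q z) = k" "j = t' z"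
          by (auto simp: transfer_tabloid_def)
        then have "inv q z \<in> {w \<in> ?D. T1 w = k}" "j = t (inv q z)"
          using iqD t'q[OF iqD] iq by auto
        then show "j \<in> transfer_tabloid lam t T1 k"
          unfolding transfer_tabloid_def by blast
      qed
    qed
  qed
  have closed: "T1 \<circ> r \<in> row_rearrangements lam T"
    if T1: "T1 \<in> row_rearrangements lam T" and r: "r permutes ?D" "\<And>z. z \<in> ?D \<Longrightarrow> fst (r z) = fst z"
    for T1 r
  proof -
    from T1 obtain p where p: "T1 = T \<circ> p" "p permutes ?D" "\<And>z. z \<in> ?D \<Longrightarrow> fst (p z) = fst z"
      by (auto simp: row_rearrangements_def)
    have "p \<circ> r permutes ?D" by (rule permutes_compose[OF r(1) p(2)])
    moreover have "fst ((p \<circ> r) z) = fst z" if "z \<in> ?D" for z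
      using that p(3) r permutes_in_image[OF r(1)] by (metis comp_apply)
    ultimately show ?thesis unfolding row_rearrangements_def p(1) by (auto simp: comp_assoc)
  qed
  show ?thesis unfolding Theta_filling_def
  proof (rule sum.reindex_bij_witness[where j = "\<lambda>T1. T1 \<circ> inv q" and i = "\<lambda>T1. T1 \<circ> q"])
    fix T1 assume a: "T1 \<in> row_rearrangements lam T"
    show "T1 \<circ> inv q \<circ> q = T1" "T1 \<circ> q \<circ> inv q = T1" using iq by (auto simp: fun_eq_iff)
    show "T1 \<circ> inv q \<in> row_rearrangements lam T" by (rule closed[OF a pqi rqi])
    show "T1 \<circ> q \<in> row_rearrangements lam T" by (rule closed[OF a pq rq])
    show "single (transfer_tabloid lam t' (T1 \<circ> inv q)) = single (transfer_tabloid lam t T1)"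
      by (simp add: tr)
  qed
qed

lemma Theta_single:
  assumes "is_composition lam" and t: "filling lam t"
  shows "Theta lam T (single (tabloid_of lam t)) = Theta_filling lam T t"
proof -
  let ?X = "tabloid_of lam t"
  let ?s = "SOME t'. filling lam t' \<and> tabloid_of lam t' = ?X"
  have X: "?X \<in> tabloids lam" using t by (auto simp: tabloids_def)
  have s: "filling lam ?s \<and> tabloid_of lam ?s = ?X"
    by (rule someI[where x = t]) (simp add: t)
  have "Theta lam T (single ?X) =
    (\<Sum>X\<in>tabloids lam. if X = ?X then Theta_filling lam T ?s else 0)"
    unfolding Theta_def by (rule sum.cong) (auto simp: single_def tscale_def fun_eq_iff)
  also have "\<dots> = Theta_filling lam T ?s"
    using X finite_tabloids[OF assms(1)] by simp
  also have "\<dots> = Theta_filling lam T t"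
    using s t by (intro Theta_filling_cong) auto
  finally show ?thesis .
qed

lemma Theta_add: "Theta lam T (v + w) = Theta lam T v + Theta lam T w"
  by (simp add: Theta_def tvec.scale_left_distrib sum.distrib)

lemma Theta_scale: "Theta lam T (c *\<^sub>t v) = c *\<^sub>t Theta lam T v"
proof -
  have "(c *\<^sub>t v) X = c * v X" for X by (simp add: tscale_def)
  then show ?thesis by (simp add: Theta_def tvec.scale_sum_right)
qed

lemma filling_comp: "filling lam t \<Longrightarrow> s permutes {1..csize lam} \<Longrightarrow> filling lam (s \<circ> t)"
  unfolding filling_def by (erule bij_betw_trans) (rule permutes_imp_bij)

lemma tabloid_of_comp: "tabloid_of lam (s \<circ> t) = act_tabloid s (tabloid_of lam t)"
  by (auto simp: tabloid_of_def act_tabloid_def image_comp)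

lemma transfer_tabloid_comp: "transfer_tabloid lam (s \<circ> t) T = act_tabloid s (transfer_tabloid lam t T)"
  by (auto simp: transfer_tabloid_def act_tabloid_def image_comp)

lemma act_tabloid_inv:
  assumes "bij s"
  shows "act_tabloid (inv s) (act_tabloid s X) = X" "act_tabloid s (act_tabloid (inv s) X) = X"
  using assms bij_is_surj[OF assms] bij_is_inj[OF assms]
  by (auto simp: act_tabloid_def image_comp fun_eq_iff surj_iff)

lemma act_single:
  assumes "bij s" shows "act s (single X) = single (act_tabloid s X)"
proof
  fix Y
  have "act_tabloid (inv s) Y = X \<longleftrightarrow> Y = act_tabloid s X"
    using act_tabloid_inv[OF assms] by metis
  then show "act s (single X) Y = single (act_tabloid s X) Y"
    by (simp add: act_def single_def)
qed

lemma tvec_sum_apply: "(\<Sum>i\<in>A. f i) (X :: tabloid) = (\<Sum>i\<in>A. f i X)"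
  by (induction A rule: infinite_finite_induct) auto

lemma act_sum: "act s (\<Sum>i\<in>A. f i) = (\<Sum>i\<in>A. act s (f i))"
  by (simp add: act_def fun_eq_iff tvec_sum_apply)

lemma Theta_filling_comp:
  assumes "bij s" shows "Theta_filling lam T (s \<circ> t) = act s (Theta_filling lam T t)"
  by (simp add: Theta_filling_def act_sum act_single[OF assms] transfer_tabloid_comp)

lemma Theta_act:
  assumes "s permutes {1..csize lam}"
  shows "Theta lam T (act s v) = act s (Theta lam T v)"
proof -
  have bs: "bij s" using assms by (rule permutes_bij)
  have s': "inv s permutes {1..csize lam}" by (rule permutes_inv[OF assms])
  let ?c = "\<lambda>X. SOME t. filling lam t \<and> tabloid_of lam t = X"
  have c: "filling lam (?c X) \<and> tabloid_of lam (?c X) = X" if "X \<in> tabloids lam" for X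
  proof -
    have "\<exists>t. filling lam t \<and> tabloid_of lam t = X" using that by (auto simp: tabloids_def)
    then show ?thesis by (rule someI_ex)
  qed
  have cl: "act_tabloid r X \<in> tabloids lam"
    if "X \<in> tabloids lam" "r permutes {1..csize lam}" for X r
    using that filling_comp unfolding tabloids_def by (fastforce simp: tabloid_of_comp[symmetric])
  have tf: "Theta_filling lam T (?c (act_tabloid s Y)) = act s (Theta_filling lam T (?c Y))"
    if Y: "Y \<in> tabloids lam" for Y
  proof -
    have "Theta_filling lam T (?c (act_tabloid s Y)) = Theta_filling lam T (s \<circ> ?c Y)"
      using c[OF Y] c[OF cl[OF Y assms]] filling_comp[OF _ assms]
      by (intro Theta_filling_cong) (simp_all add: tabloid_of_comp)
    then show ?thesis by (simp add: Theta_filling_comp[OF bs])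
  qed
  have "Theta lam T (act s v) =
    (\<Sum>Y\<in>tabloids lam. v Y *\<^sub>t act s (Theta_filling lam T (?c Y)))"
    unfolding Theta_def
  proof (rule sum.reindex_bij_witness[where i = "act_tabloid s" and j = "act_tabloid (inv s)"])
    fix X assume X: "X \<in> tabloids lam"
    show "v (act_tabloid (inv s) X) *\<^sub>t act s (Theta_filling lam T (?c (act_tabloid (inv s) X)))
        = act s v X *\<^sub>t Theta_filling lam T (?c X)"
      unfolding tf[OF cl[OF X s'], symmetric] act_tabloid_inv(2)[OF bs] by (simp add: act_def)
  qed (use cl assms s' act_tabloid_inv[OF bs] in auto)
  also have "\<dots> = act s (Theta lam T v)"
    unfolding Theta_def act_sum by (intro sum.cong) (auto simp: act_def tscale_def)
  finally show ?thesis .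
qed

lemma Theta_in_perm_module:
  assumes lam: "is_composition lam" and mu: "is_composition mu" and T: "tableau_of_type lam mu T"
  shows "Theta lam T v \<in> perm_module mu"
proof -
  let ?D = "diagram lam"
  have fin: "finite ?D" by (rule finite_diagram[OF lam])
  have main: "transfer_tabloid lam t T1 \<in> tabloids mu"
    if t: "filling lam t" and T1: "T1 \<in> row_rearrangements lam T" for t T1
  proof -
    from T1 obtain p where p: "T1 = T \<circ> p" "p permutes ?D" by (auto simp: row_rearrangements_def)
    have pos: "T1 z \<ge> 1" if "z \<in> ?D" for z
    proof -
      have "p z \<in> ?D" using that permutes_in_image[OF p(2)] by blast
      then show ?thesis using T unfolding tableau_of_type_def p(1) comp_apply by blast
    qed
    have cnt: "card {z \<in> ?D. T1 z = k} = mu k" if "k \<ge> 1" for k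
    proof -
      have "{z \<in> ?D. T z = k} = p ` {z \<in> ?D. T1 z = k}"
      proof (intro equalityI subsetI)
        fix z assume z: "z \<in> {z \<in> ?D. T z = k}"
        then have "inv p z \<in> ?D" using permutes_in_image[OF permutes_inv[OF p(2)]] by simp
        moreover have pz: "p (inv p z) = z" using permutes_inverses[OF p(2)] by simp
        ultimately have "inv p z \<in> {z \<in> ?D. T1 z = k}" using z p(1) by simp
        then show "z \<in> p ` {z \<in> ?D. T1 z = k}" using pz by (metis imageI)
      next
        fix z assume "z \<in> p ` {z \<in> ?D. T1 z = k}"
        then obtain w where "w \<in> ?D" "T1 w = k" "z = p w" by blast
        then show "z \<in> {z \<in> ?D. T z = k}" using p(1) permutes_in_image[OF p(2)] by simp
      qed
      then have "card {z \<in> ?D. T z = k} = card {z \<in> ?D. T1 z = k}"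
        using permutes_inj_on[OF p(2)] by (simp add: card_image)
      then show ?thesis using T that by (auto simp: tableau_of_type_def)
    qed
    have "\<exists>h. bij_betw h {1..mu k} {z \<in> ?D. T1 z = k}" for k
    proof (cases "k \<ge> 1")
      case True
      then show ?thesis
        using cnt[OF True] fin
        by (intro finite_same_card_bij) simp_all
    next
      case False
      then have "k = 0" by simp
      moreover have "{z \<in> ?D. T1 z = 0} = {}" using pos by force
      moreover have "mu 0 = 0" using mu by (simp add: is_composition_def)
      ultimately show ?thesis by (auto simp: bij_betw_def)
    qed
    then have "\<forall>k. \<exists>h. bij_betw h {1..mu k} {z \<in> ?D. T1 z = k}" by blast
    from choice[OF this] obtain h where "\<forall>k. bij_betw (h k) {1..mu k} {z \<in> ?D. T1 z = k}" by blast
    then have h: "\<And>k. bij_betw (h k) {1..mu k} {z \<in> ?D. T1 z = k}" by blast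
    define g where "g = (\<lambda>(k, c). h k c)"
    have gk: "g ` {z \<in> diagram mu. fst z = k} = {z \<in> ?D. T1 z = k}" for k
    proof (cases "k \<ge> 1")
      case True
      then have "{z \<in> diagram mu. fst z = k} = Pair k ` {1..mu k}"
        by (auto simp: diagram_def)
      then show ?thesis using h[of k] by (simp add: g_def image_image bij_betw_def)
    next
      case False
      then have "{z \<in> ?D. T1 z = k} = {}" using pos by force
      moreover have "{z \<in> diagram mu. fst z = k} = {}" using False by (auto simp: diagram_def)
      ultimately show ?thesis by (simp only: image_empty)
    qed
    have "bij_betw g (diagram mu) ?D"
    proof (rule bij_betw_imageI)
      have T1g: "T1 (g z) = fst z" if "z \<in> diagram mu" for z
        using gk[of "fst z"] that by blast
      show "inj_on g (diagram mu)"
      proof (rule inj_onI)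
        fix z w assume zw: "z \<in> diagram mu" "w \<in> diagram mu" "g z = g w"
        then have f: "fst z = fst w" using T1g by metis
        then have "h (fst z) (snd z) = h (fst z) (snd w)"
          using zw by (simp add: g_def case_prod_beta)
        moreover have "snd z \<in> {1..mu (fst z)}" "snd w \<in> {1..mu (fst z)}"
          using zw f by (auto simp: diagram_def)
        ultimately have "snd z = snd w"
          using h[of "fst z"] by (meson bij_betw_def inj_onD)
        with f show "z = w" by (simp add: prod_eq_iff)
      qed
      show "g ` diagram mu = ?D"
      proof -
        have "g ` diagram mu = (\<Union>k. g ` {z \<in> diagram mu. fst z = k})" by auto
        then show ?thesis unfolding gk by auto
      qed
    qed
    then have "bij_betw (t \<circ> g) (diagram mu) {1..csize lam}" and "csize mu = csize lam"
      using t bij_betw_same_card by (auto simp: filling_def csize_def intro: bij_betw_trans)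
    then have "filling mu (t \<circ> g)" by (simp add: filling_def)
    moreover have "transfer_tabloid lam t T1 = tabloid_of mu (t \<circ> g)"
      by (simp only: tabloid_of_def transfer_tabloid_def image_comp[symmetric] gk)
    ultimately show ?thesis unfolding tabloids_def by blast
  qed
  have tf: "Theta_filling lam T t Y = (0::'a)" if "filling lam t" "Y \<notin> tabloids mu" for t Y
    unfolding Theta_filling_def tvec_sum_apply
    by (rule sum.neutral) (use main[OF that(1)] that(2) in \<open>auto simp: single_def\<close>)
  have c: "filling lam (SOME t. filling lam t \<and> tabloid_of lam t = X)" if "X \<in> tabloids lam" for X
  proof -
    have "\<exists>t. filling lam t \<and> tabloid_of lam t = X" using that by (auto simp: tabloids_def)
    then have "filling lam (SOME t. filling lam t \<and> tabloid_of lam t = X) \<and>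
      tabloid_of lam (SOME t. filling lam t \<and> tabloid_of lam t = X) = X" by (rule someI_ex)
    then show ?thesis by blast
  qed
  show ?thesis
    unfolding perm_module_def Theta_def
    by (auto simp: tvec_sum_apply tscale_def intro!: sum.neutral tf c)
qed

end

theory Submission
  imports Defs
begin

text \<open>
  Fix a filling \<open>t\<close>.  The coefficient in \<open>\<Theta>\<^sub>T(e\<^sub>t)\<close> of the tabloid in which the entry of
  \<open>t\<close> at each node lies in the row named by a tableau \<open>W\<close> is the number \<open>c\<^sub>T(W)\<close> of
  column permutations of \<open>W\<close>, counted with sign, that have the same row contents as \<open>T\<close>
  (\<open>Theta_polytabloid_coefficient\<close>).  If the columns of \<open>W\<close> strictly increase, then sorting
  its columns can only move small entries up, so \<open>c\<^sub>T(W) \<noteq> 0\<close> forces \<open>W\<close> to dominate \<open>T\<close>, and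
  \<open>c\<^sub>W(W) = 1\<close>.  Hence the system \<open>c\<^sub>T(W) = (\<Sum>S. a S * c\<^sub>S(W))\<close>, with \<open>W\<close> and \<open>S\<close> semistandard, is
  unitriangular for dominance, and the theorem amounts to two values of the left-hand side:
  \<open>c\<^sub>T(W) = 0\<close> when \<open>W\<close> does not dominate \<open>Re(\<lambda>)\<close>, and \<open>c\<^sub>T(W) = \<plusminus>1\<close> when \<open>W = Re(\<lambda>)\<close>.

  For fixed \<open>W\<close>, the number \<open>c\<^sub>T(W)\<close> depends only on the row contents of \<open>T\<close>, and as a
  function of these it satisfies the Garnir relations (\<open>garnir_alt_count\<close>).  Both values
  follow from a statement about an arbitrary functional \<open>\<Phi>\<close> satisfying these relations, lemma
  \<open>magic_value\<close>: if \<open>\<Phi>\<close> vanishes on all row contents that strictly dominate those of \<open>Re(\<lambda>)\<close>,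
  then \<open>\<Phi>(T) = \<plusminus>\<Phi>(Re(\<lambda>))\<close> for each magic \<open>T\<close>.

  This is proved by induction along the recursive definition of magic tableaux, and two facts
  make the induction work.  The first is that in characteristic \<open>p\<close> the functional
  \<open>U \<mapsto> \<Phi>(U\<^sup>+)\<close> satisfies the relations for the smaller partition
  (\<open>garnir_lift_rows\<close>): the corresponding relations for \<open>\<lambda>\<close> contain further terms, in which
  some 1s change their row, but such a term has a coefficient divisible by a binomial coefficient
  \<open>(j + p - 1) choose j\<close> with \<open>0 < j < p\<close>, or it has a 1 below a row that consists of 1s, and
  then \<open>\<Phi>\<close> vanishes on it.

  The second fact compares \<open>\<Phi>(S\<^sup>+)\<close> with \<open>\<Phi>(Re(\<lambda>))\<close> when \<open>S\<close> dominates the tableau \<open>Re\<close> of the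
  smaller partition (\<open>stage_value\<close>).  The 1s of \<open>S\<^sup>+\<close> are moved up, from row \<open>m\<close> to row
  \<open>m - 1\<close>, then all of them to row \<open>m - 2\<close>, and so on to row 1; each move exchanges the
  travelling 1s for other entries of the upper row, in every possible way.  Whatever entries
  are chosen, the result dominates \<open>Re(\<lambda>)\<close>.  It is equal to \<open>Re(\<lambda>)\<close> only if \<open>S\<close> is the
  smaller \<open>Re\<close> and if the entries taken from each row \<open>y\<close> are all equal to the least possible
  value \<open>y + 1\<close>, and this single choice has coefficient \<open>\<plusminus>1\<close>.
\<close>

section \<open>Functionals satisfying the Garnir relations\<close>

lemma finite_submultisets: "finite {C. C \<subseteq># M}"
proof (induction M)
  case (add x M)
  have "{C. C \<subseteq># add_mset x M} \<subseteq> {C. C \<subseteq># M} \<union> add_mset x ` {C. C \<subseteq># M}"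
  proof
    fix C assume C: "C \<in> {C. C \<subseteq># add_mset x M}"
    show "C \<in> {C. C \<subseteq># M} \<union> add_mset x ` {C. C \<subseteq># M}"
    proof (cases "x \<in># C")
      case True
      then obtain C' where "C = add_mset x C'" by (metis insert_DiffM)
      then show ?thesis using C by auto
    next
      case False
      have "C \<subseteq># M"
      proof (rule mset_subset_eqI)
        fix v show "count C v \<le> count M v"
          using False mset_subset_eq_count[of C "add_mset x M" v] C
          by (cases "v = x") (auto simp: not_in_iff)
      qed
      then show ?thesis by simp
    qed
  qed
  then show ?case using add by (auto intro: finite_subset)
qed simp

lemma replicate_mset_add: "replicate_mset (m + n) x = replicate_mset m x + replicate_mset n x"
  by (induction m) auto

text \<open>
  The number of ways to choose a sub-multiset \<open>A\<close> from \<open>A + B\<close> when equal elements are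
  distinguishable, as \<open>card_subsets_with_image\<close> makes precise.
\<close>
definition mchoose :: "'a multiset \<Rightarrow> 'a multiset \<Rightarrow> nat" where
  "mchoose A B = (\<Prod>v\<in>set_mset A. (count A v + count B v) choose count A v)"

lemma mchoose_superset:
  assumes "finite J" "set_mset A \<subseteq> J"
  shows "mchoose A B = (\<Prod>v\<in>J. (count A v + count B v) choose count A v)"
  unfolding mchoose_def
  by (rule prod.mono_neutral_left) (use assms in \<open>auto simp: not_in_iff\<close>)

lemma mchoose_eq_1:
  assumes "\<And>v. v \<in># A \<Longrightarrow> v \<notin># B" shows "mchoose A B = 1"
  unfolding mchoose_def by (rule prod.neutral) (use assms in \<open>auto simp: not_in_iff\<close>)

text \<open>
  Induction on \<open>R\<close>.  Splitting the subsets according to whether they contain the new point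
  gives Pascal's rule in the factor of its colour, and does not affect the other factors.  The
  fixed index set \<open>J\<close> keeps the product over the same set throughout the induction.
\<close>
lemma card_subsets_with_image_aux:
  assumes "finite J" "finite R" "V ` R \<subseteq> J" "set_mset A \<subseteq> J"
  shows "card {K. K \<subseteq> R \<and> image_mset V (mset_set K) = A}
    = (\<Prod>v\<in>J. count (image_mset V (mset_set R)) v choose count A v)"
  using assms(2-4)
proof (induction R arbitrary: A)
  case empty
  show ?case
  proof (cases "A = {#}")
    case True
    then have "{K. K \<subseteq> {} \<and> image_mset V (mset_set K) = A} = {{}}" by auto
    then show ?thesis using True by simp
  next
    case False
    then obtain v where v: "v \<in># A" by auto
    then have "(0::nat) choose count A v = 0" by (simp add: binomial_eq_0)
    then have "\<exists>v\<in>J. count (image_mset V (mset_set {})) v choose count A v = 0"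
      using v empty by (intro bexI[of _ v]) auto
    then have "(\<Prod>v\<in>J. count (image_mset V (mset_set {})) v choose count A v) = 0"
      using assms(1) by (meson prod_zero)
    moreover have "{K. K \<subseteq> {} \<and> image_mset V (mset_set K) = A} = {}" using False by auto
    ultimately show ?thesis by (metis card.empty)
  qed
next
  case (insert r R)
  let ?v = "V r"
  let ?c = "\<lambda>v. count (image_mset V (mset_set R)) v"
  let ?S = "\<lambda>A. {K. K \<subseteq> R \<and> image_mset V (mset_set K) = A}"
  have vJ: "?v \<in> J" using insert by auto
  have IH: "card (?S A) = (\<Prod>v\<in>J. ?c v choose count A v)" if "set_mset A \<subseteq> J" for A
    using insert that by auto
  have finS: "finite (?S A)" for A using insert(1) by auto
  have cnt: "count (image_mset V (mset_set (insert r R))) v = (if v = ?v then Suc (?c v) else ?c v)" for v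
    using insert(1,2) by simp
  have split: "{K. K \<subseteq> insert r R \<and> image_mset V (mset_set K) = A}
      = ?S A \<union> insert r ` {K. K \<subseteq> R \<and> add_mset ?v (image_mset V (mset_set K)) = A}"
  proof (intro equalityI subsetI)
    fix K assume K: "K \<in> {K. K \<subseteq> insert r R \<and> image_mset V (mset_set K) = A}"
    show "K \<in> ?S A \<union> insert r ` {K. K \<subseteq> R \<and> add_mset ?v (image_mset V (mset_set K)) = A}"
    proof (cases "r \<in> K")
      case True
      define K' where "K' = K - {r}"
      have KK: "K = insert r K'" "r \<notin> K'" "K' \<subseteq> R" using True K by (auto simp: K'_def)
      have "finite K'" using KK insert(1) finite_subset by blast
      then have "add_mset ?v (image_mset V (mset_set K')) = A" using K KK by simp
      then show ?thesis using KK by blast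
    next
      case False then show ?thesis using K by auto
    qed
  next
    fix K assume "K \<in> ?S A \<union> insert r ` {K. K \<subseteq> R \<and> add_mset ?v (image_mset V (mset_set K)) = A}"
    then show "K \<in> {K. K \<subseteq> insert r R \<and> image_mset V (mset_set K) = A}"
    proof
      assume "K \<in> insert r ` {K. K \<subseteq> R \<and> add_mset ?v (image_mset V (mset_set K)) = A}"
      then obtain K' where K': "K = insert r K'" "K' \<subseteq> R" "add_mset ?v (image_mset V (mset_set K')) = A" by auto
      then have "finite K'" "r \<notin> K'" using insert(1,2) finite_subset by auto
      then show ?thesis using K' by auto
    qed auto
  qed
  have cg: "(\<Prod>v\<in>J - {?v}. count (image_mset V (mset_set (insert r R))) v choose count A v)
      = (\<Prod>v\<in>J - {?v}. ?c v choose count A v)" for A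
  proof (rule prod.cong[OF refl])
    fix v assume "v \<in> J - {?v}"
    then have "v \<noteq> ?v" by auto
    then show "(count (image_mset V (mset_set (insert r R))) v choose count A v) = (?c v choose count A v)"
      by (simp only: cnt if_False)
  qed
  have rest: "(\<Prod>v\<in>J. f v) = f ?v * (\<Prod>v\<in>J - {?v}. f v)" for f
    using assms(1) vJ by (simp add: prod.remove)
  show ?case
  proof (cases "?v \<in># A")
    case False
    then have "{K. K \<subseteq> R \<and> add_mset ?v (image_mset V (mset_set K)) = A} = {}" by auto
    then have "card {K. K \<subseteq> insert r R \<and> image_mset V (mset_set K) = A} = card (?S A)"
      unfolding split by (simp only: image_empty Un_empty_right)
    also have "\<dots> = (\<Prod>v\<in>J - {?v}. ?c v choose count A v)"
      unfolding IH[OF insert.prems(2)] rest[of "\<lambda>v. ?c v choose count A v"]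
      using False by (simp add: not_in_iff)
    also have "\<dots> = (\<Prod>v\<in>J. count (image_mset V (mset_set (insert r R))) v choose count A v)"
      unfolding rest[of "\<lambda>v. count (image_mset V (mset_set (insert r R))) v choose count A v"] cg
      using False by (simp add: not_in_iff)
    finally show ?thesis .
  next
    case True
    then obtain A' where A': "A = add_mset ?v A'" by (metis insert_DiffM)
    have cA: "(\<Prod>v\<in>J - {?v}. ?c v choose count A v) = (\<Prod>v\<in>J - {?v}. ?c v choose count A' v)"
      by (rule prod.cong[OF refl]) (auto simp: A')
    have eq: "{K. K \<subseteq> R \<and> add_mset ?v (image_mset V (mset_set K)) = A} = ?S A'" using A' by auto
    have "card {K. K \<subseteq> insert r R \<and> image_mset V (mset_set K) = A} = card (?S A) + card (insert r ` ?S A')"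
      unfolding split eq using insert(2) finS by (intro card_Un_disjoint) auto
    also have "card (insert r ` ?S A') = card (?S A')"
    proof (intro card_image inj_onI)
      fix K K' assume "K \<in> ?S A'" "K' \<in> ?S A'" "insert r K = insert r K'"
      moreover from this have "r \<notin> K" "r \<notin> K'" using insert(2) by auto
      ultimately show "K = K'" by (metis insert_ident)
    qed
    also have "card (?S A) + card (?S A')
      = (\<Prod>v\<in>J. ?c v choose count A v) + (\<Prod>v\<in>J. ?c v choose count A' v)"
      using insert.prems A' by (simp add: IH)
    also have "\<dots> = (?c ?v choose count A ?v) * (\<Prod>v\<in>J - {?v}. ?c v choose count A v)
       + (?c ?v choose count A' ?v) * (\<Prod>v\<in>J - {?v}. ?c v choose count A v)"
      unfolding rest[of "\<lambda>v. ?c v choose count A v"] rest[of "\<lambda>v. ?c v choose count A' v"]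
      by (simp only: cA)
    also have "\<dots> = (Suc (?c ?v) choose count A ?v) * (\<Prod>v\<in>J - {?v}. ?c v choose count A v)"
      by (simp add: A' algebra_simps)
    also have "\<dots> = (\<Prod>v\<in>J. count (image_mset V (mset_set (insert r R))) v choose count A v)"
      unfolding rest[of "\<lambda>v. count (image_mset V (mset_set (insert r R))) v choose count A v"] cg
      by (simp only: cnt if_True simp_thms)
    finally show ?thesis .
  qed
qed

lemma card_subsets_with_image:
  assumes "finite R" "image_mset V (mset_set R) = A + B"
  shows "card {K. K \<subseteq> R \<and> image_mset V (mset_set K) = A} = mchoose A B"
proof -
  have "V ` R = set_mset (A + B)" using assms by (metis finite_set_mset_mset_set set_image_mset)
  then have "V ` R \<subseteq> set_mset (A + B)" "set_mset A \<subseteq> set_mset (A + B)" by auto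
  then show ?thesis
    using card_subsets_with_image_aux[OF _ assms(1), of "set_mset (A+B)" V A]
      mchoose_superset[of "set_mset (A+B)" A B] assms(2) by simp
qed

text \<open>
  A tableau enters only through its row contents, a family of multisets indexed by the row
  numbers.  The relation for rows \<open>x < x'\<close> starts from an overfull upper row \<open>A\<close> and an
  underfull lower row \<open>B\<close> and moves the surplus down in all possible ways; the coefficient is
  the number of ways to choose the arrived entries among those of the lower row.  In the
  language of bideterminants this is invariance under adding a multiple of row \<open>x\<close> to row
  \<open>x'\<close>.  The two rows need not be adjacent, which is what allows the relations to be
  transported across a deleted row.
\<close>
definition garnir :: "(nat \<Rightarrow> nat) \<Rightarrow> ((nat \<Rightarrow> nat multiset) \<Rightarrow> 'f::comm_ring_1) \<Rightarrow> bool" where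
  "garnir lam \<Phi> \<longleftrightarrow> (\<forall>N x x' A B. 1 \<le> x \<longrightarrow> x < x' \<longrightarrow> lam x < size A \<longrightarrow>
     size A + size B = lam x + lam x' \<longrightarrow>
     (\<Sum>C | C \<subseteq># A \<and> size C = size A - lam x.
        of_nat (mchoose C B) * \<Phi> (N(x := A - C, x' := C + B))) = 0)"

lemma garnirD:
  assumes "garnir lam \<Phi>" "1 \<le> x" "x < x'" "lam x < size A" "size A + size B = lam x + lam x'"
    "k = size A - lam x"
  shows "(\<Sum>C | C \<subseteq># A \<and> size C = k. of_nat (mchoose C B) * \<Phi> (N(x := A - C, x' := C + B))) = 0"
  using assms unfolding garnir_def by blast

lemma submultiset_replicate_split:
  assumes "C \<subseteq># replicate_mset n u + R" "u \<notin># R"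
  obtains i P where "i \<le> n" "C = replicate_mset i u + P" "P \<subseteq># R" "u \<notin># P"
    "replicate_mset n u + R - C = replicate_mset (n - i) u + (R - P)" "i = count C u"
proof -
  define P where "P = filter_mset (\<lambda>v. v \<noteq> u) C"
  let ?i = "count C u"
  have le: "count C v \<le> count (replicate_mset n u + R) v" for v
    using assms(1) by (rule mset_subset_eq_count)
  have Ru: "count R u = 0" using assms(2) by (simp add: not_in_iff)
  have i: "?i \<le> n" using le[of u] Ru by simp
  have C: "C = replicate_mset ?i u + P" by (rule multiset_eqI) (auto simp: P_def)
  have P: "P \<subseteq># R"
  proof (rule mset_subset_eqI)
    fix v show "count P v \<le> count R v" using le[of v] by (auto simp: P_def)
  qed
  have uP: "u \<notin># P" by (simp add: P_def)
  have D: "replicate_mset n u + R - C = replicate_mset (n - ?i) u + (R - P)"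
    by (rule multiset_eqI) (auto simp: P_def Ru)
  show ?thesis by (rule that[OF i C P uP D]) simp
qed

text \<open>
  All occurrences of \<open>u\<close> can be moved from row \<open>x'\<close> up to row \<open>x\<close>, at the cost of exchanging
  them for other entries \<open>P\<close> of row \<open>x\<close>: the relation in which the upper row contains all
  of them expresses the given family by families with fewer copies of \<open>u\<close> in row \<open>x'\<close>, and
  the process can be repeated.  In particular, a functional that vanishes on all possible
  results vanishes on the family at the start.
\<close>
lemma garnir_clear_zero:
  assumes g: "garnir lam \<Phi>" and x: "1 \<le> x" "x < x'"
  shows "a + size R = lam x \<Longrightarrow> b + size Q = lam x' \<Longrightarrow> u \<notin># R \<Longrightarrow> u \<notin># Q \<Longrightarrow>
    (\<And>P. P \<subseteq># R \<Longrightarrow> size P = b \<Longrightarrow> \<Phi> (N(x := replicate_mset (a + b) u + (R - P), x' := P + Q)) = 0) \<Longrightarrow>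
    \<Phi> (N(x := replicate_mset a u + R, x' := replicate_mset b u + Q)) = 0"
proof (induction b arbitrary: a R Q rule: less_induct)
  case (less b)
  show ?case
  proof (cases "b = 0")
    case True
    then show ?thesis using less.prems(5)[of "{#}"] by simp
  next
    case False
    let ?A = "replicate_mset (a + b) u + R"
    let ?S = "{C. C \<subseteq># ?A \<and> size C = b}"
    define f where "f C = of_nat (mchoose C Q) * \<Phi> (N(x := ?A - C, x' := C + Q))" for C
    let ?C0 = "replicate_mset b u"
    have finS: "finite ?S" by (rule finite_subset[OF _ finite_submultisets[of ?A]]) auto
    have C0: "?C0 \<in> ?S"
      by (auto simp: replicate_mset_add)
    have sum0: "sum f ?S = 0"
      unfolding f_def by (rule garnirD[OF g x]) (use less.prems False in auto)
    have other: "f C = 0" if C: "C \<in> ?S - {?C0}" for C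
    proof -
      have "C \<subseteq># ?A" using C by auto
      then obtain i P where i: "i \<le> a + b" "C = replicate_mset i u + P" "P \<subseteq># R" "u \<notin># P"
        "?A - C = replicate_mset (a + b - i) u + (R - P)"
        using submultiset_replicate_split[OF _ less.prems(3)] by metis
      have sz: "i + size P = b" using C i(2) by auto
      have ib: "i < b"
      proof (rule ccontr)
        assume "\<not> i < b"
        then have "i = b" "P = {#}" using sz by auto
        then show False using C i(2) by auto
      qed
      have "\<Phi> (N(x := replicate_mset (a + b - i) u + (R - P), x' := replicate_mset i u + (P + Q))) = 0"
      proof (rule less.IH[OF ib])
        show "a + b - i + size (R - P) = lam x"
          using less.prems(1) sz i(3) size_mset_mono[OF i(3)] by (simp add: size_Diff_submset)
        show "i + size (P + Q) = lam x'" using less.prems(2) sz by simp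
        show "u \<notin># R - P" using less.prems(3) in_diffD by fastforce
        show "u \<notin># P + Q" using less.prems(4) i(4) by auto
        fix P' assume P': "P' \<subseteq># R - P" "size P' = i"
        have "P + P' \<subseteq># R" using P'(1) i(3)
          by (metis subset_mset.le_diff_conv2 add.commute)
        moreover have "size (P + P') = b" using P' sz by simp
        ultimately have "\<Phi> (N(x := replicate_mset (a + b) u + (R - (P + P')), x' := P + P' + Q)) = 0"
          by (rule less.prems(5))
        then show "\<Phi> (N(x := replicate_mset (a + b - i + i) u + (R - P - P'), x' := P' + (P + Q))) = 0"
          using ib by (simp add: ac_simps)
      qed
      then show ?thesis using i by (simp add: f_def ac_simps)
    qed
    have "sum f ?S = f ?C0 + sum f (?S - {?C0})" by (rule sum.remove[OF finS C0])
    also have "sum f (?S - {?C0}) = 0" by (rule sum.neutral) (use other in blast)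
    finally have "f ?C0 = 0" using sum0 by (simp only: add_0_right)
    moreover have "mchoose ?C0 Q = 1" by (rule mchoose_eq_1) (use less.prems(4) in \<open>auto split: if_splits\<close>)
    moreover have "?A - ?C0 = replicate_mset a u + R" by (simp add: replicate_mset_add)
    ultimately show ?thesis by (simp add: f_def fun_upd_def)
  qed
qed

text \<open>
  The same process when \<open>\<Phi>\<close> vanishes on all results but one, the result in which the
  exchanged entries are \<open>b\<close> copies of a single value \<open>z\<close>.  The intermediate families that
  contribute have exchanged only copies of \<open>z\<close>, so that the number \<open>j\<close> of copies of \<open>z\<close> that
  are in row \<open>x'\<close> already must be arbitrary for the induction; the contributions add up to an
  alternating sum of binomial coefficients.
\<close>
lemma garnir_clear_one:
  assumes g: "garnir lam \<Phi>" and x: "1 \<le> x" "x < x'" and zu: "z \<noteq> u"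
    and uQ: "u \<notin># Q" and zQ: "z \<notin># Q"
  shows "a + size R = lam x \<Longrightarrow> b + j + size Q = lam x' \<Longrightarrow> u \<notin># R \<Longrightarrow> replicate_mset b z \<subseteq># R \<Longrightarrow>
    (\<And>P. P \<subseteq># R \<Longrightarrow> size P = b \<Longrightarrow> P \<noteq> replicate_mset b z \<Longrightarrow>
       \<Phi> (N(x := replicate_mset (a + b) u + (R - P), x' := P + (replicate_mset j z + Q))) = 0) \<Longrightarrow>
    \<Phi> (N(x := replicate_mset a u + R, x' := replicate_mset b u + (replicate_mset j z + Q)))
     = (-1) ^ b * of_nat ((b + j) choose b) *
       \<Phi> (N(x := replicate_mset (a + b) u + (R - replicate_mset b z), x' := replicate_mset (b + j) z + Q))"
proof (induction b arbitrary: a R j rule: less_induct)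
  case (less b)
  show ?case
  proof (cases "b = 0")
    case True
    then show ?thesis by simp
  next
    case False
    let ?Q = "replicate_mset j z + Q"
    let ?A = "replicate_mset (a + b) u + R"
    let ?S = "{C. C \<subseteq># ?A \<and> size C = b}"
    let ?f = "\<lambda>C. of_nat (mchoose C ?Q) * \<Phi> (N(x := ?A - C, x' := C + ?Q))"
    define \<Phi>0 where "\<Phi>0 = \<Phi> (N(x := replicate_mset (a + b) u + (R - replicate_mset b z), x' := replicate_mset (b + j) z + Q))"
    \<comment> \<open>The ways to move \<open>b\<close> entries down that use only copies of \<open>u\<close> and \<open>z\<close>.\<close>
    define gg where "gg i = replicate_mset i u + replicate_mset (b - i) z" for i
    have finS: "finite ?S" by (rule finite_subset[OF _ finite_submultisets[of ?A]]) auto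
    have sum0: "sum ?f ?S = 0"
      by (rule garnirD[OF g x]) (use less.prems False in auto)
    have uR: "count R u = 0" and uQ0: "count Q u = 0" and zQ0: "count Q z = 0"
      using less.prems(3) uQ zQ by (auto simp: not_in_iff)
    have zR: "b \<le> count R z" using mset_subset_eq_count[OF less.prems(4), of z] by simp
    have sub_z: "replicate_mset n z \<subseteq># R" if "n \<le> b" for n
      using zR that by (intro mset_subset_eqI) auto
    have gS: "gg ` {..b} \<subseteq> ?S"
    proof (rule image_subsetI)
      fix i assume "i \<in> {..b}"
      then have "gg i \<subseteq># ?A" using zR zu by (intro mset_subset_eqI) (auto simp: gg_def)
      then show "gg i \<in> ?S" using \<open>i \<in> {..b}\<close> by (simp add: gg_def)
    qed
    have inj: "inj_on gg {..b}"
    proof (rule inj_onI)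
      fix i i' assume "gg i = gg i'"
      then have "count (gg i) u = count (gg i') u" by simp
      then show "i = i'" using zu by (simp add: gg_def)
    qed
    have ext: "P + P' \<subseteq># R \<and> size (P + P') = b \<and> P + P' \<noteq> replicate_mset b z"
      if P: "P \<subseteq># R" "P' \<subseteq># R - P" "size P + size P' = b"
        and ne: "P \<noteq> replicate_mset (size P) z \<or> P' \<noteq> replicate_mset (size P') z" for P P'
    proof -
      have "P + P' \<subseteq># R" using P by (metis subset_mset.le_diff_conv2 add.commute)
      moreover have "P + P' \<noteq> replicate_mset b z"
      proof
        assume e: "P + P' = replicate_mset b z"
        have "set_mset P \<subseteq> {z}" "set_mset P' \<subseteq> {z}"
          using arg_cong[OF e, of set_mset] by (auto split: if_splits)
        then show False using ne set_mset_subset_singletonD by (metis size_replicate_mset)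
      qed
      ultimately show ?thesis using P(3) by simp
    qed
    have other: "?f C = 0" if C: "C \<in> ?S - gg ` {..b}" for C
    proof -
      have "C \<subseteq># ?A" using C by auto
      then obtain i P where i: "i \<le> a + b" "C = replicate_mset i u + P" "P \<subseteq># R" "u \<notin># P"
        "?A - C = replicate_mset (a + b - i) u + (R - P)"
        using submultiset_replicate_split[OF _ less.prems(3)] by metis
      have sz: "i + size P = b" using C i(2) by auto
      have Pne: "P \<noteq> replicate_mset (size P) z"
      proof
        assume "P = replicate_mset (size P) z"
        then have "P = replicate_mset (b - i) z" using sz by (metis add_diff_cancel_left')
        then have "C = gg i" using i(2) by (simp add: gg_def)
        then show False using C sz by auto
      qed
      have "\<Phi> (N(x := replicate_mset (a + b - i) u + (R - P), x' := replicate_mset i u + (P + ?Q))) = 0"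
      proof (rule garnir_clear_zero[OF g x])
        show "a + b - i + size (R - P) = lam x"
          using less.prems(1) sz i(3) size_mset_mono[OF i(3)] by (simp add: size_Diff_submset)
        show "i + size (P + ?Q) = lam x'" using less.prems(2) sz by simp
        show "u \<notin># R - P" using less.prems(3) in_diffD by fastforce
        show "u \<notin># P + ?Q" using uQ zu i(4) by (auto split: if_splits)
        fix P' assume P': "P' \<subseteq># R - P" "size P' = i"
        have "\<Phi> (N(x := replicate_mset (a + b) u + (R - (P + P')), x' := P + P' + ?Q)) = 0"
          by (rule less.prems(5)) (use ext[OF i(3) P'(1)] P' sz Pne in auto)
        then show "\<Phi> (N(x := replicate_mset (a + b - i + i) u + (R - P - P'), x' := P' + (P + ?Q))) = 0"
          using sz by (simp add: ac_simps)
      qed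
      then show ?thesis using i by (simp add: ac_simps)
    qed
    have mch: "mchoose (gg i) ?Q = (b + j - i) choose (b - i)" if "i \<le> b" for i
    proof -
      have "mchoose (gg i) ?Q = (\<Prod>v\<in>{u,z}. (count (gg i) v + count ?Q v) choose count (gg i) v)"
        by (rule mchoose_superset) (auto simp: gg_def split: if_splits)
      also have "\<dots> = (b + j - i) choose (b - i)"
        using zu uQ0 zQ0 that by (simp add: gg_def)
      finally show ?thesis .
    qed
    have diffg: "?A - gg i = replicate_mset (a + b - i) u + (R - replicate_mset (b - i) z)" if "i \<le> b" for i
      using that zu uR by (intro multiset_eqI) (auto simp: gg_def)
    have trm: "?f (gg i) = of_nat ((b + j) choose b) * ((-1) ^ i * of_nat (b choose i)) * \<Phi>0" if ib: "i < b" for i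
    proof -
      have sz: "size (replicate_mset (b - i) z) + i = b" using ib by simp
      have "\<Phi> (N(x := replicate_mset (a + b - i) u + (R - replicate_mset (b - i) z),
                x' := replicate_mset i u + (replicate_mset (b - i + j) z + Q)))
        = (-1) ^ i * of_nat ((i + (b - i + j)) choose i) *
          \<Phi> (N(x := replicate_mset (a + b - i + i) u + (R - replicate_mset (b - i) z - replicate_mset i z),
               x' := replicate_mset (i + (b - i + j)) z + Q))"
      proof (rule less.IH[OF ib])
        show "a + b - i + size (R - replicate_mset (b - i) z) = lam x"
          using less.prems(1) ib size_mset_mono[OF less.prems(4)] sub_z[of "b - i"]
          by (simp add: size_Diff_submset)
        show "i + (b - i + j) + size Q = lam x'" using less.prems(2) ib by simp
        show "u \<notin># R - replicate_mset (b - i) z" using less.prems(3) in_diffD by fastforce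
        show "replicate_mset i z \<subseteq># R - replicate_mset (b - i) z"
          using zR ib by (intro mset_subset_eqI) auto
        fix P' assume P': "P' \<subseteq># R - replicate_mset (b - i) z" "size P' = i" "P' \<noteq> replicate_mset i z"
        let ?P = "replicate_mset (b - i) z"
        have "\<Phi> (N(x := replicate_mset (a + b) u + (R - (?P + P')), x' := ?P + P' + ?Q)) = 0"
          by (rule less.prems(5)) (use ext[OF sub_z[of "b - i"] P'(1)] P' ib in auto)
        then show "\<Phi> (N(x := replicate_mset (a + b - i + i) u + (R - ?P - P'),
                        x' := P' + (replicate_mset (b - i + j) z + Q))) = 0"
          unfolding replicate_mset_add[of "b - i" j] using ib by (simp add: ac_simps replicate_mset_add)
      qed
      moreover have "R - replicate_mset (b - i) z - replicate_mset i z = R - replicate_mset b z"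
        using ib by (simp add: replicate_mset_add[symmetric])
      moreover have "replicate_mset i u + (replicate_mset (b - i + j) z + Q) = gg i + ?Q"
        by (simp add: gg_def replicate_mset_add ac_simps)
      moreover have "a + b - i + i = a + b" "i + (b - i + j) = b + j" using ib by auto
      ultimately have "\<Phi> (N(x := ?A - gg i, x' := gg i + ?Q)) = (-1) ^ i * of_nat ((b + j) choose i) * \<Phi>0"
        by (simp only: diffg[OF less_imp_le[OF ib]] \<Phi>0_def)
      then have "?f (gg i) = of_nat (((b + j) choose i) * ((b + j - i) choose (b - i))) * (-1) ^ i * \<Phi>0"
        using ib by (simp add: mch)
      also have "((b + j) choose i) * ((b + j - i) choose (b - i)) = ((b + j) choose b) * (b choose i)"
        using choose_mult[of i b "b + j"] ib by simp
      finally show ?thesis by (simp add: fun_upd_def mult_ac)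
    qed
    have "0 = sum ?f (gg ` {..b})"
      unfolding sum0[symmetric] by (rule sum.mono_neutral_right[OF finS gS]) (use other in blast)
    also have "\<dots> = (\<Sum>i\<le>b. ?f (gg i))" by (rule sum.reindex_cong[OF inj]) auto
    also have "\<dots> = (\<Sum>i<b. ?f (gg i)) + ?f (gg b)" by (simp add: lessThan_Suc_atMost[symmetric])
    also have "(\<Sum>i<b. ?f (gg i)) = of_nat ((b + j) choose b) * (\<Sum>i<b. (-1) ^ i * of_nat (b choose i)) * \<Phi>0"
      by (simp add: trm sum_distrib_left sum_distrib_right)
    also have "(\<Sum>i<b. (-1) ^ i * of_nat (b choose i)) = - ((-1) ^ b :: 'a)"
      using choose_alternating_sum[of b, where 'a='a] False
      by (simp add: lessThan_Suc_atMost[symmetric] eq_neg_iff_add_eq_0)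
    also have "?f (gg b) = \<Phi> (N(x := replicate_mset a u + R, x' := replicate_mset b u + ?Q))"
      unfolding mch[OF order_refl] diffg[OF order_refl] by (simp add: gg_def)
    finally show ?thesis unfolding \<Phi>0_def by (simp add: algebra_simps fun_upd_def)
  qed
qed

section \<open>Moving the ones up to the first row\<close>

text \<open>
  The numbers that are compared in the dominance order (\<open>dominates_iff_ncount\<close>).
\<close>
definition ncount :: "(nat \<Rightarrow> nat multiset) \<Rightarrow> nat \<Rightarrow> nat \<Rightarrow> nat" where
  "ncount N l r = (\<Sum>y\<le>r. size (filter_mset (\<lambda>v. v \<le> l) (N y)))"

text \<open>
  The row contents on which a functional will be required to vanish, except for \<open>G\<close> itself.
  The bound on the entries excludes contents that no tableau with strictly increasing columns
  has; in \<open>stage_move\<close> it ensures that the entries taken from row \<open>x\<close> exceed \<open>x\<close>.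
\<close>
definition dominating_rows :: "(nat \<Rightarrow> nat) \<Rightarrow> (nat \<Rightarrow> nat multiset) \<Rightarrow> (nat \<Rightarrow> nat multiset) \<Rightarrow> bool" where
  "dominating_rows lam G N \<longleftrightarrow> (\<forall>y. size (N y) = lam y) \<and> (\<forall>y. \<forall>v\<in>#N y. y \<le> v) \<and>
     (\<forall>l r. ncount G l r \<le> ncount N l r)"

lemma ncount_two_rows:
  assumes "\<And>y. y \<noteq> x \<Longrightarrow> y \<noteq> Suc x \<Longrightarrow> N' y = N y" and "N' x + N' (Suc x) = N x + N (Suc x)" and "r \<noteq> x"
  shows "ncount N' l r = ncount N l r"
proof (cases "r < x")
  case True
  then show ?thesis unfolding ncount_def by (intro sum.cong) (use assms(1) in auto)
next
  case False
  let ?c = "\<lambda>M. size (filter_mset (\<lambda>v. v \<le> l) M)"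
  have dec: "ncount N l r = (\<Sum>y\<in>{..r} - {x, Suc x}. ?c (N y)) + ?c (N x + N (Suc x))" for N
  proof -
    have "{x, Suc x} \<subseteq> {..r}" using False assms(3) by auto
    then have "ncount N l r = (\<Sum>y\<in>{..r} - {x, Suc x}. ?c (N y)) + (\<Sum>y\<in>{x, Suc x}. ?c (N y))"
      unfolding ncount_def by (intro sum.subset_diff) auto
    then show ?thesis by simp
  qed
  have "(\<Sum>y\<in>{..r} - {x, Suc x}. ?c (N' y)) = (\<Sum>y\<in>{..r} - {x, Suc x}. ?c (N y))"
    by (intro sum.cong) (use assms(1) in auto)
  then show ?thesis unfolding dec assms(2) by simp
qed

lemma ncount_last: "ncount N l r = (\<Sum>y<r. size (filter_mset (\<lambda>v. v \<le> l) (N y))) + size (filter_mset (\<lambda>v. v \<le> l) (N r))"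
  unfolding ncount_def by (simp add: lessThan_Suc_atMost[symmetric])

lemma size_filter_replicate: "size (filter_mset P (replicate_mset n x)) = (if P x then n else 0)"
  by (induction n) auto

lemma replicate_mset_eqI:
  assumes "count M z = size M" shows "M = replicate_mset (size M) z"
proof -
  have "size (filter_mset (\<lambda>v. v \<noteq> z) M) + size (filter_mset (\<lambda>v. v = z) M) = size M"
    by (metis (no_types, lifting) filter_mset_cong multiset_partition size_union add.commute)
  moreover have "size (filter_mset (\<lambda>v. v = z) M) = count M z"
    by (simp add: filter_eq_replicate_mset)
  ultimately have "filter_mset (\<lambda>v. v \<noteq> z) M = {#}" using assms by simp
  then have "{v \<in> set_mset M. v \<noteq> z} = {}" by (metis set_mset_empty set_mset_filter)
  then have "set_mset M \<subseteq> {z}" by auto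
  then show ?thesis by (metis set_mset_subset_singletonD size_replicate_mset)
qed

text \<open>
  Here \<open>G\<close> stands for the row contents of \<open>Re(\<lambda>)\<close>.  Its row \<open>y \<le> m\<close> begins with
  \<open>full_len y\<close> copies of the least possible entry \<open>y\<close>, followed by a \<open>tail\<close> of larger
  entries, and \<open>q\<close> is \<open>p - 1\<close>.
\<close>
locale ladder =
  fixes lam :: "nat \<Rightarrow> nat" and \<Phi> :: "(nat \<Rightarrow> nat multiset) \<Rightarrow> 'f::comm_ring_1"
    and q m :: nat and full_len :: "nat \<Rightarrow> nat" and tail G :: "nat \<Rightarrow> nat multiset"
  assumes garnir: "garnir lam \<Phi>"
    and full_len_step: "\<And>y. 1 \<le> y \<Longrightarrow> y < m \<Longrightarrow> full_len y = q + full_len (Suc y)"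
    and G_row: "\<And>y. 1 \<le> y \<Longrightarrow> y \<le> m \<Longrightarrow> G y = replicate_mset (full_len y) y + tail y"
    and tail_gt: "\<And>y v. 1 \<le> y \<Longrightarrow> y \<le> m \<Longrightarrow> v \<in># tail y \<Longrightarrow> y < v"
    and vanish: "\<And>N. dominating_rows lam G N \<Longrightarrow> N \<noteq> G \<Longrightarrow> \<Phi> N = 0"
begin

text \<open>
  The families \<open>rung m, \<dots>, rung 1\<close> lead from the row contents of \<open>Re\<close> of the smaller
  partition, with the operation \<open>U\<^sup>+\<close> applied, to \<open>G\<close>.  On \<open>rung x\<close> the 1s of rows
  \<open>x, \<dots>, m\<close> have been collected in row \<open>x\<close>, and below row \<open>x\<close> the family agrees with \<open>G\<close>
  already.
\<close>
definition rung :: "nat \<Rightarrow> nat \<Rightarrow> nat multiset" where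
  "rung x y = (if y = 0 \<or> x < y then G y
     else if y < x then replicate_mset q 1 + (replicate_mset (full_len (Suc y)) (Suc y) + tail y)
     else replicate_mset (full_len x) 1 + tail x)"

text \<open>
  What remains true of an arbitrary family of row contents while its 1s climb to row \<open>x\<close>.
  Comparing it with \<open>rung x\<close> rather than with \<open>G\<close> makes dominance an invariant.
\<close>
definition stage :: "nat \<Rightarrow> (nat \<Rightarrow> nat multiset) \<Rightarrow> bool" where
  "stage x N \<longleftrightarrow> (\<forall>y. size (N y) = lam y) \<and> (\<forall>y>x. \<forall>v\<in>#N y. y \<le> v) \<and>
     (\<forall>y. 1 \<le> y \<longrightarrow> y < x \<longrightarrow> (\<exists>R. N y = replicate_mset q 1 + R \<and> (\<forall>v\<in>#R. y < v))) \<and>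
     (\<exists>Q. N x = replicate_mset (full_len x) 1 + Q \<and> (\<forall>v\<in>#Q. x < v)) \<and>
     (\<forall>l r. ncount (rung x) l r \<le> ncount N l r)"

lemma rung_1: "1 \<le> m \<Longrightarrow> rung 1 = G"
proof
  fix y assume "1 \<le> m"
  then show "rung 1 y = G y" by (cases "y = 1") (auto simp: rung_def G_row)
qed

lemma stage_1_dominating: "1 \<le> m \<Longrightarrow> stage 1 N \<Longrightarrow> dominating_rows lam G N"
proof -
  assume m: "1 \<le> m" and st: "stage 1 N"
  then obtain Q where Q: "N 1 = replicate_mset (full_len 1) 1 + Q" "\<forall>v\<in>#Q. 1 < v"
    by (auto simp: stage_def)
  have "\<forall>v\<in>#N y. y \<le> v" for y
  proof (cases "y > 1")
    case False
    then consider "y = 0" | "y = 1" by linarith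
    then show ?thesis using Q by cases (auto split: if_splits)
  qed (use st in \<open>auto simp: stage_def\<close>)
  then show ?thesis using st m unfolding dominating_rows_def stage_def rung_1[OF m] by blast
qed

text \<open>
  One step of the climb: the 1s of row \<open>Suc x\<close> change places with the entries \<open>P\<close> of row
  \<open>x\<close>.
\<close>
definition move :: "nat \<Rightarrow> (nat \<Rightarrow> nat multiset) \<Rightarrow> nat multiset \<Rightarrow> nat multiset \<Rightarrow> nat multiset \<Rightarrow> (nat \<Rightarrow> nat multiset)" where
  "move x N R Q P = N(x := replicate_mset (full_len x) 1 + (R - P), Suc x := P + Q)"

context
  fixes x N R Q
  assumes x: "1 \<le> x" "Suc x \<le> m" and st: "stage (Suc x) N"
    and R: "N x = replicate_mset q 1 + R" "\<forall>v\<in>#R. x < v"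
    and Q: "N (Suc x) = replicate_mset (full_len (Suc x)) 1 + Q" "\<forall>v\<in>#Q. Suc x < v"
begin

lemma fx: "full_len x = q + full_len (Suc x)" using full_len_step x by simp

text \<open>
  Only the number of entries at most \<open>l\<close> in the first \<open>x\<close> rows is affected.  The gain from the
  1s is the same for the family and for the rung.  The family loses the entries of \<open>P\<close> that are
  at most \<open>l\<close>, whereas the rung loses \<open>full_len (Suc x)\<close> copies of \<open>Suc x\<close>.  As \<open>P\<close> has the same size and its entries are at least
  \<open>Suc x\<close>, the loss is not greater than that of the rung, and dominance persists.
\<close>
lemma stage_move:
  assumes P: "P \<subseteq># R" "size P = full_len (Suc x)"
  shows "stage x (move x N R Q P)"
  unfolding stage_def
proof (intro conjI allI impI)
  let ?b = "full_len (Suc x)" and ?N' = "move x N R Q P"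
  have sz: "size (N y) = lam y" for y using st by (simp add: stage_def)
  have sR: "q + size R = lam x" using sz[of x] R by simp
  have sQ: "?b + size Q = lam (Suc x)" using sz[of "Suc x"] Q by simp
  have bR: "?b \<le> size R" using P size_mset_mono by fastforce
  have "size (replicate_mset (full_len x) 1 + (R - P)) = lam x"
    using sR P bR unfolding size_union size_Diff_submset[OF P(1)] by (simp add: fx)
  then show "size (?N' y) = lam y" for y
    using sQ sz P by (simp add: move_def)
  have Pgt: "x < v" if "v \<in># P" for v using mset_subset_eqD[OF P(1) that] R(2) by simp
  show "\<forall>v\<in>#?N' y. y \<le> v" if "x < y" for y
  proof (cases "y = Suc x")
    case True
    then show ?thesis using Q(2) Pgt by (auto simp: move_def intro: less_imp_le Suc_leI)
  next
    case False
    then show ?thesis using st that by (auto simp: move_def stage_def)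
  qed
  show "\<exists>R. ?N' y = replicate_mset q 1 + R \<and> (\<forall>v\<in>#R. y < v)" if "1 \<le> y" "y < x" for y
    using st that by (auto simp: move_def stage_def)
  have "\<forall>v\<in>#R - P. x < v" using R(2) by (auto dest: in_diffD)
  then show "\<exists>Q. ?N' x = replicate_mset (full_len x) 1 + Q \<and> (\<forall>v\<in>#Q. x < v)"
    by (auto simp: move_def)
  fix l r
  have dom: "ncount (rung (Suc x)) l r \<le> ncount N l r" using st by (simp add: stage_def)
  have Kx: "rung x y = rung (Suc x) y" if "y \<noteq> x" "y \<noteq> Suc x" for y
    using that by (auto simp: rung_def)
  show "ncount (rung x) l r \<le> ncount ?N' l r"
  proof (cases "r = x")
    case False
    have "ncount ?N' l r = ncount N l r"
    proof (rule ncount_two_rows)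
      show "?N' x + ?N' (Suc x) = N x + N (Suc x)"
      proof (rule multiset_eqI)
        show "count (?N' x + ?N' (Suc x)) v = count (N x + N (Suc x)) v" for v
          using mset_subset_eq_count[OF P(1), of v] by (auto simp add: move_def R Q fx)
      qed
    qed (use False in \<open>auto simp: move_def\<close>)
    moreover have "ncount (rung x) l r = ncount (rung (Suc x)) l r"
    proof (rule ncount_two_rows[OF Kx _ False])
      show "rung x x + rung x (Suc x) = rung (Suc x) x + rung (Suc x) (Suc x)"
        using x by (simp add: rung_def fx G_row replicate_mset_add ac_simps)
    qed
    ultimately show ?thesis using dom by simp
  next
    case True
    let ?c = "\<lambda>M. size (filter_mset (\<lambda>v. v \<le> l) M)"
    have "(\<Sum>y<x. ?c (rung (Suc x) y)) = (\<Sum>y<x. ?c (rung x y))"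
      by (intro sum.cong) (use Kx in auto)
    moreover have "(\<Sum>y<x. ?c (?N' y)) = (\<Sum>y<x. ?c (N y))"
      by (intro sum.cong) (auto simp: move_def)
    moreover have "?c (?N' x) + ?c P = ?c (N x) + (if 1 \<le> l then ?b else 0)"
    proof -
      have "?N' x + P = N x + replicate_mset ?b 1"
      proof (rule multiset_eqI)
        show "count (?N' x + P) v = count (N x + replicate_mset ?b 1) v" for v
          using mset_subset_eq_count[OF P(1), of v] by (auto simp add: move_def R fx)
      qed
      from arg_cong[OF this, of ?c] show ?thesis by (simp add: size_filter_replicate)
    qed
    moreover have "?c (rung x x) + (if Suc x \<le> l then ?b else 0) = ?c (rung (Suc x) x) + (if 1 \<le> l then ?b else 0)"
      using x by (simp add: rung_def fx replicate_mset_add size_filter_replicate)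
    moreover have "?c P \<le> (if Suc x \<le> l then ?b else 0)"
    proof (cases "Suc x \<le> l")
      case True
      then show ?thesis using P(2) size_filter_mset_lesseq[of "\<lambda>v. v \<le> l" P] by simp
    next
      case False
      then have "filter_mset (\<lambda>v. v \<le> l) P = {#}" using Pgt by (intro multiset_eqI) (fastforce simp: not_in_iff[symmetric] count_eq_zero_iff)
      then have "?c P = 0" by (metis size_empty)
      then show ?thesis by linarith
    qed
    ultimately show ?thesis using dom unfolding True ncount_last by linarith
  qed
qed

text \<open>
  The value \<open>Suc x\<close> occurs in row \<open>Suc x\<close> of \<open>rung x\<close> exactly \<open>full_len (Suc x)\<close> times, and it
  can have come there only through \<open>P\<close>, which has just that size.
\<close>
lemma move_eq_rung:
  assumes P: "P \<subseteq># R" "size P = full_len (Suc x)" and eq: "move x N R Q P = rung x"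
  shows "N = rung (Suc x)" "P = replicate_mset (full_len (Suc x)) (Suc x)"
proof -
  let ?b = "full_len (Suc x)"
  have "replicate_mset (full_len x) 1 + (R - P) = replicate_mset (full_len x) 1 + tail x"
    using fun_cong[OF eq, of x] x by (simp add: move_def rung_def)
  then have RP: "R - P = tail x" by simp
  have PQ: "P + Q = replicate_mset ?b (Suc x) + tail (Suc x)"
    using fun_cong[OF eq, of "Suc x"] x by (simp add: move_def rung_def G_row)
  have "count Q (Suc x) = 0" "count (tail (Suc x)) (Suc x) = 0"
    using Q(2) tail_gt[of "Suc x" "Suc x"] x by (auto simp: not_in_iff[symmetric])
  then have "count P (Suc x) = ?b" using arg_cong[OF PQ, of "\<lambda>M. count M (Suc x)"] by simp
  then show Pr: "P = replicate_mset ?b (Suc x)" using replicate_mset_eqI P(2) by metis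
  then have QH: "Q = tail (Suc x)" using PQ by simp
  have RH: "R = replicate_mset ?b (Suc x) + tail x"
    using RP P(1) Pr by (metis subset_mset.add_diff_inverse)
  show "N = rung (Suc x)"
  proof
    fix y
    consider "y = x" | "y = Suc x" | "y \<noteq> x" "y \<noteq> Suc x" by blast
    then show "N y = rung (Suc x) y"
    proof cases
      case 3
      then show ?thesis using fun_cong[OF eq, of y] by (auto simp: move_def rung_def split: if_splits)
    qed (use x R Q RH QH in \<open>auto simp: rung_def\<close>)
  qed
qed

lemma stage_step:
  assumes IH: "\<And>N'. stage x N' \<Longrightarrow> (N' \<noteq> rung x \<longrightarrow> \<Phi> N' = 0) \<and> (N' = rung x \<longrightarrow> \<Phi> N' = \<Phi> G \<or> \<Phi> N' = - \<Phi> G)"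
  shows "(N \<noteq> rung (Suc x) \<longrightarrow> \<Phi> N = 0) \<and> (N = rung (Suc x) \<longrightarrow> \<Phi> N = \<Phi> G \<or> \<Phi> N = - \<Phi> G)"
proof (intro conjI impI)
  let ?b = "full_len (Suc x)"
  have sz: "size (N y) = lam y" for y using st by (simp add: stage_def)
  have sR: "q + size R = lam x" using sz[of x] R by simp
  have sQ: "?b + size Q = lam (Suc x)" using sz[of "Suc x"] Q by simp
  have oneR: "1 \<notin># R" and oneQ: "1 \<notin># Q" using R(2) Q(2) x by auto
  have N: "N = N(x := replicate_mset q 1 + R, Suc x := replicate_mset ?b 1 + Q)"
    using R(1) Q(1) by (auto simp: fun_eq_iff)
  have mv: "move x N R Q P = N(x := replicate_mset (q + ?b) 1 + (R - P), Suc x := P + Q)" for P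
    by (simp add: move_def fx)
  {
    assume ne: "N \<noteq> rung (Suc x)"
    have "\<Phi> (N(x := replicate_mset q 1 + R, Suc x := replicate_mset ?b 1 + Q)) = 0"
    proof (rule garnir_clear_zero[OF garnir x(1) _ sR sQ oneR oneQ])
      fix P assume P: "P \<subseteq># R" "size P = ?b"
      then have "move x N R Q P \<noteq> rung x" using move_eq_rung ne by blast
      then show "\<Phi> (N(x := replicate_mset (q + ?b) 1 + (R - P), Suc x := P + Q)) = 0"
        using IH[OF stage_move[OF P]] unfolding mv by blast
    qed simp
    then show "\<Phi> N = 0" using N by simp
  next
    assume e: "N = rung (Suc x)"
    have "replicate_mset q 1 + R = replicate_mset q 1 + (replicate_mset ?b (Suc x) + tail x)"
      using fun_cong[OF e, of x] x unfolding R(1) by (simp add: rung_def)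
    then have RH: "R = replicate_mset ?b (Suc x) + tail x" by simp
    have "replicate_mset ?b 1 + Q = replicate_mset ?b 1 + tail (Suc x)"
      using fun_cong[OF e, of "Suc x"] x unfolding Q(1) by (simp add: rung_def)
    then have QH: "Q = tail (Suc x)" by simp
    have "\<Phi> (N(x := replicate_mset q 1 + R, Suc x := replicate_mset ?b 1 + (replicate_mset 0 (Suc x) + Q)))
      = (-1) ^ ?b * of_nat ((?b + 0) choose ?b) *
        \<Phi> (N(x := replicate_mset (q + ?b) 1 + (R - replicate_mset ?b (Suc x)), Suc x := replicate_mset (?b + 0) (Suc x) + Q))"
    proof (rule garnir_clear_one[OF garnir x(1)])
      fix P assume P: "P \<subseteq># R" "size P = ?b" "P \<noteq> replicate_mset ?b (Suc x)"
      then have "move x N R Q P \<noteq> rung x" using move_eq_rung by blast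
      then have "\<Phi> (move x N R Q P) = 0" using IH[OF stage_move[OF P(1,2)]] by blast
      then show "\<Phi> (N(x := replicate_mset (q + ?b) 1 + (R - P), Suc x := P + (replicate_mset 0 (Suc x) + Q))) = 0"
        by (simp add: mv)
    qed (use sR sQ oneR oneQ Q(2) RH x in auto)
    moreover have mvK: "N(x := replicate_mset (q + ?b) 1 + (R - replicate_mset ?b (Suc x)), Suc x := replicate_mset (?b + 0) (Suc x) + Q) = rung x"
      using RH QH e x by (auto simp: fun_eq_iff rung_def fx G_row)
    ultimately have "\<Phi> N = (-1) ^ ?b * \<Phi> (rung x)" using N by simp
    moreover have "stage x (rung x)"
    proof -
      have "replicate_mset ?b (Suc x) \<subseteq># R" by (simp add: RH)
      from stage_move[OF this] have "stage x (move x N R Q (replicate_mset ?b (Suc x)))" by simp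
      moreover have "move x N R Q (replicate_mset ?b (Suc x)) = rung x"
        unfolding mv mvK[symmetric] by simp
      ultimately show ?thesis by simp
    qed
    then have "\<Phi> (rung x) = \<Phi> G \<or> \<Phi> (rung x) = - \<Phi> G" using IH by blast
    ultimately show "\<Phi> N = \<Phi> G \<or> \<Phi> N = - \<Phi> G"
      by (cases "even ?b") auto
  }
qed

end

text \<open>
  By induction, a family at stage \<open>x\<close> leads to families at stage 1, and these are \<open>G\<close> or
  dominate \<open>G\<close> strictly.  By \<open>move_eq_rung\<close> only the rungs lead to \<open>G\<close>, in a single way.
\<close>
lemma stage_value:
  "1 \<le> x \<Longrightarrow> x \<le> m \<Longrightarrow> stage x N \<Longrightarrow>
    (N \<noteq> rung x \<longrightarrow> \<Phi> N = 0) \<and> (N = rung x \<longrightarrow> \<Phi> N = \<Phi> G \<or> \<Phi> N = - \<Phi> G)"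
proof (induction x arbitrary: N rule: nat_induct_at_least)
  case base
  then show ?case using rung_1 stage_1_dominating[of N] vanish[of N] by auto
next
  case (Suc x)
  from Suc.prems obtain Q where Q: "N (Suc x) = replicate_mset (full_len (Suc x)) 1 + Q" "\<forall>v\<in>#Q. Suc x < v"
    by (auto simp: stage_def)
  from Suc.prems Suc.hyps obtain R where R: "N x = replicate_mset q 1 + R" "\<forall>v\<in>#R. x < v"
    by (auto simp: stage_def)
  show ?case
    by (rule stage_step[OF Suc.hyps Suc.prems(1,2) R Q]) (use Suc in auto)
qed

end

section \<open>Garnir relations and the operation U to U-plus\<close>

text \<open>
  The successor, except that 0 is fixed.  Entries of tableaux are positive, so that this is the
  increment in the definition of \<open>U\<^sup>+\<close>; fixing 0 keeps the value 1 out of the range for all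
  multisets of natural numbers.
\<close>
definition bump :: "nat \<Rightarrow> nat" where
  "bump v = (if v = 0 then 0 else Suc v)"

lemma inj_bump: "inj bump"
  by (auto simp: inj_def bump_def split: if_splits)

lemma bump_neq_1: "bump v \<noteq> 1" "bump v \<noteq> Suc 0"
  by (auto simp: bump_def)

text \<open>
  The row contents of \<open>U\<^sup>+\<close> in terms of those of \<open>U\<close> (\<open>rows_of_tplus\<close>), where \<open>q\<close> is \<open>p - 1\<close>
  and \<open>c\<close> is the length of the inserted row \<open>m\<close>.
\<close>
definition lift_rows :: "nat \<Rightarrow> nat \<Rightarrow> nat \<Rightarrow> (nat \<Rightarrow> nat multiset) \<Rightarrow> nat \<Rightarrow> nat multiset" where
  "lift_rows q m c N y =
     (if y = 0 then N 0
      else if y < m then replicate_mset q 1 + image_mset bump (N y)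
      else if y = m then replicate_mset c 1
      else image_mset bump (N (y - 1)))"

text \<open>
  If the upper row of a relation consists of copies of \<open>u\<close> only, there is a single way to move
  the surplus, so that the relation has a single term.
\<close>
lemma garnir_excess_ones:
  assumes g: "garnir lam \<Phi>" and m: "1 \<le> m" "m < z"
    and M: "M m = replicate_mset (lam m) u" "size (M z) = lam z" "u \<in># M z"
  shows "\<Phi> M = 0"
proof -
  define j where "j = count (M z) u"
  define B where "B = filter_mset (\<lambda>v. v \<noteq> u) (M z)"
  have Mz: "M z = replicate_mset j u + B" by (rule multiset_eqI) (auto simp: j_def B_def)
  have j: "j > 0" using M(3) by (simp add: j_def)
  let ?A = "replicate_mset (lam m + j) u"
  have "{C. C \<subseteq># ?A \<and> size C = j} = {replicate_mset j u}"
  proof (intro equalityI subsetI)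
    fix C assume C: "C \<in> {C. C \<subseteq># ?A \<and> size C = j}"
    then have "set_mset C \<subseteq> {u}" using set_mset_mono[of C ?A] by (auto split: if_splits)
    then have "C = replicate_mset (size C) u" by (metis set_mset_subset_singletonD size_replicate_mset)
    then show "C \<in> {replicate_mset j u}" using C by simp
  qed (auto simp: replicate_mset_add)
  moreover have "(\<Sum>C | C \<subseteq># ?A \<and> size C = j. of_nat (mchoose C B) * \<Phi> (M(m := ?A - C, z := C + B))) = 0"
    by (rule garnirD[OF g m]) (use M(2) Mz j in auto)
  moreover have "mchoose (replicate_mset j u) B = 1"
    by (rule mchoose_eq_1) (auto simp: B_def split: if_splits)
  moreover have "M(m := ?A - replicate_mset j u, z := replicate_mset j u + B) = M"
    using Mz M(1) by (auto simp: fun_eq_iff replicate_mset_add)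
  ultimately show ?thesis by simp
qed

text \<open>
  Adding \<open>j\<close> and \<open>p - 1\<close> in base \<open>p\<close> produces a carry.
\<close>
lemma prime_dvd_choose_pred:
  assumes "prime (p::nat)" "1 \<le> j" "j < p"
  shows "p dvd (j + (p - 1)) choose j"
proof -
  have "fact j * fact (p - 1) * ((j + (p - 1)) choose j) = (fact (j + (p - 1)) :: nat)"
    using binomial_fact_lemma[of j "j + (p - 1)"] by simp
  moreover have "p dvd fact (j + (p - 1))"
    using assms by (simp add: prime_dvd_fact_iff)
  ultimately have "p dvd fact j * fact (p - 1) * ((j + (p - 1)) choose j)" by metis
  moreover have "\<not> p dvd fact j" "\<not> p dvd fact (p - 1)"
    using assms prime_gt_0_nat[of p] by (auto simp: prime_dvd_fact_iff)
  ultimately show ?thesis using assms(1) by (simp add: prime_dvd_mult_iff)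
qed

lemma submultiset_of_image:
  assumes "C \<subseteq># image_mset g A" shows "\<exists>C'. C' \<subseteq># A \<and> C = image_mset g C'"
  using assms
proof (induction A arbitrary: C)
  case (add x A)
  show ?case
  proof (cases "g x \<in># C")
    case True
    then obtain D where D: "C = add_mset (g x) D" by (metis insert_DiffM)
    then obtain D' where "D' \<subseteq># A" "D = image_mset g D'" using add by auto
    then show ?thesis using D by (intro exI[of _ "add_mset x D'"]) auto
  next
    case False
    have "C \<subseteq># image_mset g A"
    proof (rule mset_subset_eqI)
      fix v show "count C v \<le> count (image_mset g A) v"
        using False mset_subset_eq_count[OF add.prems, of v]
        by (cases "v = g x") (auto simp: not_in_iff)
    qed
    then obtain C' where "C' \<subseteq># A" "C = image_mset g C'" using add.IH by blast
    then show ?thesis by (intro exI[of _ C']) (auto intro: subset_mset.order_trans)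
  qed
qed auto

lemma count_image_inj: "inj g \<Longrightarrow> count (image_mset g M) (g v) = count M v"
  by (induction M) (auto simp: inj_def)

lemma inj_image_mset_bump: "inj (image_mset bump)"
proof (rule injI)
  fix M M' assume "image_mset bump M = image_mset bump M'"
  then have "count M v = count M' v" for v by (metis count_image_inj[OF inj_bump])
  then show "M = M'" by (rule multiset_eqI)
qed

lemma mchoose_image:
  assumes "inj g" "\<And>v. g v \<notin># E"
  shows "mchoose (image_mset g C) (E + image_mset g B) = mchoose C B"
proof -
  note c = count_image_inj[OF assms(1)]
  have "mchoose (image_mset g C) (E + image_mset g B)
     = (\<Prod>v\<in>g ` set_mset C. (count (image_mset g C) v + count (E + image_mset g B) v) choose count (image_mset g C) v)"
    by (simp add: mchoose_def)
  also have "\<dots> = (\<Prod>v\<in>set_mset C. (count C v + count B v) choose count C v)"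
    by (subst prod.reindex) (use assms c in \<open>auto simp: inj_on_def inj_def not_in_iff\<close>)
  finally show ?thesis by (simp add: mchoose_def)
qed

text \<open>
  A relation for rows \<open>x < x'\<close> of the smaller shape is compared with the relation for the
  corresponding rows of \<open>lam\<close>, in which the rows above \<open>m\<close> are filled up with \<open>p - 1\<close> copies of
  1.  The terms that move no 1 correspond to each other and have the same coefficients.  If
  \<open>j > 0\<close> copies of 1 are moved, they come from a row \<open>x < m\<close>, so that \<open>j < p\<close>.  For \<open>x' < m\<close>
  the coefficient then has the factor \<open>(j + (p - 1)) choose j\<close>, which is zero in
  characteristic \<open>p\<close>; for \<open>x' \<ge> m\<close> the term vanishes by \<open>garnir_excess_ones\<close>.
\<close>
lemma garnir_lift_rows:
  fixes \<Phi> :: "(nat \<Rightarrow> nat multiset) \<Rightarrow> 'f::comm_ring_1"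
  assumes g: "garnir lam \<Phi>" and p: "prime p" "CHAR('f) = p" and m: "1 \<le> m"
    and upper: "\<And>y. 1 \<le> y \<Longrightarrow> y < m \<Longrightarrow> lam y = lam' y + (p - 1)"
    and lower: "\<And>y. m \<le> y \<Longrightarrow> lam (Suc y) = lam' y"
  shows "garnir lam' (\<lambda>N. \<Phi> (lift_rows (p - 1) m (lam m) N))"
  unfolding garnir_def
proof (intro allI impI)
  fix N :: "nat \<Rightarrow> nat multiset" and x x' :: nat and A B :: "nat multiset"
  assume x: "1 \<le> x" "x < x'" and sA: "lam' x < size A" and sAB: "size A + size B = lam' x + lam' x'"
  let ?q = "p - 1" and ?L = "lift_rows (p - 1) m (lam m)" and ?k = "size A - lam' x"
  \<comment> \<open>The row of \<open>lam\<close> that row \<open>y\<close> becomes, and the 1s that are added to it.\<close>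
  define e where "e y = (if y < m then y else Suc y)" for y
  define E where "E y = (if y < m then replicate_mset ?q 1 else ({#} :: nat multiset))" for y
  let ?A = "E x + image_mset bump A" and ?B = "E x' + image_mset bump B"
  let ?f = "\<lambda>C. of_nat (mchoose C ?B) * \<Phi> ((?L N)(e x := ?A - C, e x' := C + ?B))"
  let ?S = "{C. C \<subseteq># ?A \<and> size C = ?k}" and ?T = "{C. C \<subseteq># A \<and> size C = ?k}"
  have lam_e: "lam (e y) = lam' y + size (E y)" if "1 \<le> y" for y
    using upper lower that by (auto simp: e_def E_def)
  have bE: "bump v \<notin># E y" for v y using bump_neq_1 by (auto simp: E_def split: if_splits)
  have finS: "finite ?S" by (rule finite_subset[OF _ finite_submultisets[of ?A]]) auto
  have sum0: "sum ?f ?S = 0"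
  proof (rule garnirD[OF g])
    show "1 \<le> e x" "e x < e x'" using x by (auto simp: e_def)
    show "lam (e x) < size ?A" using sA lam_e x by simp
    show "size ?A + size ?B = lam (e x) + lam (e x')" using sAB lam_e x by simp
    show "?k = size ?A - lam (e x)" using lam_e x by simp
  qed
  have lift_upd: "?L (N(x := A - C, x' := C + B)) = (?L N)(e x := ?A - image_mset bump C, e x' := image_mset bump C + ?B)"
    if C: "C \<subseteq># A" for C
  proof
    fix y
    obtain D where D: "A = C + D" using C by (metis subset_mset.less_eqE)
    have d: "?A - image_mset bump C = E x + image_mset bump (A - C)"
    proof -
      have "?A = E x + image_mset bump D + image_mset bump C" by (simp only: D image_mset_union ac_simps)
      then show ?thesis by (simp only: D add_diff_cancel_left' add_diff_cancel_right')
    qed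
    have x0: "x \<noteq> 0" "x' \<noteq> 0" "x \<noteq> x'" using x by auto
    consider "y = e x" | "y = e x'" | "y \<noteq> e x" "y \<noteq> e x'" by blast
    then show "?L (N(x := A - C, x' := C + B)) y = ((?L N)(e x := ?A - image_mset bump C, e x' := image_mset bump C + ?B)) y"
    proof cases
      case 1
      then show ?thesis using x0 x unfolding d by (auto simp: lift_rows_def e_def E_def)
    next
      case 2
      then show ?thesis using x0 x by (auto simp: lift_rows_def e_def E_def)
    next
      case 3
      then have "y < m \<Longrightarrow> y \<noteq> x \<and> y \<noteq> x'" "y > m \<Longrightarrow> y - 1 \<noteq> x \<and> y - 1 \<noteq> x'"
        by (auto simp: e_def split: if_splits)
      then show ?thesis using 3 x0 m by (auto simp: lift_rows_def)
    qed
  qed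
  have "(\<Sum>C\<in>?T. of_nat (mchoose C B) * \<Phi> (?L (N(x := A - C, x' := C + B)))) = (\<Sum>C\<in>?T. ?f (image_mset bump C))"
  proof (rule sum.cong[OF refl])
    fix C assume "C \<in> ?T"
    then have C: "C \<subseteq># A" by simp
    show "of_nat (mchoose C B) * \<Phi> (?L (N(x := A - C, x' := C + B))) = ?f (image_mset bump C)"
      unfolding lift_upd[OF C] mchoose_image[OF inj_bump bE] ..
  qed
  also have "\<dots> = sum ?f (image_mset bump ` ?T)"
    by (subst sum.reindex[OF inj_on_subset[OF inj_image_mset_bump]]) (simp_all only: subset_UNIV o_def)
  also have "\<dots> = sum ?f ?S"
  proof (rule sum.mono_neutral_left[OF finS])
    show "image_mset bump ` ?T \<subseteq> ?S"
      by (auto intro: image_mset_subseteq_mono subset_mset.add_increasing)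
    show "\<forall>C\<in>?S - image_mset bump ` ?T. ?f C = 0"
    proof
      fix C assume C: "C \<in> ?S - image_mset bump ` ?T"
      have one: "1 \<notin># image_mset bump M" for M by (auto simp: bump_neq_1(2)[symmetric])
      have one0: "count (image_mset bump M) 1 = 0" for M
        by (rule not_in_iff[THEN iffD1, OF one])
      have "1 \<in># C"
      proof (rule ccontr)
        assume "1 \<notin># C"
        have "C \<subseteq># image_mset bump A"
        proof (rule mset_subset_eqI)
          fix v show "count C v \<le> count (image_mset bump A) v"
            using mset_subset_eq_count[of C ?A v] C \<open>1 \<notin># C\<close>
            by (cases "v = 1") (auto simp: E_def not_in_iff split: if_splits)
        qed
        then obtain C' where "C' \<subseteq># A" "C = image_mset bump C'" using submultiset_of_image by blast
        then show False using C by auto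
      qed
      define j where "j = count C 1"
      have j: "1 \<le> j" using \<open>1 \<in># C\<close> by (simp add: j_def Suc_le_eq)
      have "j \<le> count ?A 1" unfolding j_def using C by (intro mset_subset_eq_count) auto
      also have "count ?A 1 = count (E x) 1" by (simp only: count_union one0 add_0_right)
      finally have jE: "j \<le> count (E x) 1" .
      then have xm: "x < m" and jp: "j < p"
        using j by (auto simp: E_def split: if_splits)
      show "?f C = 0"
      proof (cases "x' < m")
        case True
        have "count ?B 1 = p - 1" using True by (simp only: count_union one0 add_0_right E_def if_True count_replicate_mset simp_thms)
        then have "p dvd (count C 1 + count ?B 1) choose count C 1"
          using prime_dvd_choose_pred[OF p(1) j jp] by (simp add: j_def)
        then have "p dvd mchoose C ?B"
          unfolding mchoose_def using \<open>1 \<in># C\<close> by (meson dvd_prodI dvd_trans finite_set_mset)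
        then have "(of_nat (mchoose C ?B) :: 'f) = 0" using p(2) by (simp add: of_nat_eq_0_iff_char_dvd)
        then show ?thesis by simp
      next
        case False
        have "\<Phi> ((?L N)(e x := ?A - C, e x' := C + ?B)) = 0"
        proof (rule garnir_excess_ones[OF g m, where z = "e x'" and u = 1])
          show "m < e x'" using False by (simp add: e_def)
          show "((?L N)(e x := ?A - C, e x' := C + ?B)) m = replicate_mset (lam m) 1"
            using xm False m by (simp add: e_def lift_rows_def)
          have "size C = ?k" using C by simp
          then show "size (((?L N)(e x := ?A - C, e x' := C + ?B)) (e x')) = lam (e x')"
            using sAB sA lam_e[of x'] x by simp
          show "1 \<in># ((?L N)(e x := ?A - C, e x' := C + ?B)) (e x')" using \<open>1 \<in># C\<close> by simp
        qed
        then show ?thesis by simp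
      qed
    qed
  qed
  also have "\<dots> = 0" by (rule sum0)
  finally show "(\<Sum>C\<in>?T. of_nat (mchoose C B) * \<Phi> (?L (N(x := A - C, x' := C + B)))) = 0" .
qed

section \<open>Ramps and removal of a nice row\<close>

definition rows_of :: "(nat \<Rightarrow> nat) \<Rightarrow> tableau \<Rightarrow> nat \<Rightarrow> nat multiset" where
  "rows_of lam T y = image_mset (\<lambda>c. T (y, c)) (mset_set {1..lam y})"

text \<open>
  The rows below row \<open>x\<close> in which the ramp through \<open>(x, y)\<close> has a node outside the diagram.
  The node of this ramp in row \<open>x'\<close> has column \<open>y - (x' - x) * q\<close>, so that the one inequality
  says both that this column exists and that it is not in the diagram.
\<close>
definition missing_below :: "nat \<Rightarrow> (nat \<Rightarrow> nat) \<Rightarrow> nat \<Rightarrow> nat \<Rightarrow> nat set" where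
  "missing_below q lam x y = {x'. x < x' \<and> lam x' + (x' - x) * q < y}"

lemma finite_missing_below:
  assumes "0 < q" shows "finite (missing_below q lam x y)"
proof (rule finite_subset)
  show "missing_below q lam x y \<subseteq> {..x + y}"
  proof
    fix z assume z: "z \<in> missing_below q lam x y"
    have "(z - x) * 1 \<le> (z - x) * q" using assms by (intro mult_le_mono2) simp
    moreover have "x < z" "lam z + (z - x) * q < y" using z by (auto simp: missing_below_def)
    ultimately have "z \<le> x + y" by linarith
    then show "z \<in> {..x + y}" by simp
  qed
qed simp

lemma ramp_iff:
  assumes "x < x'" "1 \<le> x" "1 \<le> y"
  shows "(\<exists>l. (x, y) \<in> ramp p l \<and> (x', y') \<in> ramp p l) \<longleftrightarrow> 1 \<le> y' \<and> y' + (x' - x) * (p - 1) = y"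
proof -
  define d where "d = x' - x"
  have "x' - 1 = (x - 1) + d" using assms by (simp add: d_def)
  then have "q * (x' - 1) = q * (x - 1) + d * q" for q by (simp add: distrib_left mult.commute)
  from this[of "p - 1"] obtain a b where ab: "(p - 1) * (x - 1) = a" "(p - 1) * (x' - 1) = a + b" "(x' - x) * (p - 1) = b"
    by (simp add: d_def)
  have "(x, y) \<in> ramp p l \<longleftrightarrow> y - 1 + a = l" "(x', y') \<in> ramp p l \<longleftrightarrow> 1 \<le> y' \<and> y' - 1 + (a + b) = l" for l
    using assms unfolding ramp_def mem_Collect_eq prod.case ab by auto
  then show ?thesis unfolding ab using assms by auto
qed

lemma Re_tableau_eq:
  assumes "1 \<le> x" "1 \<le> y" "y \<le> lam x"
  shows "Re_tableau p lam (x, y) = x + card (missing_below (p - 1) lam x y)"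
proof -
  let ?S = "{(x', y'). x < x' \<and> (\<exists>l. (x, y) \<in> ramp p l \<and> (x', y') \<in> ramp p l) \<and> (x', y') \<notin> diagram lam}"
  have key: "(x', y') \<in> ?S \<longleftrightarrow> x < x' \<and> 1 \<le> y' \<and> y' + (x' - x) * (p - 1) = y \<and> lam x' < y'" for x' y'
    using ramp_iff[of x x' y p y'] assms by (auto simp: diagram_def)
  have "?S = {(x', y'). x < x' \<and> 1 \<le> y' \<and> y' + (x' - x) * (p - 1) = y \<and> lam x' < y'}"
  proof (rule set_eqI)
    fix z show "z \<in> ?S \<longleftrightarrow> z \<in> {(x', y'). x < x' \<and> 1 \<le> y' \<and> y' + (x' - x) * (p - 1) = y \<and> lam x' < y'}"
      using key[of "fst z" "snd z"] by (simp only: mem_Collect_eq case_prod_beta fst_conv snd_conv)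
  qed
  also have "\<dots> = (\<lambda>x'. (x', y - (x' - x) * (p - 1))) ` missing_below (p - 1) lam x y"
    by (force simp: missing_below_def)
  finally have "?S = (\<lambda>x'. (x', y - (x' - x) * (p - 1))) ` missing_below (p - 1) lam x y" .
  moreover have "inj_on (\<lambda>x'. (x', y - (x' - x) * (p - 1))) (missing_below (p - 1) lam x y)"
    by (auto simp: inj_on_def)
  ultimately have "card ?S = card (missing_below (p - 1) lam x y)" by (simp add: card_image)
  moreover have "(x, y) \<in> diagram lam" using assms by (simp add: diagram_def)
  ultimately show ?thesis by (simp add: Re_tableau_def)
qed

lemma Re_ge: "1 \<le> x \<Longrightarrow> 1 \<le> y \<Longrightarrow> y \<le> lam x \<Longrightarrow> x \<le> Re_tableau p lam (x, y)"
  by (simp add: Re_tableau_eq)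

text \<open>
  Translation to the right maps a ramp into any later one, so that the full ramps form an
  initial segment and their number is the index of the first ramp that is not full.
\<close>
lemma full_ramp_subset:
  assumes "is_partition lam" "l < full p lam"
  shows "ramp p l \<subseteq> diagram lam"
proof (rule ccontr)
  assume n: "\<not> ramp p l \<subseteq> diagram lam"
  let ?A = "{l. ramp p l \<subseteq> diagram lam}"
  have "\<not> ramp p k \<subseteq> diagram lam" if "l \<le> k" for k
  proof
    assume k: "ramp p k \<subseteq> diagram lam"
    have "ramp p l \<subseteq> diagram lam"
    proof
      fix z assume z: "z \<in> ramp p l"
      obtain r c where rc: "z = (r, c)" by (cases z)
      then have "(r, c + (k - l)) \<in> ramp p k" using z that by (auto simp: ramp_def)
      then have "(r, c + (k - l)) \<in> diagram lam" using k by blast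
      then show "z \<in> diagram lam" using z rc by (auto simp: diagram_def ramp_def)
    qed
    then show False using n by simp
  qed
  then have "?A \<subseteq> {..<l}" by (auto simp: not_le[symmetric])
  then have "card ?A \<le> l" by (metis card_lessThan card_mono finite_lessThan)
  then show False using assms(2) by (simp add: full_def)
qed

text \<open>
  The last full ramp has a node in row \<open>y\<close>, unless row \<open>y\<close> begins after it.
\<close>
lemma full_le_row:
  assumes "is_partition lam" "1 \<le> y"
  shows "full p lam \<le> lam y + (y - 1) * (p - 1)"
proof (cases "(y - 1) * (p - 1) < full p lam")
  case True
  let ?c = "full p lam - (y - 1) * (p - 1)"
  have "(y, ?c) \<in> ramp p (full p lam - 1)" using True assms(2) by (auto simp: ramp_def mult.commute)
  then have "(y, ?c) \<in> diagram lam" using full_ramp_subset[OF assms(1), of "full p lam - 1" p] True by auto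
  then show ?thesis by (auto simp: diagram_def)
qed simp

lemma nice_row:
  assumes "is_partition lam" "nice p lam m"
  shows "1 \<le> m" "lam m + (m - 1) * (p - 1) = full p lam"
proof -
  obtain c where c: "(m, c) \<in> ramp p (full p lam)" "(m, c) \<notin> diagram lam"
    using assms(2) by (auto simp: nice_def)
  then show m: "1 \<le> m" by (auto simp: ramp_def)
  have "lam m + (m - 1) * (p - 1) \<le> full p lam"
    using c by (auto simp: ramp_def diagram_def mult.commute)
  then show "lam m + (m - 1) * (p - 1) = full p lam" using full_le_row[OF assms(1) m, of p] by simp
qed

text \<open>
  In the following, \<open>full_len y\<close> is the number of nodes of row \<open>y\<close> that lie in full ramps, and
  \<open>tail y\<close> contains the entries of \<open>Re(\<lambda>)\<close> in the other nodes of this row.  A node of the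
  smaller partition in a row \<open>y < m\<close> corresponds to the node of \<open>lam\<close> that lies \<open>q\<close> columns
  further to the right, and a node in a row \<open>y \<ge> m\<close> to the node one row below.  Both shifts
  raise the number of the ramp by \<open>q\<close>, so that ramps correspond to ramps.
\<close>
locale nice_removal =
  fixes p :: nat and lam :: "nat \<Rightarrow> nat" and m :: nat
  assumes part: "is_partition lam" and nice: "nice p lam m" and p2: "2 \<le> p"
begin

abbreviation q where "q \<equiv> p - 1"
abbreviation lam' where "lam' \<equiv> circ p m lam"
definition full_len where "full_len y = full p lam - (y - 1) * q"
definition tail where "tail y = image_mset (\<lambda>c. Re_tableau p lam (y, c)) (mset_set {full_len y<..lam y})"

lemma m: "1 \<le> m" using nice_row[OF part nice] by simp

lemma full_len_m: "full_len m = lam m" using nice_row(2)[OF part nice] by (simp add: full_len_def)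

lemma full_len_le: "1 \<le> y \<Longrightarrow> full_len y \<le> lam y"
  using full_le_row[OF part, of y p] by (simp add: full_len_def)

lemma full_len_diff: "1 \<le> x \<Longrightarrow> x \<le> y \<Longrightarrow> full_len y = full_len x - (y - x) * q"
proof -
  assume xy: "1 \<le> x" "x \<le> y"
  then have "y - 1 = (x - 1) + (y - x)" by simp
  then have "(y - 1) * q = (x - 1) * q + (y - x) * q" by (metis distrib_right)
  then show ?thesis by (simp add: full_len_def)
qed

lemma full_len_lower: "1 \<le> x \<Longrightarrow> x \<le> m \<Longrightarrow> full_len x = lam m + (m - x) * q"
proof -
  assume xm: "1 \<le> x" "x \<le> m"
  then have "m - 1 = (x - 1) + (m - x)" by simp
  then have "(m - 1) * q = (x - 1) * q + (m - x) * q" by (metis distrib_right)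
  then have "full p lam = lam m + (m - x) * q + (x - 1) * q" using nice_row(2)[OF part nice] by simp
  then show ?thesis by (simp add: full_len_def)
qed

lemma full_len_step: "1 \<le> y \<Longrightarrow> y < m \<Longrightarrow> full_len y = q + full_len (Suc y)"
proof -
  assume y: "1 \<le> y" "y < m"
  then have "(m - y) * q = q + (m - Suc y) * q" by (metis Suc_diff_Suc mult_Suc)
  then show ?thesis using y by (simp add: full_len_lower)
qed

lemma circ_upper: "1 \<le> y \<Longrightarrow> y < m \<Longrightarrow> lam y = lam' y + q"
  using full_len_le[of y] full_len_step[of y] by (simp add: circ_def)

lemma circ_lower: "m \<le> y \<Longrightarrow> lam (Suc y) = lam' y"
  by (simp add: circ_def)

lemma missing_below_full:
  assumes "1 \<le> x" "y \<le> full_len x" shows "missing_below q lam x y = {}"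
proof -
  have "y \<le> lam x' + (x' - x) * q" if "x < x'" for x'
    using full_len_diff[of x x'] full_len_le[of x'] assms that by linarith
  then show ?thesis by (auto simp: missing_below_def not_less[symmetric])
qed

lemma missing_below_upper_iff:
  assumes "1 \<le> x" "x < m"
  shows "z < m \<Longrightarrow> z \<in> missing_below q lam' x (y - q) \<longleftrightarrow> z \<in> missing_below q lam x y"
    and "m \<le> z \<Longrightarrow> z \<in> missing_below q lam' x (y - q) \<longleftrightarrow> Suc z \<in> missing_below q lam x y"
proof -
  assume "z < m"
  moreover have "lam z + b < y \<longleftrightarrow> lam' z + b < y - q" if "x < z" for b
    using circ_upper[of z] \<open>z < m\<close> assms that by linarith
  ultimately show "z \<in> missing_below q lam' x (y - q) \<longleftrightarrow> z \<in> missing_below q lam x y"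
    by (auto simp: missing_below_def)
next
  assume z: "m \<le> z"
  have e: "(Suc z - x) * q = q + (z - x) * q" using z assms by (simp add: Suc_diff_le)
  have "lam' z + b < y - q \<longleftrightarrow> lam' z + (q + b) < y" for b by linarith
  then show "z \<in> missing_below q lam' x (y - q) \<longleftrightarrow> Suc z \<in> missing_below q lam x y"
    unfolding missing_below_def mem_Collect_eq e circ_lower[OF z] using z assms by auto
qed

text \<open>
  Under the correspondence of ramps, the missing nodes are the same ones, except for a possible
  missing node in row \<open>m\<close>, which has no counterpart.
\<close>
lemma missing_below_upper:
  assumes x: "1 \<le> x" "x < m"
  shows "missing_below q lam x y - {m} = (\<lambda>z. if z < m then z else Suc z) ` missing_below q lam' x (y - q)"
    (is "_ = ?g ` _")
proof (intro equalityI subsetI)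
  fix z assume z: "z \<in> missing_below q lam x y - {m}"
  show "z \<in> ?g ` missing_below q lam' x (y - q)"
  proof (cases "z < m")
    case True
    then have "z \<in> missing_below q lam' x (y - q)"
      using z missing_below_upper_iff(1)[OF x] by blast
    then show ?thesis using True by (intro image_eqI[of _ _ z]) auto
  next
    case False
    then obtain w where w: "z = Suc w" "m \<le> w" using z by (cases z) auto
    then have "w \<in> missing_below q lam' x (y - q)"
      using z missing_below_upper_iff(2)[OF x] by blast
    then show ?thesis using w by (intro image_eqI[of _ _ w]) auto
  qed
next
  fix z assume "z \<in> ?g ` missing_below q lam' x (y - q)"
  then obtain w where w: "w \<in> missing_below q lam' x (y - q)" "z = ?g w" by auto
  show "z \<in> missing_below q lam x y - {m}"
  proof (cases "w < m")
    case True
    then show ?thesis using w missing_below_upper_iff(1)[OF x True] by simp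
  next
    case False
    then have "z = Suc w" "m \<le> w" using w by auto
    then show ?thesis using w missing_below_upper_iff(2)[OF x, of w] by simp
  qed
qed

lemma missing_below_lower:
  assumes "m < x" shows "missing_below q lam x y = Suc ` missing_below q lam' (x - 1) y"
proof (intro equalityI subsetI)
  fix z assume z: "z \<in> missing_below q lam x y"
  then obtain w where w: "z = Suc w" by (cases z) (auto simp: missing_below_def)
  have "w \<in> missing_below q lam' (x - 1) y"
    using z w assms circ_lower[of w] by (auto simp: missing_below_def)
  then show "z \<in> Suc ` missing_below q lam' (x - 1) y" using w by blast
next
  fix z assume "z \<in> Suc ` missing_below q lam' (x - 1) y"
  then show "z \<in> missing_below q lam x y"
    using assms circ_lower by (auto simp: missing_below_def)
qed

lemma Re_full:
  assumes "1 \<le> x" "1 \<le> y" "y \<le> full_len x" shows "Re_tableau p lam (x, y) = x"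
  using assms Re_tableau_eq[of x y lam p] missing_below_full[of x y] full_len_le[of x] by simp

text \<open>
  To the right of the full ramps, the node in row \<open>m\<close> of the ramp through \<open>(x, y)\<close> is missing
  and contributes the difference of 1.
\<close>
lemma Re_upper:
  assumes x: "1 \<le> x" "x < m" and y: "full_len x < y" "y \<le> lam x"
  shows "Re_tableau p lam (x, y) = Suc (Re_tableau p lam' (x, y - q))"
proof -
  let ?g = "\<lambda>z. if z < m then z else Suc z"
  have qy: "q < y" using full_len_step[OF x] y by simp
  have "m \<in> missing_below q lam x y"
    using x y full_len_lower[of x] by (auto simp: missing_below_def)
  then have "missing_below q lam x y = insert m (?g ` missing_below q lam' x (y - q))"
    using missing_below_upper[OF x, of y] by blast
  moreover have "m \<notin> ?g ` missing_below q lam' x (y - q)" by auto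
  moreover have "finite (missing_below q lam' x (y - q))"
    by (rule finite_missing_below) (use p2 in simp)
  moreover have "card (?g ` missing_below q lam' x (y - q)) = card (missing_below q lam' x (y - q))"
    by (rule card_image) (auto simp: inj_on_def)
  ultimately have "card (missing_below q lam x y) = Suc (card (missing_below q lam' x (y - q)))"
    by (simp only: card_insert_disjoint finite_imageI not_False_eq_True)
  moreover have "1 \<le> y - q" "y - q \<le> lam' x" using qy y circ_upper[OF x] by linarith+
  ultimately show ?thesis
    using Re_tableau_eq[of x y lam p] Re_tableau_eq[of x "y - q" lam' p] x y by simp
qed

text \<open>
  The first \<open>full_len (Suc x)\<close> nodes of a row \<open>x < m\<close> of the smaller partition come from nodes
  in full ramps of \<open>lam\<close>, so that their own ramps are full.
\<close>
lemma Re_circ_upper: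
  assumes x: "1 \<le> x" "x < m" and y: "1 \<le> y" "y \<le> full_len (Suc x)"
  shows "Re_tableau p lam' (x, y) = x"
proof -
  have yq: "y + q \<le> full_len x" using full_len_step[OF x] y by simp
  then have "missing_below q lam x (y + q) = {}" by (rule missing_below_full[OF x(1)])
  then have "missing_below q lam' x y = {}"
    using missing_below_upper[OF x, of "y + q"] y by auto
  moreover have "y \<le> lam' x" using yq full_len_le[OF x(1)] circ_upper[OF x] by simp
  ultimately show ?thesis using Re_tableau_eq[of x y lam' p] x y by simp
qed

lemma Re_lower:
  assumes x: "m < x" and y: "1 \<le> y" "y \<le> lam x"
  shows "Re_tableau p lam (x, y) = Suc (Re_tableau p lam' (x - 1, y))"
proof -
  have "1 \<le> x - 1" "y \<le> lam' (x - 1)" using x y m circ_lower[of "x - 1"] by auto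
  then show ?thesis
    using Re_tableau_eq[of x y lam p] Re_tableau_eq[of "x - 1" y lam' p] x y m missing_below_lower[OF x, of y]
    by (simp add: card_image)
qed

lemma Re_row: 
  assumes "1 \<le> y" shows "rows_of lam (Re_tableau p lam) y = replicate_mset (full_len y) y + tail y"
proof -
  have "mset_set {1..lam y} = mset_set {1..full_len y} + mset_set {full_len y<..lam y}"
    using full_len_le[OF assms] by (subst mset_set_Union[symmetric]) (auto intro!: arg_cong[where f = mset_set])
  moreover have "image_mset (\<lambda>c. Re_tableau p lam (y, c)) (mset_set {1..full_len y}) = image_mset (\<lambda>_. y) (mset_set {1..full_len y})"
    by (rule image_mset_cong) (use assms Re_full in auto)
  ultimately show ?thesis by (simp add: rows_of_def tail_def image_mset_const_eq)
qed

text \<open>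
  With \<open>p - 1\<close> copies of 1 added, this is row \<open>y\<close> of the rung on which the climb of the 1s
  begins; \<open>Re_row\<close> and \<open>Re_circ_row_lower\<close> show that the climb ends at \<open>Re(\<lambda>)\<close>.
\<close>
lemma Re_circ_row_upper:
  assumes y: "1 \<le> y" "y < m"
  shows "image_mset bump (rows_of lam' (Re_tableau p lam') y) = replicate_mset (full_len (Suc y)) (Suc y) + tail y"
proof -
  have le: "full_len (Suc y) \<le> lam' y" using full_len_le[OF y(1)] full_len_step[OF y] circ_upper[OF y] by simp
  have "mset_set {1..lam' y} = mset_set {1..full_len (Suc y)} + mset_set {full_len (Suc y)<..lam' y}"
    using le by (subst mset_set_Union[symmetric]) (auto intro!: arg_cong[where f = mset_set])
  moreover have "image_mset (\<lambda>c. bump (Re_tableau p lam' (y, c))) (mset_set {1..full_len (Suc y)}) = image_mset (\<lambda>_. Suc y) (mset_set {1..full_len (Suc y)})"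
    by (rule image_mset_cong) (use y Re_circ_upper in \<open>auto simp: bump_def\<close>)
  moreover have "image_mset (\<lambda>c. bump (Re_tableau p lam' (y, c))) (mset_set {full_len (Suc y)<..lam' y}) = tail y"
  proof -
    have "{q + a<..b + q} = (\<lambda>c. c + q) ` {a<..b}" for a b
    proof (intro equalityI subsetI)
      fix z assume "z \<in> {q + a<..b + q}"
      then have "z = (z - q) + q" "z - q \<in> {a<..b}" by auto
      then show "z \<in> (\<lambda>c. c + q) ` {a<..b}" by (rule image_eqI)
    qed auto
    then have "{full_len y<..lam y} = (\<lambda>c. c + q) ` {full_len (Suc y)<..lam' y}"
      unfolding full_len_step[OF y] circ_upper[OF y] .
    then have "mset_set {full_len y<..lam y} = image_mset (\<lambda>c. c + q) (mset_set {full_len (Suc y)<..lam' y})"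
      by (simp add: image_mset_mset_set)
    then have "tail y = image_mset (\<lambda>c. Re_tableau p lam (y, c + q)) (mset_set {full_len (Suc y)<..lam' y})"
      by (simp add: tail_def image_mset.compositionality o_def)
    also have "\<dots> = image_mset (\<lambda>c. bump (Re_tableau p lam' (y, c))) (mset_set {full_len (Suc y)<..lam' y})"
    proof (rule image_mset_cong)
      fix c assume "c \<in># mset_set {full_len (Suc y)<..lam' y}"
      then have c: "full_len (Suc y) < c" "c \<le> lam' y" by auto
      have "Re_tableau p lam (y, c + q) = Suc (Re_tableau p lam' (y, c))"
        using Re_upper[OF y, of "c + q"] c full_len_step[OF y] circ_upper[OF y] by simp
      moreover have "Re_tableau p lam' (y, c) \<ge> y" using Re_ge[of y c lam'] y c by simp
      ultimately show "Re_tableau p lam (y, c + q) = bump (Re_tableau p lam' (y, c))"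
        using y by (simp add: bump_def)
    qed
    finally show ?thesis ..
  qed
  ultimately show ?thesis
    by (simp add: rows_of_def image_mset.compositionality o_def image_mset_const_eq)
qed

lemma Re_circ_row_lower:
  assumes y: "m < y"
  shows "image_mset bump (rows_of lam' (Re_tableau p lam') (y - 1)) = rows_of lam (Re_tableau p lam) y"
proof -
  have l: "lam' (y - 1) = lam y" using circ_lower[of "y - 1"] y by simp
  show ?thesis unfolding rows_of_def l image_mset.compositionality o_def
  proof (rule image_mset_cong)
    fix c assume "c \<in># mset_set {1..lam y}"
    then have c: "1 \<le> c" "c \<le> lam y" by auto
    have "Re_tableau p lam (y, c) = Suc (Re_tableau p lam' (y - 1, c))"
      using Re_lower[OF y c] by simp
    moreover have "Re_tableau p lam' (y - 1, c) \<ge> y - 1"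
      using Re_ge[of "y - 1" c lam'] y c l m by simp
    ultimately show "bump (Re_tableau p lam' (y - 1, c)) = Re_tableau p lam (y, c)"
      using y m by (simp add: bump_def)
  qed
qed

lemma tail_gt: "1 \<le> y \<Longrightarrow> y \<le> m \<Longrightarrow> v \<in># tail y \<Longrightarrow> y < v"
proof -
  assume y: "1 \<le> y" "y \<le> m" and v: "v \<in># tail y"
  then obtain c where c: "full_len y < c" "c \<le> lam y" "v = Re_tableau p lam (y, c)" by (auto simp: tail_def)
  then have ym: "y < m" using y full_len_m by (cases "y = m") auto
  have "y \<le> Re_tableau p lam' (y, c - q)"
    using Re_ge[of y "c - q" lam'] c full_len_step[OF y(1) ym] circ_upper[OF y(1) ym] y by simp
  then show ?thesis using Re_upper[OF y(1) ym c(1,2)] c(3) by simp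
qed

end

section \<open>The value of a Garnir functional on a magic tableau\<close>

lemma magic_pos: "magic p lam T \<Longrightarrow> z \<in> diagram lam \<Longrightarrow> 1 \<le> T z"
  by (induction rule: magic.cases) (auto simp: diagram_def tplus_def split: prod.splits)

lemma size_rows_of [simp]: "size (rows_of lam T y) = lam y"
  by (simp add: rows_of_def)

text \<open>
  The first summand does not depend on \<open>N\<close>, so that \<open>lift_rows\<close> preserves dominance.
\<close>
lemma ncount_lift_rows:
  assumes "1 \<le> m" "N 0 = {#}" "\<And>y v. v \<in># N y \<Longrightarrow> 1 \<le> v"
  shows "ncount (lift_rows q m c N) l r
    = (if l = 0 then 0 else (\<Sum>y\<le>r. if y = 0 \<or> m < y then 0 else if y < m then q else c)
        + ncount N (l - 1) (if r < m then r else r - 1))"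
proof (cases l)
  case 0
  have "filter_mset (\<lambda>v. v \<le> 0) (lift_rows q m c N y) = {#}" for y
  proof -
    have "0 < v" if "v \<in># lift_rows q m c N y" for v
      using that assms(2) assms(3)[of _ y] assms(3)[of _ "y - 1"]
      by (fastforce simp: lift_rows_def bump_def split: if_splits)
    then show ?thesis by (intro multiset_eqI) (fastforce simp: not_in_iff[symmetric])
  qed
  then show ?thesis using 0 by (simp add: ncount_def)
next
  case (Suc k)
  have b: "size (filter_mset (\<lambda>v. v \<le> l) (image_mset bump (N y))) = size (filter_mset (\<lambda>v. v \<le> k) (N y))" for y
  proof -
    have "filter_mset (\<lambda>v. bump v \<le> l) (N y) = filter_mset (\<lambda>v. v \<le> k) (N y)"
      by (rule filter_mset_cong) (use assms(3) Suc in \<open>auto simp: bump_def\<close>)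
    then show ?thesis by (simp add: filter_mset_image_mset)
  qed
  have one: "size (filter_mset (\<lambda>v. v \<le> l) (replicate_mset n 1)) = n" for n
    using Suc by (simp add: size_filter_replicate)
  have row: "size (filter_mset (\<lambda>v. v \<le> l) (lift_rows q m c N y))
     = (if y = 0 \<or> m < y then 0 else if y < m then q else c)
       + (if y = m then 0 else size (filter_mset (\<lambda>v. v \<le> k) (N (if y < m then y else y - 1))))" for y
    using assms(1,2) b one by (auto simp: lift_rows_def)
  have "ncount (lift_rows q m c N) l r
    = (\<Sum>y\<le>r. if y = 0 \<or> m < y then 0 else if y < m then q else c)
        + ncount N k (if r < m then r else r - 1)"
  proof (induction r)
    case 0
    then show ?case using assms(1,2) by (simp add: ncount_def row)
  next
    case (Suc r)
    have s: "ncount (lift_rows q m c N) l (Suc r) = ncount (lift_rows q m c N) l r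
        + size (filter_mset (\<lambda>v. v \<le> l) (lift_rows q m c N (Suc r)))" by (simp add: ncount_def)
    have t: "ncount N k (Suc r') = ncount N k r' + size (filter_mset (\<lambda>v. v \<le> k) (N (Suc r')))" for r'
      by (simp add: ncount_def)
    consider "Suc r < m" | "Suc r = m" | "m < Suc r" by linarith
    then show ?case
    proof cases
      case 3
      then have "Suc (r - 1) = r" using assms(1) by simp
      then have "ncount N k r = ncount N k (r - 1) + size (filter_mset (\<lambda>v. v \<le> k) (N r))"
        using t[of "r - 1"] by metis
      then show ?thesis using 3 by (auto simp: s Suc row)
    next
      case 2
      show ?thesis unfolding s Suc row by (simp add: 2[symmetric])
    qed (simp_all add: s Suc row t)
  qed
  then show ?thesis using Suc by simp
qed

lemma lift_rows_inject:
  assumes "lift_rows q m c N = lift_rows q m c N'" "N 0 = N' 0" "1 \<le> m" shows "N = N'"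
proof
  fix y
  consider "y = 0" | "1 \<le> y" "y < m" | "m \<le> y" by linarith
  then show "N y = N' y"
  proof cases
    case 2
    then show ?thesis using fun_cong[OF assms(1), of y] inj_image_mset_bump by (auto simp: lift_rows_def dest: injD)
  next
    case 3
    then show ?thesis using fun_cong[OF assms(1), of "Suc y"] inj_image_mset_bump by (auto simp: lift_rows_def dest: injD)
  qed (use assms in auto)
qed

context nice_removal
begin

lemma rows_of_tplus:
  assumes "\<And>z. z \<in> diagram lam' \<Longrightarrow> 1 \<le> U z"
  shows "rows_of lam (tplus p m lam U) = lift_rows q m (lam m) (rows_of lam' U)"
proof
  fix y
  have lam0: "lam 0 = 0" using part by (simp add: is_partition_def is_composition_def)
  consider "y = 0" | "1 \<le> y" "y < m" | "y = m" | "m < y" by linarith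
  then show "rows_of lam (tplus p m lam U) y = lift_rows q m (lam m) (rows_of lam' U) y"
  proof cases
    case 1
    then show ?thesis using lam0 m by (simp add: rows_of_def lift_rows_def circ_def)
  next
    case 2
    have "{1..lam y} = {1..q} \<union> (\<lambda>c. c + q) ` {1..lam' y}"
    proof (intro equalityI subsetI)
      fix z assume z: "z \<in> {1..lam y}"
      show "z \<in> {1..q} \<union> (\<lambda>c. c + q) ` {1..lam' y}"
      proof (cases "z \<le> q")
        case False
        then have "z = (z - q) + q" "z - q \<in> {1..lam' y}" using z circ_upper[OF 2] by auto
        then show ?thesis by blast
      qed (use z in auto)
    qed (use circ_upper[OF 2] in auto)
    then have "mset_set {1..lam y} = mset_set {1..q} + mset_set ((\<lambda>c. c + q) ` {1..lam' y})"
      by (simp add: mset_set_Union disjoint_iff)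
    then have ms: "mset_set {1..lam y} = mset_set {1..q} + image_mset (\<lambda>c. c + q) (mset_set {1..lam' y})"
      by (simp add: image_mset_mset_set)
    have "image_mset (\<lambda>c. tplus p m lam U (y, c)) (mset_set {1..q}) = image_mset (\<lambda>_. 1) (mset_set {1..q})"
      by (rule image_mset_cong) (use 2 circ_upper[OF 2] p2 in \<open>auto simp: tplus_def diagram_def\<close>)
    moreover have "image_mset (\<lambda>c. tplus p m lam U (y, c + q)) (mset_set {1..lam' y}) = image_mset (\<lambda>c. bump (U (y, c))) (mset_set {1..lam' y})"
    proof (rule image_mset_cong)
      fix c assume "c \<in># mset_set {1..lam' y}"
      then have c: "1 \<le> c" "c \<le> lam' y" by auto
      then have "1 \<le> U (y, c)" using assms 2 by (simp add: diagram_def)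
      moreover have "(y, c + q) \<in> diagram lam" "\<not> c + q < p" "c + q - q = c"
        using c circ_upper[OF 2] 2 by (auto simp: diagram_def)
      ultimately show "tplus p m lam U (y, c + q) = bump (U (y, c))" using 2
        by (simp add: tplus_def bump_def)
    qed
    ultimately show ?thesis using 2
      unfolding rows_of_def ms by (simp add: lift_rows_def image_mset.compositionality o_def image_mset_const_eq)
  next
    case 3
    have "image_mset (\<lambda>c. tplus p m lam U (y, c)) (mset_set {1..lam m}) = image_mset (\<lambda>_. 1) (mset_set {1..lam m})"
      by (rule image_mset_cong) (use 3 m in \<open>auto simp: tplus_def diagram_def\<close>)
    then show ?thesis using 3 m by (simp add: rows_of_def lift_rows_def image_mset_const_eq)
  next
    case 4
    have l: "lam y = lam' (y - 1)" using circ_lower[of "y - 1"] 4 by simp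
    have "image_mset (\<lambda>c. tplus p m lam U (y, c)) (mset_set {1..lam' (y - 1)}) = image_mset (\<lambda>c. bump (U (y - 1, c))) (mset_set {1..lam' (y - 1)})"
    proof (rule image_mset_cong)
      fix c assume "c \<in># mset_set {1..lam' (y - 1)}"
      then have c: "1 \<le> c" "c \<le> lam' (y - 1)" by auto
      then have "1 \<le> U (y - 1, c)" using assms 4 m by (simp add: diagram_def)
      then show "tplus p m lam U (y, c) = bump (U (y - 1, c))" using 4 c l m
        by (simp add: tplus_def bump_def diagram_def)
    qed
    then show ?thesis using 4
      by (simp add: rows_of_def l lift_rows_def image_mset.compositionality o_def)
  qed
qed

end

text \<open>
  The induction hypothesis is applied to the functional \<open>N \<mapsto> \<Phi> (lift_rows q m (lam m) N)\<close>.  It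
  satisfies the relations by \<open>garnir_lift_rows\<close>, and it vanishes where it should by
  \<open>stage_value\<close>, which also evaluates it at the smaller \<open>Re\<close>.
\<close>
lemma magic_value:
  fixes \<Phi> :: "(nat \<Rightarrow> nat multiset) \<Rightarrow> 'f::comm_ring_1"
  assumes p: "prime p" "CHAR('f) = p"
  shows "magic p lam T \<Longrightarrow> garnir lam \<Phi> \<Longrightarrow>
    (\<And>N. dominating_rows lam (rows_of lam (Re_tableau p lam)) N \<Longrightarrow> N \<noteq> rows_of lam (Re_tableau p lam) \<Longrightarrow> \<Phi> N = 0) \<Longrightarrow>
    \<Phi> (rows_of lam T) = \<Phi> (rows_of lam (Re_tableau p lam)) \<or>
    \<Phi> (rows_of lam T) = - \<Phi> (rows_of lam (Re_tableau p lam))"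
proof (induction arbitrary: \<Phi> rule: magic.induct)
  case magic_empty
  have "rows_of (\<lambda>_. 0) T = rows_of (\<lambda>_. 0) T'" for T T' by (simp add: rows_of_def fun_eq_iff)
  then show ?case by metis
next
  case (magic_plus lam m U)
  interpret nice_removal p lam m
    by unfold_locales (use magic_plus.hyps p(1) prime_ge_2_nat in auto)
  let ?G = "rows_of lam (Re_tableau p lam)" and ?G' = "rows_of lam' (Re_tableau p lam')"
  let ?L = "lift_rows q m (lam m)"
  have lam0: "lam 0 = 0" using part by (simp add: is_partition_def is_composition_def)
  interpret L: ladder lam \<Phi> q m full_len tail ?G
  proof
    show "garnir lam \<Phi>" by (rule magic_plus.prems)
    show "?G y = replicate_mset (full_len y) y + tail y" if "1 \<le> y" "y \<le> m" for y using Re_row[OF that(1)] .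
  qed (use full_len_step tail_gt magic_plus.prems in auto)
  have row0: "rows_of lam T 0 = {#}" "rows_of lam' T 0 = {#}" for T
    using lam0 m by (auto simp: rows_of_def circ_def)
  have Hm: "tail m = {#}" by (simp add: tail_def full_len_m)
  have rung: "L.rung m = ?L ?G'"
  proof
    fix y
    consider "y = 0" | "1 \<le> y" "y < m" | "y = m" | "m < y" by linarith
    then show "L.rung m y = ?L ?G' y"
    proof cases
      case 1 then show ?thesis unfolding L.rung_def lift_rows_def by (simp add: row0)
    next
      case 2 then show ?thesis
        unfolding L.rung_def lift_rows_def using Re_circ_row_upper[OF 2] by simp
    next
      case 3 then show ?thesis
        unfolding L.rung_def lift_rows_def using m by (simp add: Hm full_len_m)
    next
      case 4 then show ?thesis
        unfolding L.rung_def lift_rows_def using Re_circ_row_lower[OF 4] by simp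
    qed
  qed
  have Gpos: "y \<le> v" if v: "v \<in># ?G' y" and y: "1 \<le> y" for y v
  proof -
    obtain c where "1 \<le> c" "c \<le> lam' y" "v = Re_tableau p lam' (y, c)"
      using v by (auto simp: rows_of_def)
    then show ?thesis using Re_ge[OF y] by simp
  qed
  have Gpos1: "1 \<le> v" if "v \<in># ?G' y" for y v
    using Gpos[OF that] row0(2)[of "Re_tableau p lam'"] that by (cases "y = 0") auto
  have stage: "L.stage m (?L N)" if good: "dominating_rows lam' ?G' N" for N
  proof -
    have sz: "size (N y) = lam' y" and ge: "v \<in># N y \<Longrightarrow> y \<le> v" for y v
      using good by (auto simp: dominating_rows_def)
    have N0: "N 0 = {#}" using sz[of 0] lam0 m by (simp add: circ_def)
    have pos: "1 \<le> v" if "v \<in># N y" for y v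
      using ge[OF that] N0 that by (cases "y = 0") auto
    show ?thesis unfolding L.stage_def
    proof (intro conjI allI impI)
      show "size (?L N y) = lam y" for y
        using sz[of y] sz[of "y - 1"] circ_upper[of y] circ_lower[of "y - 1"] lam0 N0
        by (auto simp: lift_rows_def)
      show "\<forall>v\<in>#?L N y. y \<le> v" if "m < y" for y
        using that ge[of _ "y - 1"] pos[of _ "y - 1"] by (fastforce simp: lift_rows_def bump_def)
      show "\<exists>R. ?L N y = replicate_mset q 1 + R \<and> (\<forall>v\<in>#R. y < v)" if "1 \<le> y" "y < m" for y
        using that ge[of _ y] by (fastforce simp: lift_rows_def bump_def)
      show "\<exists>Q. ?L N m = replicate_mset (full_len m) 1 + Q \<and> (\<forall>v\<in>#Q. m < v)"
        using m by (auto simp: lift_rows_def full_len_m)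
      show "ncount (L.rung m) l r \<le> ncount (?L N) l r" for l r
      proof -
        have "ncount ?G' (l - 1) r' \<le> ncount N (l - 1) r'" for r' using good by (simp add: dominating_rows_def)
        then show ?thesis
          unfolding rung
          by (subst (1 2) ncount_lift_rows) (use m N0 pos row0(2) Gpos1 in auto)
      qed
    qed
  qed
  have goodG: "dominating_rows lam' ?G' ?G'"
  proof -
    have "y \<le> v" if "v \<in># ?G' y" for y v using Gpos[OF that] by (cases "y = 0") auto
    then show ?thesis by (simp add: dominating_rows_def)
  qed
  have "\<Phi> (?L (rows_of lam' U)) = \<Phi> (?L ?G') \<or> \<Phi> (?L (rows_of lam' U)) = - \<Phi> (?L ?G')"
  proof (rule magic_plus.IH[where \<Phi> = "\<lambda>N. \<Phi> (?L N)"])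
    show "garnir lam' (\<lambda>N. \<Phi> (?L N))"
      by (rule garnir_lift_rows[OF magic_plus.prems(1) p m circ_upper circ_lower])
    fix N assume N: "dominating_rows lam' ?G' N" "N \<noteq> ?G'"
    have "size (N 0) = lam' 0" using N(1) by (simp add: dominating_rows_def)
    then have "N 0 = ?G' 0" using row0(2) lam0 m by (simp add: circ_def)
    then have "?L N \<noteq> L.rung m" using lift_rows_inject[OF _ _ m] N(2) unfolding rung by metis
    then show "\<Phi> (?L N) = 0" using L.stage_value[OF m order_refl stage[OF N(1)]] by blast
  qed
  moreover have "\<Phi> (?L ?G') = \<Phi> ?G \<or> \<Phi> (?L ?G') = - \<Phi> ?G"
    using L.stage_value[OF m order_refl stage[OF goodG]] rung by simp
  moreover have "rows_of lam (tplus p m lam U) = ?L (rows_of lam' U)"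
    by (rule rows_of_tplus) (use magic_pos[OF magic_plus.hyps(4)] in auto)
  ultimately show ?case by auto
qed

section \<open>Coefficients of the image of a polytabloid\<close>

text \<open>
  The column permutations in a column stabiliser act on \<open>{1..n}\<close>; this is the corresponding
  permutation of the nodes.
\<close>
definition col_move :: "(nat \<Rightarrow> nat) \<Rightarrow> tableau \<Rightarrow> (nat \<Rightarrow> nat) \<Rightarrow> nat \<times> nat \<Rightarrow> nat \<times> nat" where
  "col_move lam t s z = (if z \<in> diagram lam then inv_into (diagram lam) t (s (t z)) else z)"

text \<open>
  This is \<open>c\<^sub>T(W)\<close> of the introduction, where \<open>N\<close> gives the row contents of \<open>T\<close>.  It is an integer
  so that the cancellation in pairs in \<open>garnir_alt_count\<close> is available before reduction to
  characteristic 2.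
\<close>
definition alt_count :: "(nat \<Rightarrow> nat) \<Rightarrow> tableau \<Rightarrow> tableau \<Rightarrow> (nat \<Rightarrow> nat multiset) \<Rightarrow> int" where
  "alt_count lam t W N =
     (\<Sum>s\<in>column_stabiliser lam t. sign s * (if rows_of lam (W \<circ> col_move lam t s) = N then 1 else 0))"

lemma col_move:
  assumes "filling lam t" "s \<in> column_stabiliser lam t" "z \<in> diagram lam"
  shows "col_move lam t s z \<in> diagram lam" "snd (col_move lam t s z) = snd z" "t (col_move lam t s z) = s (t z)"
proof -
  obtain z' where z': "z' \<in> diagram lam" "snd z' = snd z" "s (t z) = t z'"
    using assms(2,3) by (auto simp: column_stabiliser_def)
  have "inj_on t (diagram lam)" using assms(1) by (auto simp: filling_def bij_betw_def)
  then have "col_move lam t s z = z'" using z' assms(3) by (simp add: col_move_def)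
  then show "col_move lam t s z \<in> diagram lam" "snd (col_move lam t s z) = snd z" "t (col_move lam t s z) = s (t z)"
    using z' by auto
qed

lemma col_move_permutes:
  assumes fin: "finite (diagram lam)" and t: "filling lam t" and s: "s \<in> column_stabiliser lam t"
  shows "col_move lam t s permutes diagram lam"
proof -
  have injt: "inj_on t (diagram lam)" using t by (auto simp: filling_def bij_betw_def)
  have "inj s" using s by (auto simp: column_stabiliser_def permutes_inj)
  have "inj_on (col_move lam t s) (diagram lam)"
  proof (rule inj_onI)
    fix z w assume zw: "z \<in> diagram lam" "w \<in> diagram lam" "col_move lam t s z = col_move lam t s w"
    then have "s (t z) = s (t w)" using col_move(3)[OF t s] by metis
    then have "t z = t w" using \<open>inj s\<close> by (simp add: inj_eq)
    then show "z = w" using injt zw by (simp add: inj_on_eq_iff)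
  qed
  moreover have "col_move lam t s ` diagram lam \<subseteq> diagram lam" using col_move(1)[OF t s] by auto
  ultimately have "bij_betw (col_move lam t s) (diagram lam) (diagram lam)"
    by (simp add: bij_betw_def endo_inj_surj fin)
  then show ?thesis by (rule bij_imp_permutes) (simp add: col_move_def)
qed

lemma finite_column_stabiliser: "finite (column_stabiliser lam t)"
  by (rule finite_subset[OF _ finite_permutations[of "{1..csize lam}"]]) (auto simp: column_stabiliser_def)

lemma Theta_sum: "Theta lam T (\<Sum>i\<in>A. c i *\<^sub>t v i) = (\<Sum>i\<in>A. c i *\<^sub>t Theta lam T (v i))"
proof (induction A rule: infinite_finite_induct)
  case (insert i A)
  then show ?case by (simp only: sum.insert Theta_add Theta_scale not_False_eq_True)
qed (simp_all add: Theta_def tscale_def fun_eq_iff tvec_sum_apply)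

lemma count_image_mset_set: "finite A \<Longrightarrow> count (image_mset g (mset_set A)) b = card {a \<in> A. g a = b}"
proof (induction A rule: finite_induct)
  case (insert a A)
  have "{a' \<in> insert a A. g a' = b} = (if g a = b then insert a {a \<in> A. g a = b} else {a \<in> A. g a = b})" by auto
  then show ?case using insert by simp
qed simp

lemma count_rows_of:
  assumes "1 \<le> y" shows "count (rows_of lam T y) v = card {z \<in> diagram lam. fst z = y \<and> T z = v}"
proof -
  have "{z \<in> diagram lam. fst z = y \<and> T z = v} = Pair y ` {c \<in> {1..lam y}. T (y, c) = v}"
    using assms by (auto simp: diagram_def)
  then show ?thesis by (simp add: rows_of_def count_image_mset_set card_image inj_on_def)
qed

lemma rows_of_cong:
  assumes "\<And>z. z \<in> diagram lam \<Longrightarrow> T z = T' z" "lam 0 = 0"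
  shows "rows_of lam T = rows_of lam T'"
proof
  fix y show "rows_of lam T y = rows_of lam T' y"
    using assms by (cases "y = 0") (auto simp: rows_of_def diagram_def intro!: image_mset_cong)
qed

text \<open>
  Equality of all row contents is equality of the multisets of pairs of a row number and an
  entry, and then a permutation of the nodes matches these pairs.
\<close>
lemma row_rearrangements_iff:
  assumes comp: "is_composition lam" and T: "\<And>z. z \<notin> diagram lam \<Longrightarrow> T z = 0" and V: "\<And>z. z \<notin> diagram lam \<Longrightarrow> V z = 0"
  shows "V \<in> row_rearrangements lam T \<longleftrightarrow> rows_of lam V = rows_of lam T"
proof
  let ?D = "diagram lam"
  have lam0: "lam 0 = 0" using comp by (simp add: is_composition_def)
  assume "V \<in> row_rearrangements lam T"
  then obtain p where p: "V = T \<circ> p" "p permutes ?D" "\<And>z. z \<in> ?D \<Longrightarrow> fst (p z) = fst z"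
    by (auto simp: row_rearrangements_def)
  show "rows_of lam V = rows_of lam T"
  proof
    fix y show "rows_of lam V y = rows_of lam T y"
    proof (cases "y = 0")
      case True then show ?thesis using lam0 by (simp add: rows_of_def)
    next
      case False
      have "card {z \<in> ?D. fst z = y \<and> V z = v} = card {z \<in> ?D. fst z = y \<and> T z = v}" for v
      proof (rule bij_betw_same_card)
        show "bij_betw p {z \<in> ?D. fst z = y \<and> V z = v} {z \<in> ?D. fst z = y \<and> T z = v}"
        proof (rule bij_betw_imageI)
          show "p ` {z \<in> ?D. fst z = y \<and> V z = v} = {z \<in> ?D. fst z = y \<and> T z = v}"
          proof (intro equalityI subsetI)
            fix z assume z: "z \<in> {z \<in> ?D. fst z = y \<and> T z = v}"
            then obtain w where w: "w \<in> ?D" "z = p w" using permutes_image[OF p(2)] by blast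
            then show "z \<in> p ` {z \<in> ?D. fst z = y \<and> V z = v}" using z p(1,3) by auto
          qed (use p permutes_in_image[OF p(2)] in auto)
        qed (use permutes_inj_on[OF p(2)] in auto)
      qed
      then show ?thesis using False by (intro multiset_eqI) (simp add: count_rows_of)
    qed
  qed
next
  let ?D = "diagram lam"
  assume r: "rows_of lam V = rows_of lam T"
  have fin: "finite ?D" by (rule finite_diagram[OF comp])
  have "image_mset (\<lambda>z. (fst z, V z)) (mset_set ?D) = image_mset (\<lambda>z. (fst z, T z)) (mset_set ?D)"
  proof (rule multiset_eqI)
    fix b :: "nat \<times> nat"
    obtain y v where b: "b = (y, v)" by (cases b)
    have e: "count (image_mset (\<lambda>z. (fst z, T z)) (mset_set ?D)) b = card {z \<in> ?D. fst z = y \<and> T z = v}" for T :: tableau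
      by (simp add: count_image_mset_set[OF fin] b)
    show "count (image_mset (\<lambda>z. (fst z, V z)) (mset_set ?D)) b = count (image_mset (\<lambda>z. (fst z, T z)) (mset_set ?D)) b"
    proof (cases "y = 0")
      case True
      then have empty: "{z \<in> ?D. fst z = y \<and> T z = v} = {}" for T :: tableau by (auto simp: diagram_def)
      show ?thesis unfolding e empty ..
    next
      case False
      then show ?thesis unfolding e using fun_cong[OF r, of y]
        by (simp add: count_rows_of[symmetric])
    qed
  qed
  then obtain p where p: "p permutes ?D" "\<forall>z\<in>?D. (fst z, V z) = (fst (p z), T (p z))"
    using image_mset_eq_implies_permutes[OF fin] by blast
  have "V z = (T \<circ> p) z" for z
    using p V[of z] T[of z] permutes_not_in[OF p(1), of z] by (cases "z \<in> ?D") auto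
  then have "V = T \<circ> p" by (rule ext)
  then show "V \<in> row_rearrangements lam T" using p by (auto simp: row_rearrangements_def)
qed

lemma row_rearrangements_outside:
  assumes "V \<in> row_rearrangements lam T" "T z = 0" "z \<notin> diagram lam"
  shows "V z = 0"
  using assms by (auto simp: row_rearrangements_def permutes_not_in)

lemma partition_antimono:
  assumes "is_partition lam" "1 \<le> i" "i \<le> j" shows "lam j \<le> lam i"
  using assms(3)
proof (induction j rule: dec_induct)
  case (step j)
  then show ?case using assms(1,2) unfolding is_partition_def by (meson le_trans)
qed simp

lemma transfer_tabloid_eq_iff:
  assumes comp: "is_composition lam" and t: "filling lam t" and s: "s \<in> column_stabiliser lam t"
  shows "transfer_tabloid lam t W = transfer_tabloid lam (s \<circ> t) T \<longleftrightarrow> (\<forall>z\<in>diagram lam. T z = W (col_move lam t s z))"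
proof
  let ?D = "diagram lam" and ?m = "col_move lam t s"
  note m = col_move[OF t s]
  have injt: "inj_on t ?D" using t by (auto simp: filling_def bij_betw_def)
  {
    assume e: "transfer_tabloid lam t W = transfer_tabloid lam (s \<circ> t) T"
    show "\<forall>z\<in>?D. T z = W (?m z)"
    proof
      fix z assume z: "z \<in> ?D"
      then have "s (t z) \<in> transfer_tabloid lam (s \<circ> t) T (T z)" by (auto simp: transfer_tabloid_def)
      then have "t (?m z) \<in> transfer_tabloid lam t W (T z)" using e m(3)[OF z] by simp
      then obtain w where "w \<in> ?D" "W w = T z" "t (?m z) = t w" by (auto simp: transfer_tabloid_def)
      then show "T z = W (?m z)" using injt m(1)[OF z] by (metis inj_onD)
    qed
  next
    assume e: "\<forall>z\<in>?D. T z = W (?m z)"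
    have im: "?m ` ?D = ?D" by (rule permutes_image[OF col_move_permutes[OF finite_diagram[OF comp] t s]])
    show "transfer_tabloid lam t W = transfer_tabloid lam (s \<circ> t) T"
    proof
      fix k
      have "{w \<in> ?D. W w = k} = ?m ` {z \<in> ?D. T z = k}"
      proof (intro equalityI subsetI)
        fix w assume w: "w \<in> {w \<in> ?D. W w = k}"
        then obtain z where "z \<in> ?D" "w = ?m z" using im by blast
        then show "w \<in> ?m ` {z \<in> ?D. T z = k}" using w e by auto
      qed (use m(1) e in auto)
      then have "transfer_tabloid lam t W k = (\<lambda>z. t (?m z)) ` {z \<in> ?D. T z = k}"
        by (simp add: transfer_tabloid_def image_image)
      also have "\<dots> = transfer_tabloid lam (s \<circ> t) T k"
        unfolding transfer_tabloid_def by (rule image_cong) (use m(3) in auto)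
      finally show "transfer_tabloid lam t W k = transfer_tabloid lam (s \<circ> t) T k" .
    qed
  }
qed

text \<open>
  The distinct rearrangements in the definition of \<open>Theta_filling\<close> yield distinct tabloids, so
  that each column permutation contributes its sign or zero.
\<close>
lemma Theta_polytabloid_coefficient:
  assumes comp: "is_composition lam" and t: "filling lam t" and T: "\<And>z. z \<notin> diagram lam \<Longrightarrow> T z = 0"
  shows "Theta lam T (polytabloid lam t) (transfer_tabloid lam t W) = (of_int (alt_count lam t W (rows_of lam T)) :: 'f::field)"
proof -
  let ?D = "diagram lam" and ?CS = "column_stabiliser lam t"
  have lam0: "lam 0 = 0" using comp by (simp add: is_composition_def)
  have fin: "finite ?D" by (rule finite_diagram[OF comp])
  have finrr: "finite (row_rearrangements lam T)"
    by (rule finite_subset[OF _ finite_imageI[OF finite_permutations[OF fin], of "\<lambda>p. T \<circ> p"]])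
      (auto simp: row_rearrangements_def)
  have coef: "Theta lam T (act s (single (tabloid_of lam t))) (transfer_tabloid lam t W)
      = (if rows_of lam (W \<circ> col_move lam t s) = rows_of lam T then 1 else 0 :: 'f)" if s: "s \<in> ?CS" for s
  proof -
    have ps: "s permutes {1..csize lam}" using s by (simp add: column_stabiliser_def)
    let ?V = "\<lambda>z. if z \<in> ?D then W (col_move lam t s z) else 0"
    have e: "Theta lam T (act s (single (tabloid_of lam t))) = (Theta_filling lam T (s \<circ> t) :: 'f tvec)"
      using Theta_single[OF comp filling_comp[OF t ps]]
      by (simp add: act_single[OF permutes_bij[OF ps]] tabloid_of_comp)
    have "Theta lam T (act s (single (tabloid_of lam t))) (transfer_tabloid lam t W)
        = (\<Sum>T1\<in>row_rearrangements lam T. if transfer_tabloid lam t W = transfer_tabloid lam (s \<circ> t) T1 then 1 else (0::'f))"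
      unfolding e by (simp add: Theta_filling_def tvec_sum_apply single_def)
    also have "\<dots> = (\<Sum>T1\<in>row_rearrangements lam T. if T1 = ?V then 1 else 0)"
    proof (rule sum.cong)
      fix T1 assume T1: "T1 \<in> row_rearrangements lam T"
      have "T1 z = 0" if z: "z \<notin> ?D" for z by (rule row_rearrangements_outside[OF T1 T[OF z] z])
      then have iff: "(\<forall>z\<in>?D. T1 z = W (col_move lam t s z)) \<longleftrightarrow> T1 = ?V"
        unfolding fun_eq_iff by (metis (full_types))
      show "(if transfer_tabloid lam t W = transfer_tabloid lam (s \<circ> t) T1 then 1 else (0::'f)) = (if T1 = ?V then 1 else 0)"
        unfolding transfer_tabloid_eq_iff[OF comp t s] iff ..
    qed (rule refl)
    also have "\<dots> = (if ?V \<in> row_rearrangements lam T then 1 else 0)" using finrr by simp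
    also have "?V \<in> row_rearrangements lam T \<longleftrightarrow> rows_of lam ?V = rows_of lam T"
      by (rule row_rearrangements_iff[OF comp T]) auto
    also have "rows_of lam ?V = rows_of lam (W \<circ> col_move lam t s)"
      by (rule rows_of_cong) (use lam0 in auto)
    finally show ?thesis .
  qed
  have "Theta lam T (polytabloid lam t) (transfer_tabloid lam t W)
     = (\<Sum>s\<in>?CS. of_int (sign s) * Theta lam T (act s (single (tabloid_of lam t))) (transfer_tabloid lam t W) :: 'f)"
    unfolding polytabloid_def Theta_sum by (simp add: tvec_sum_apply tscale_def)
  also have "\<dots> = (\<Sum>s\<in>?CS. of_int (sign s * (if rows_of lam (W \<circ> col_move lam t s) = rows_of lam T then 1 else 0)))"
  proof (rule sum.cong[OF refl])
    fix s assume "s \<in> ?CS"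
    from coef[OF this]
    show "of_int (sign s) * Theta lam T (act s (single (tabloid_of lam t))) (transfer_tabloid lam t W)
      = (of_int (sign s * (if rows_of lam (W \<circ> col_move lam t s) = rows_of lam T then 1 else 0)) :: 'f)"
      by simp
  qed
  finally show ?thesis by (simp add: alt_count_def)
qed

text \<open>
  The coefficient in the relation counts the subsets \<open>K\<close> of row \<open>x'\<close> whose entries are the ones
  that were moved down.  For a fixed \<open>K\<close>, the remaining condition only concerns the joint
  content of row \<open>x\<close> and \<open>K\<close>, the content of the rest of row \<open>x'\<close>, and the other rows.  It is
  unchanged when the two nodes in rows \<open>x\<close> and \<open>x'\<close> of a column that meets \<open>K\<close> are interchanged.
  This is a column transposition, so the signs cancel; such a column exists because there is
  a surplus.
\<close>
lemma garnir_alt_count: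
  fixes lam :: "nat \<Rightarrow> nat"
  assumes part: "is_partition lam" and t: "filling lam t"
  shows "garnir lam (\<lambda>N. of_int (alt_count lam t W N) :: 'f::comm_ring_1)"
  unfolding garnir_def
proof (intro allI impI)
  fix N :: "nat \<Rightarrow> nat multiset" and x x' :: nat and A B :: "nat multiset"
  assume x: "1 \<le> x" "x < x'" and sA: "lam x < size A" and sAB: "size A + size B = lam x + lam x'"
  let ?D = "diagram lam" and ?CS = "column_stabiliser lam t"
  define k where "k = size A - lam x"
  define S where "S = {C. C \<subseteq># A \<and> size C = k}"
  define V where "V s = W \<circ> col_move lam t s" for s
  define con where "con v K = image_mset (\<lambda>c. v (x', c)) (mset_set K)" for v :: tableau and K
  define M where "M C = N(x := A - C, x' := C + B)" for C
  define good where "good v K \<longleftrightarrow> con v K \<in> S \<and> rows_of lam v = M (con v K)" for v K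
  have injt: "inj_on t ?D" using t by (auto simp: filling_def bij_betw_def)
  have xx: "x \<noteq> x'" using x by simp
  have kpos: "k > 0" using sA by (simp add: k_def)
  have anti: "lam x' \<le> lam x"
    using partition_antimono[OF part, of x x'] x by simp
  have finS: "finite S" unfolding S_def by (rule finite_subset[OF _ finite_submultisets[of A]]) auto
  have finK: "finite K" if "K \<subseteq> {1..lam x'}" for K using that finite_subset by blast
  have count_step: "(\<Sum>C\<in>S. int (mchoose C B) * (if rows_of lam v = M C then 1 else 0))
      = (\<Sum>K\<in>Pow {1..lam x'}. if good v K then 1 else 0)" for v
  proof -
    have "int (mchoose C B) * (if rows_of lam v = M C then 1 else 0)
        = (\<Sum>K\<in>Pow {1..lam x'}. if con v K = C \<and> rows_of lam v = M C then 1 else 0)" if "C \<in> S" for C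
    proof (cases "rows_of lam v = M C")
      case True
      have content: "image_mset (\<lambda>c. v (x', c)) (mset_set {1..lam x'}) = C + B"
        using fun_cong[OF True, of x'] by (simp add: rows_of_def M_def)
      have "card {K. K \<subseteq> {1..lam x'} \<and> con v K = C} = mchoose C B"
        unfolding con_def by (rule card_subsets_with_image[OF _ content]) simp
      then have "int (mchoose C B) = int (card {K \<in> Pow {1..lam x'}. con v K = C})" by simp
      also have "\<dots> = (\<Sum>K\<in>{K \<in> Pow {1..lam x'}. con v K = C}. 1)" by simp
      also have "\<dots> = (\<Sum>K\<in>Pow {1..lam x'}. if con v K = C then 1 else 0)"
        by (rule sum.inter_filter) simp
      finally show ?thesis unfolding True by simp
    qed simp
    then have "(\<Sum>C\<in>S. int (mchoose C B) * (if rows_of lam v = M C then 1 else 0))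
       = (\<Sum>C\<in>S. \<Sum>K\<in>Pow {1..lam x'}. if con v K = C \<and> rows_of lam v = M C then 1 else 0)"
      by (rule sum.cong[OF refl])
    also have "\<dots> = (\<Sum>K\<in>Pow {1..lam x'}. \<Sum>C\<in>S. if con v K = C \<and> rows_of lam v = M C then 1 else 0)"
      by (rule sum.swap)
    also have "\<dots> = (\<Sum>K\<in>Pow {1..lam x'}. if good v K then 1 else 0)"
    proof (rule sum.cong[OF refl])
      fix K
      have "(\<Sum>C\<in>S. if con v K = C \<and> rows_of lam v = M C then 1 else (0::int))
        = (\<Sum>C\<in>S. if con v K = C then (if rows_of lam v = M (con v K) then 1 else 0) else 0)"
        by (rule sum.cong) auto
      then show "(\<Sum>C\<in>S. if con v K = C \<and> rows_of lam v = M C then 1 else (0::int)) = (if good v K then 1 else 0)"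
        using finS by (simp add: good_def)
    qed
    finally show ?thesis .
  qed
  have good_iff: "good v K \<longleftrightarrow> card K = k \<and> rows_of lam v x + con v K = A \<and> con v ({1..lam x'} - K) = B
      \<and> (\<forall>y. y \<noteq> x \<longrightarrow> y \<noteq> x' \<longrightarrow> rows_of lam v y = N y)" if K: "K \<subseteq> {1..lam x'}" for v K
  proof -
    have "mset_set {1..lam x'} = mset_set K + mset_set ({1..lam x'} - K)"
      using K finK[OF K] by (metis Diff_disjoint Un_Diff_cancel2 finite_Diff finite_atLeastAtMost mset_set_Union sup.absorb2 Un_Diff_cancel)
    then have row': "rows_of lam v x' = con v K + con v ({1..lam x'} - K)"
      by (simp add: rows_of_def con_def)
    have sz: "size (con v K) = card K" by (simp add: con_def)
    have "rows_of lam v = M C \<longleftrightarrow> rows_of lam v x = A - C \<and> rows_of lam v x' = C + B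
        \<and> (\<forall>y. y \<noteq> x \<longrightarrow> y \<noteq> x' \<longrightarrow> rows_of lam v y = N y)" for C
      using xx by (auto simp: M_def fun_eq_iff)
    moreover have "con v K \<subseteq># A \<and> rows_of lam v x = A - con v K \<longleftrightarrow> rows_of lam v x + con v K = A"
      by (auto simp: subset_mset.diff_add)
    ultimately show ?thesis unfolding good_def S_def using row' sz by auto
  qed
  have inner: "(\<Sum>s\<in>?CS. sign s * (if good (V s) K then 1 else 0)) = 0" if K: "K \<subseteq> {1..lam x'}" for K
  proof (cases "card K = k")
    case False
    then have "\<not> good (V s) K" for s using good_iff[OF K] by blast
    then show ?thesis by simp
  next
    case True
    then obtain c where c: "c \<in> K" using kpos by (metis card.empty ex_in_conv less_numeral_extra(3))
    have Dx': "(x', c) \<in> ?D" and Dx: "(x, c) \<in> ?D"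
      using c K x anti by (auto simp: diagram_def)
    let ?\<tau> = "transpose (t (x, c)) (t (x', c))"
    have ne: "t (x, c) \<noteq> t (x', c)" using injt Dx Dx' xx by (auto dest: inj_onD)
    have tD: "t z \<in> {1..csize lam}" if "z \<in> ?D" for z using t that by (auto simp: filling_def bij_betw_def)
    have \<tau>p: "?\<tau> permutes {1..csize lam}" by (rule permutes_swap_id) (use tD Dx Dx' in auto)
    have \<tau>t: "?\<tau> (t z) = t (transpose (x, c) (x', c) z)" if "z \<in> ?D" for z
      using injt Dx Dx' that by (auto simp: transpose_def dest: inj_onD)
    have trD: "transpose (x, c) (x', c) z \<in> ?D" "snd (transpose (x, c) (x', c) z) = snd z" if "z \<in> ?D" for z
      using that Dx Dx' by (auto simp: transpose_def)
    have CS: "s \<circ> ?\<tau> \<in> ?CS" if s: "s \<in> ?CS" for s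
    proof -
      have "s \<circ> ?\<tau> permutes {1..csize lam}"
        using s \<tau>p by (auto simp: column_stabiliser_def intro: permutes_compose)
      moreover have "\<exists>z'\<in>?D. snd z' = snd z \<and> (s \<circ> ?\<tau>) (t z) = t z'" if z: "z \<in> ?D" for z
      proof -
        have "\<forall>w\<in>?D. \<exists>z'\<in>?D. snd z' = snd w \<and> s (t w) = t z'"
          using s by (simp add: column_stabiliser_def)
        from bspec[OF this trD(1)[OF z]] show ?thesis
          by (simp only: trD(2)[OF z] comp_apply \<tau>t[OF z])
      qed
      ultimately show ?thesis by (simp add: column_stabiliser_def)
    qed
    have Vs: "V (s \<circ> ?\<tau>) z = V s (transpose (x, c) (x', c) z)" if "z \<in> ?D" for s z
      using that trD[OF that] \<tau>t[OF that] by (simp add: V_def col_move_def)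
    have goodinv: "good (V (s \<circ> ?\<tau>)) K \<longleftrightarrow> good (V s) K" for s
    proof -
      let ?v = "V s" and ?v' = "V (s \<circ> ?\<tau>)"
      have rest: "?v' z = ?v z" if "z \<in> ?D" "z \<noteq> (x, c)" "z \<noteq> (x', c)" for z
        using Vs[OF that(1)] that by (simp add: transpose_def)
      have sw: "?v' (x, c) = ?v (x', c)" "?v' (x', c) = ?v (x, c)"
        using Vs[OF Dx] Vs[OF Dx'] by (auto simp: transpose_def)
      have rx: "rows_of lam v x = add_mset (v (x, c)) (image_mset (\<lambda>d. v (x, d)) (mset_set ({1..lam x} - {c})))" for v
        unfolding rows_of_def using Dx
        by (subst mset_set.remove[of _ c]) (auto simp: diagram_def)
      have rK: "con v K = add_mset (v (x', c)) (image_mset (\<lambda>d. v (x', d)) (mset_set (K - {c})))" for v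
        unfolding con_def using finK[OF K] c by (subst mset_set.remove[of _ c]) auto
      have "image_mset (\<lambda>d. ?v' (x, d)) (mset_set ({1..lam x} - {c})) = image_mset (\<lambda>d. ?v (x, d)) (mset_set ({1..lam x} - {c}))"
        by (rule image_mset_cong) (use x xx in \<open>auto intro!: rest simp: diagram_def\<close>)
      moreover have "image_mset (\<lambda>d. ?v' (x', d)) (mset_set (K - {c})) = image_mset (\<lambda>d. ?v (x', d)) (mset_set (K - {c}))"
        by (rule image_mset_cong) (use x xx K finK[OF K] in \<open>auto intro!: rest simp: diagram_def\<close>)
      ultimately have 1: "rows_of lam ?v' x + con ?v' K = rows_of lam ?v x + con ?v K"
        unfolding rx rK sw by simp
      have 2: "con ?v' ({1..lam x'} - K) = con ?v ({1..lam x'} - K)"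
        unfolding con_def by (rule image_mset_cong) (use x xx c in \<open>auto intro!: rest simp: diagram_def\<close>)
      have 3: "rows_of lam ?v' y = rows_of lam ?v y" if "y \<noteq> x" "y \<noteq> x'" for y
      proof (cases "y = 0")
        case True
        then show ?thesis using part by (simp add: rows_of_def is_partition_def is_composition_def)
      next
        case False
        then show ?thesis unfolding rows_of_def
          by (intro image_mset_cong) (use that in \<open>auto intro!: rest simp: diagram_def\<close>)
      qed
      show ?thesis unfolding good_iff[OF K] using 1 2 3 by auto
    qed
    have sgn: "sign (s \<circ> ?\<tau>) = - sign s" if "s \<in> ?CS" for s
    proof -
      have "permutation s" using that by (auto simp: column_stabiliser_def permutation_permutes)
      then show ?thesis using ne by (simp add: sign_compose sign_swap_id permutation_swap_id)
    qed
    have ss: "s \<circ> ?\<tau> \<circ> ?\<tau> = s" for s by (simp add: fun_eq_iff)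
    have "(\<Sum>s\<in>?CS. sign s * (if good (V s) K then 1 else 0)) = (\<Sum>s\<in>?CS. sign (s \<circ> ?\<tau>) * (if good (V (s \<circ> ?\<tau>)) K then 1 else 0))"
      by (rule sum.reindex_bij_witness[where i = "\<lambda>s. s \<circ> ?\<tau>" and j = "\<lambda>s. s \<circ> ?\<tau>"])
        (simp_all only: CS ss)
    also have "\<dots> = - (\<Sum>s\<in>?CS. sign s * (if good (V s) K then 1 else 0))"
      unfolding sum_negf[symmetric] by (rule sum.cong) (auto simp: goodinv sgn)
    finally show ?thesis by simp
  qed
  have "(\<Sum>C\<in>S. int (mchoose C B) * alt_count lam t W (M C))
     = (\<Sum>C\<in>S. \<Sum>s\<in>?CS. sign s * (int (mchoose C B) * (if rows_of lam (V s) = M C then 1 else 0)))"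
    by (simp add: alt_count_def V_def sum_distrib_left mult.left_commute)
  also have "\<dots> = (\<Sum>s\<in>?CS. sign s * (\<Sum>C\<in>S. int (mchoose C B) * (if rows_of lam (V s) = M C then 1 else 0)))"
    by (subst sum.swap) (simp add: sum_distrib_left)
  also have "\<dots> = (\<Sum>s\<in>?CS. \<Sum>K\<in>Pow {1..lam x'}. sign s * (if good (V s) K then 1 else 0))"
    unfolding count_step by (simp add: sum_distrib_left)
  also have "\<dots> = (\<Sum>K\<in>Pow {1..lam x'}. \<Sum>s\<in>?CS. sign s * (if good (V s) K then 1 else 0))"
    by (rule sum.swap)
  also have "\<dots> = 0" by (rule sum.neutral) (use inner in auto)
  finally have "of_int (\<Sum>C\<in>S. int (mchoose C B) * alt_count lam t W (M C)) = (0 :: 'f)" by (simp only: of_int_0)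
  then show "(\<Sum>C | C \<subseteq># A \<and> size C = size A - lam x. of_nat (mchoose C B) *
        (of_int (alt_count lam t W (N(x := A - C, x' := C + B))) :: 'f)) = 0"
    by (simp add: S_def M_def k_def)
qed

section \<open>Unitriangularity for dominance\<close>

lemma card_column_sum:
  assumes "finite (D :: (nat \<times> nat) set)"
  shows "card {z \<in> D. P z} = (\<Sum>c\<in>snd ` D. card {x. (x, c) \<in> D \<and> P (x, c)})"
proof -
  have "card {x. (x, c) \<in> D \<and> P (x, c)} = card {z \<in> D. P z \<and> snd z = c}" for c
  proof -
    have "{z \<in> D. P z \<and> snd z = c} = (\<lambda>x. (x, c)) ` {x. (x, c) \<in> D \<and> P (x, c)}" by force
    then show ?thesis by (simp add: card_image inj_on_def)
  qed
  moreover have "card {z \<in> D. P z} = card (\<Union>c\<in>snd ` D. {z \<in> D. P z \<and> snd z = c})"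
    by (rule arg_cong[where f = card]) auto
  moreover have "card (\<Union>c\<in>snd ` D. {z \<in> D. P z \<and> snd z = c}) = (\<Sum>c\<in>snd ` D. card {z \<in> D. P z \<and> snd z = c})"
    by (rule card_UN_disjoint) (use assms in auto)
  ultimately show ?thesis by simp
qed

lemma ncount_rows_of:
  assumes "is_composition lam"
  shows "ncount (rows_of lam V) l r = card {z \<in> diagram lam. fst z \<le> r \<and> V z \<le> l}"
proof -
  let ?D = "diagram lam"
  have fin: "finite ?D" by (rule finite_diagram[OF assms])
  have "size (filter_mset (\<lambda>v. v \<le> l) (rows_of lam V y)) = card {z \<in> ?D. fst z = y \<and> V z \<le> l}" for y
  proof -
    have "{z \<in> ?D. fst z = y \<and> V z \<le> l} = Pair y ` {c \<in> {1..lam y}. V (y, c) \<le> l}"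
      using assms by (cases "y = 0") (auto simp: diagram_def is_composition_def)
    then show ?thesis by (simp add: rows_of_def filter_mset_image_mset card_image inj_on_def filter_mset_mset_set)
  qed
  then have "ncount (rows_of lam V) l r = (\<Sum>y\<le>r. card {z \<in> ?D. fst z = y \<and> V z \<le> l})"
    by (simp add: ncount_def)
  also have "\<dots> = card (\<Union>y\<in>{..r}. {z \<in> ?D. fst z = y \<and> V z \<le> l})"
    by (rule card_UN_disjoint[symmetric]) (use fin in auto)
  also have "(\<Union>y\<in>{..r}. {z \<in> ?D. fst z = y \<and> V z \<le> l}) = {z \<in> ?D. fst z \<le> r \<and> V z \<le> l}" by auto
  finally show ?thesis .
qed

lemma dominates_iff_ncount:
  assumes "is_composition lam"
  shows "dominates lam S U \<longleftrightarrow> (\<forall>l r. ncount (rows_of lam U) l r \<le> ncount (rows_of lam S) l r)"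
proof -
  have "{(x, y) \<in> diagram lam. x \<le> r \<and> S (x, y) \<le> l} = {z \<in> diagram lam. fst z \<le> r \<and> S z \<le> l}" for S :: tableau and l r
    by auto
  then show ?thesis by (simp add: dominates_def ncount_rows_of[OF assms])
qed

lemma ncount_antisym:
  assumes "\<And>l r. ncount N l r = ncount N' l r" shows "N = N'"
proof
  fix y
  have s: "size (filter_mset (\<lambda>v. v \<le> l) (N y)) = size (filter_mset (\<lambda>v. v \<le> l) (N' y))" for l
  proof (cases y)
    case 0
    then show ?thesis using assms[of l 0] by (simp add: ncount_def)
  next
    case (Suc r)
    then show ?thesis using assms[of l r] assms[of l "Suc r"] by (simp add: ncount_def)
  qed
  have c: "size (filter_mset (\<lambda>v. v \<le> Suc l) M) = size (filter_mset (\<lambda>v. v \<le> l) M) + count M (Suc l)" for l and M :: "nat multiset"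
    by (induction M) auto
  have c0: "size (filter_mset (\<lambda>v. v \<le> 0) M) = count M 0" for M :: "nat multiset"
    by (induction M) auto
  show "N y = N' y"
  proof (rule multiset_eqI)
    fix v show "count (N y) v = count (N' y) v"
    proof (cases v)
      case 0 then show ?thesis using s[of 0, unfolded c0] by simp
    next
      case (Suc l) then show ?thesis using s[of l] s[of "Suc l", unfolded c] by simp
    qed
  qed
qed

definition col_count :: "(nat \<Rightarrow> nat) \<Rightarrow> tableau \<Rightarrow> nat \<Rightarrow> nat \<Rightarrow> nat \<Rightarrow> nat" where
  "col_count lam V l r c = card {x. (x, c) \<in> diagram lam \<and> x \<le> r \<and> V (x, c) \<le> l}"

lemma ncount_columns:
  assumes "is_composition lam"
  shows "ncount (rows_of lam V) l r = (\<Sum>c\<in>snd ` diagram lam. col_count lam V l r c)"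
  unfolding ncount_rows_of[OF assms] card_column_sum[OF finite_diagram[OF assms]] col_count_def by simp

text \<open>
  In a strictly increasing column the entries at most \<open>l\<close> occupy an initial segment.  If this
  segment ends in the first \<open>r\<close> rows, all of these entries are counted on the right-hand side;
  otherwise all of the first \<open>r\<close> rows are.
\<close>
lemma col_count_le:
  assumes comp: "is_composition lam" and t: "filling lam t" and s: "s \<in> column_stabiliser lam t"
    and W: "column_strict lam W"
  shows "col_count lam (W \<circ> col_move lam t s) l r c \<le> col_count lam W l r c"
proof -
  let ?D = "diagram lam" and ?m = "col_move lam t s"
  let ?A = "{x. (x, c) \<in> ?D \<and> x \<le> r \<and> W (?m (x, c)) \<le> l}" and ?B = "{x. (x, c) \<in> ?D \<and> x \<le> r \<and> W (x, c) \<le> l}"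
  have finB: "finite ?B" by (rule finite_subset[of _ "{..r}"]) auto
  have "card ?A \<le> card ?B"
  proof (cases "\<exists>x0>r. (x0, c) \<in> ?D \<and> W (x0, c) \<le> l")
    case True
    then obtain x0 where x0: "x0 > r" "(x0, c) \<in> ?D" "W (x0, c) \<le> l" by blast
    have "?A \<subseteq> ?B"
    proof
      fix x assume x: "x \<in> ?A"
      then have "W (x, c) < W (x0, c)" using W x0 unfolding column_strict_def by auto
      then show "x \<in> ?B" using x x0 by simp
    qed
    then show ?thesis by (rule card_mono[OF finB])
  next
    case False
    have m: "?m (x, c) = (fst (?m (x, c)), c)" "?m (x, c) \<in> ?D" if "(x, c) \<in> ?D" for x
      using col_move[OF t s that] by (auto simp: prod_eq_iff)
    have "inj_on (\<lambda>x. fst (?m (x, c))) ?A"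
    proof (rule inj_onI)
      fix x y assume xy: "x \<in> ?A" "y \<in> ?A" "fst (?m (x, c)) = fst (?m (y, c))"
      then have "?m (x, c) = ?m (y, c)" using m(1)[of x] m(1)[of y] by (metis (no_types, lifting) mem_Collect_eq)
      moreover have "inj ?m" using col_move_permutes[OF finite_diagram[OF comp] t s] permutes_inj by blast
      ultimately show "x = y" by (auto dest: injD)
    qed
    moreover have "(\<lambda>x. fst (?m (x, c))) ` ?A \<subseteq> ?B"
    proof (rule image_subsetI)
      fix x assume x: "x \<in> ?A"
      define x1 where "x1 = fst (?m (x, c))"
      have "?m (x, c) = (x1, c)" "(x1, c) \<in> ?D" using m[of x] x by (auto simp: x1_def)
      then have "(x1, c) \<in> ?D" "W (x1, c) \<le> l" using x by auto
      then have "x1 \<in> ?B" using False by (auto simp: not_less)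
      then show "fst (?m (x, c)) \<in> ?B" by (simp only: x1_def)
    qed
    ultimately show ?thesis by (rule card_inj_on_le) (rule finB)
  qed
  then show ?thesis by (simp add: col_count_def)
qed

lemma alt_count_nonzero_ncount:
  assumes comp: "is_composition lam" and t: "filling lam t" and W: "column_strict lam W"
    and nz: "alt_count lam t W N \<noteq> 0"
  shows "ncount N l r \<le> ncount (rows_of lam W) l r"
proof -
  obtain s where s: "s \<in> column_stabiliser lam t" "rows_of lam (W \<circ> col_move lam t s) = N"
  proof (rule ccontr)
    assume "\<not> thesis"
    then have "\<forall>s\<in>column_stabiliser lam t. rows_of lam (W \<circ> col_move lam t s) \<noteq> N" using that by blast
    then have "alt_count lam t W N = 0" by (simp add: alt_count_def)
    then show False using nz by simp
  qed
  show ?thesis unfolding s(2)[symmetric] ncount_columns[OF comp]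
    by (rule sum_mono) (rule col_count_le[OF comp t s(1) W])
qed

text \<open>
  Equal row contents turn the inequalities of \<open>col_count_le\<close>, summed over the columns, into
  equalities, and therefore each single one of them.  Comparing them for consecutive numbers
  of rows shows that no entry has changed.
\<close>
lemma col_move_trivial:
  assumes comp: "is_composition lam" and t: "filling lam t" and s: "s \<in> column_stabiliser lam t"
    and W: "column_strict lam W" and rows: "rows_of lam (W \<circ> col_move lam t s) = rows_of lam W"
  shows "s = id"
proof -
  let ?D = "diagram lam" and ?m = "col_move lam t s"
  let ?V = "W \<circ> ?m"
  have fin: "finite ?D" by (rule finite_diagram[OF comp])
  have colc: "col_count lam ?V l r c = col_count lam W l r c" if "c \<in> snd ` ?D" for l r c
  proof (rule sum_mono_inv[of "col_count lam ?V l r" "snd ` ?D" "col_count lam W l r"])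
    show "(\<Sum>c\<in>snd ` ?D. col_count lam ?V l r c) = (\<Sum>c\<in>snd ` ?D. col_count lam W l r c)"
      unfolding ncount_columns[OF comp, symmetric] rows ..
  qed (use that fin col_count_le[OF comp t s W] in auto)
  have step: "col_count lam U l (Suc r) c = col_count lam U l r c + (if (Suc r, c) \<in> ?D \<and> U (Suc r, c) \<le> l then 1 else 0)" for U l r c
  proof -
    let ?A = "\<lambda>r. {x. (x, c) \<in> ?D \<and> x \<le> r \<and> U (x, c) \<le> l}"
    have "finite (?A r)" by (rule finite_subset[of _ "{..r}"]) auto
    moreover have "?A (Suc r) = (if (Suc r, c) \<in> ?D \<and> U (Suc r, c) \<le> l then insert (Suc r) (?A r) else ?A r)"
      by (auto simp: le_Suc_eq)
    ultimately show ?thesis by (simp add: col_count_def)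
  qed
  have le_iff: "?V z \<le> l \<longleftrightarrow> W z \<le> l" if z: "z \<in> ?D" for z l
  proof -
    obtain x c where xc: "z = (x, c)" by (cases z)
    then obtain r where r: "x = Suc r" using z by (cases x) (auto simp: diagram_def)
    have "c \<in> snd ` ?D" using z xc by force
    then have "col_count lam ?V l (Suc r) c = col_count lam W l (Suc r) c" "col_count lam ?V l r c = col_count lam W l r c"
      using colc by auto
    then show ?thesis unfolding step using z unfolding xc r by (simp split: if_splits)
  qed
  have VW: "W (?m z) = W z" if "z \<in> ?D" for z
    using le_iff[OF that, of "W z"] le_iff[OF that, of "W (?m z)"] by simp
  have mz: "?m z = z" if z: "z \<in> ?D" for z
  proof (rule ccontr)
    assume ne: "?m z \<noteq> z"
    note cm = col_move[OF t s z]
    obtain x c x1 where xc: "z = (x, c)" "?m z = (x1, c)"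
      using cm(2) by (metis prod.collapse)
    then have "W (x1, c) = W (x, c)" "(x1, c) \<in> ?D" "(x, c) \<in> ?D" "x1 \<noteq> x"
      using VW[OF z] cm(1) z ne by auto
    then show False using W unfolding column_strict_def by (metis less_irrefl nat_neq_iff)
  qed
  have "s (t z) = t z" if "z \<in> ?D" for z using col_move(3)[OF t s that] mz[OF that] by simp
  moreover have "t ` ?D = {1..csize lam}" using t by (simp add: filling_def bij_betw_def)
  ultimately have "s n = n" if "n \<in> {1..csize lam}" for n using that by (metis imageE)
  moreover have "s permutes {1..csize lam}" using s by (simp add: column_stabiliser_def)
  ultimately have "s n = n" for n by (cases "n \<in> {1..csize lam}") (blast dest: permutes_not_in)+
  then show "s = id" by (simp add: fun_eq_iff)
qed

lemma alt_count_self: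
  assumes comp: "is_composition lam" and t: "filling lam t" and W: "column_strict lam W"
  shows "alt_count lam t W (rows_of lam W) = 1"
proof -
  let ?CS = "column_stabiliser lam t"
  have id: "id \<in> ?CS" by (auto simp: column_stabiliser_def permutes_id)
  have "rows_of lam (W \<circ> col_move lam t id) = rows_of lam W"
  proof (rule rows_of_cong)
    have "inj_on t (diagram lam)" using t by (simp add: filling_def bij_betw_def)
    then show "(W \<circ> col_move lam t id) z = W z" if "z \<in> diagram lam" for z
      using that by (simp add: col_move_def)
  qed (use comp in \<open>simp add: is_composition_def\<close>)
  then have "alt_count lam t W (rows_of lam W) = (\<Sum>s\<in>?CS. if s = id then 1 else 0)"
    unfolding alt_count_def
    by (intro sum.cong) (auto dest: col_move_trivial[OF comp t _ W])
  then show ?thesis using id finite_column_stabiliser[of lam t] by simp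
qed

lemma row_standard_rows_inject:
  assumes comp: "is_composition lam" and S: "row_standard lam S" "row_standard lam U"
    and out: "\<And>z. z \<notin> diagram lam \<Longrightarrow> S z = U z" and rows: "rows_of lam S = rows_of lam U"
  shows "S = U"
proof -
  have iff: "S (x, y) \<le> l \<longleftrightarrow> y \<le> size (filter_mset (\<lambda>v. v \<le> l) (rows_of lam S x))"
    if z: "(x, y) \<in> diagram lam" and S: "row_standard lam S" for S x y l
  proof -
    let ?A = "{c \<in> {1..lam x}. S (x, c) \<le> l}"
    have sz: "size (filter_mset (\<lambda>v. v \<le> l) (rows_of lam S x)) = card ?A"
      by (simp add: rows_of_def filter_mset_image_mset filter_mset_mset_set)
    have y: "1 \<le> x" "1 \<le> y" "y \<le> lam x" using z by (auto simp: diagram_def)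
    have mono: "S (x, c) \<le> S (x, c')" if "1 \<le> c" "c \<le> c'" "c' \<le> lam x" for c c'
      using S that y(1) unfolding row_standard_def diagram_def by auto
    show ?thesis unfolding sz
    proof
      assume le: "S (x, y) \<le> l"
      have "{1..y} \<subseteq> ?A"
      proof
        fix c assume c: "c \<in> {1..y}"
        then have "S (x, c) \<le> S (x, y)" using mono[of c y] y by simp
        then show "c \<in> ?A" using c y le by simp
      qed
      then have "card {1..y} \<le> card ?A" by (intro card_mono) auto
      then show "y \<le> card ?A" by simp
    next
      assume c: "y \<le> card ?A"
      show "S (x, y) \<le> l"
      proof (rule ccontr)
        assume n: "\<not> S (x, y) \<le> l"
        have "?A \<subseteq> {1..<y}"
        proof
          fix c assume c: "c \<in> ?A"
          have "c < y"
          proof (rule ccontr)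
            assume "\<not> c < y"
            then have "S (x, y) \<le> S (x, c)" using mono[of y c] y c by auto
            then show False using n c by auto
          qed
          then show "c \<in> {1..<y}" using c by auto
        qed
        then have "card ?A \<le> card {1..<y}" by (intro card_mono) auto
        then show False using c y by simp
      qed
    qed
  qed
  show ?thesis
  proof
    fix z
    show "S z = U z"
    proof (cases "z \<in> diagram lam")
      case True
      obtain x y where z: "z = (x, y)" by (cases z)
      have "S z \<le> l \<longleftrightarrow> U z \<le> l" for l
        using iff[of x y S l] iff[of x y U l] True S rows unfolding z by simp
      then show ?thesis by (meson order_antisym order_refl)
    qed (rule out)
  qed
qed

section \<open>The tableau Re is semistandard of the restrictised type\<close>

text \<open>
  The number of larger elements is injective on \<open>P\<close> with values below \<open>card P\<close>, and hence takes
  all of these values.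
\<close>
lemma ex_rank:
  fixes P :: "nat set"
  assumes "finite P" "j < card P"
  shows "\<exists>x\<in>P. card {r \<in> P. x < r} = j"
proof -
  let ?g = "\<lambda>x. card {r \<in> P. x < r}"
  have less: "?g y < ?g x" if "x \<in> P" "y \<in> P" "x < y" for x y
    by (rule psubset_card_mono) (use assms(1) that in auto)
  have "inj_on ?g P"
  proof (rule inj_onI)
    fix x y assume "x \<in> P" "y \<in> P" "?g x = ?g y"
    then show "x = y" using less[of x y] less[of y x] by (metis less_irrefl nat_neq_iff)
  qed
  moreover have "?g ` P \<subseteq> {..<card P}"
  proof (rule image_subsetI)
    fix x assume "x \<in> P"
    then have "?g x < card P" by (intro psubset_card_mono) (use assms(1) in auto)
    then show "?g x \<in> {..<card P}" by simp
  qed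
  ultimately have "?g ` P = {..<card P}"
    by (intro card_subset_eq) (auto simp: card_image)
  then show ?thesis using assms(2) by (metis (no_types, lifting) imageE lessThan_iff)
qed

lemma rank_inj:
  fixes P :: "nat set"
  assumes "finite P" "x \<in> P" "y \<in> P" "card {r \<in> P. x < r} = card {r \<in> P. y < r}"
  shows "x = y"
proof (rule ccontr)
  have less: "card {r \<in> P. y < r} < card {r \<in> P. x < r}" if "x \<in> P" "y \<in> P" "x < y" for x y
    by (rule psubset_card_mono) (use assms(1) that in auto)
  assume "x \<noteq> y"
  then show False using less[of x y] less[of y x] assms by (metis less_irrefl nat_neq_iff)
qed

context
  fixes p :: nat and lam :: "nat \<Rightarrow> nat"
  assumes p2: "2 \<le> p"
begin

text \<open>
  Each ramp has exactly one node in each of its rows, which are the rows \<open>1, \<dots>, L\<close> with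
  \<open>L = l div (p - 1) + 1\<close>.
\<close>
definition ramp_node :: "nat \<Rightarrow> nat \<Rightarrow> nat \<times> nat" where
  "ramp_node l r = (r, l + 1 - (p - 1) * (r - 1))"

definition ramp_rows :: "nat \<Rightarrow> nat set" where
  "ramp_rows l = {1..l div (p - 1) + 1}"

definition ramp_present :: "nat \<Rightarrow> nat set" where
  "ramp_present l = {r \<in> ramp_rows l. ramp_node l r \<in> diagram lam}"

lemma ramp_rows_iff: "r \<in> ramp_rows l \<longleftrightarrow> 1 \<le> r \<and> (p - 1) * (r - 1) \<le> l"
proof -
  have "r - 1 \<le> l div (p - 1) \<longleftrightarrow> (r - 1) * (p - 1) \<le> l"
    by (rule less_eq_div_iff_mult_less_eq) (use p2 in simp)
  then show ?thesis by (auto simp: ramp_rows_def mult.commute)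
qed

lemma ramp_eq: "ramp p l = ramp_node l ` ramp_rows l"
proof (intro equalityI subsetI)
  fix z assume z: "z \<in> ramp p l"
  obtain r c where rc: "z = (r, c)" by (cases z)
  have "1 \<le> r" "1 \<le> c" "c - 1 + (p - 1) * (r - 1) = l" using z rc by (auto simp: ramp_def)
  then have "r \<in> ramp_rows l" "ramp_node l r = (r, c)" by (auto simp: ramp_rows_iff ramp_node_def)
  then show "z \<in> ramp_node l ` ramp_rows l" unfolding rc by (metis imageI)
next
  fix z assume "z \<in> ramp_node l ` ramp_rows l"
  then obtain r where r: "z = ramp_node l r" "1 \<le> r" "(p - 1) * (r - 1) \<le> l" by (auto simp: ramp_rows_iff)
  have "l + 1 - b \<ge> 1 \<and> l + 1 - b - 1 + b = l" if "b \<le> l" for b using that by simp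
  from this[OF r(3)] show "z \<in> ramp p l" using r(1,2) by (simp add: ramp_def ramp_node_def)
qed

lemma inj_ramp_node: "inj_on (ramp_node l) A"
  by (auto simp: inj_on_def ramp_node_def)

lemma ramp_node_col_less:
  assumes "i \<in> ramp_rows l" "r \<in> ramp_rows l"
  shows "snd (ramp_node l r) < snd (ramp_node l i) \<longleftrightarrow> i < r"
proof -
  have 1: "(p - 1) * (i - 1) < (p - 1) * (r - 1) \<longleftrightarrow> i - 1 < r - 1" using p2 by simp
  have 2: "(p - 1) * (i - 1) \<le> l" "(p - 1) * (r - 1) \<le> l" "1 \<le> i" "1 \<le> r"
    using assms by (auto simp: ramp_rows_iff)
  have "l + 1 - b < l + 1 - a \<longleftrightarrow> a < b" if "a \<le> l" "b \<le> l" for a b using that by auto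
  from this[OF 2(1,2)] show ?thesis unfolding ramp_node_def snd_conv 1 using 2(3,4) by auto
qed

lemma card_ramp_diagram: "card (ramp p l \<inter> diagram lam) = card (ramp_present l)"
proof -
  have "ramp p l \<inter> diagram lam = ramp_node l ` ramp_present l"
    by (auto simp: ramp_eq ramp_present_def)
  then show ?thesis by (simp add: card_image[OF inj_ramp_node])
qed

text \<open>
  From the bottom to the top, the entries of \<open>Re(\<lambda>)\<close> in a ramp with \<open>L\<close> rows are
  \<open>L, L - 1, \<dots>\<close>: they are the rows in which the nodes arrive when they are moved to the left.
\<close>
lemma Re_ramp_node:
  assumes x: "x \<in> ramp_present l"
  shows "Re_tableau p lam (ramp_node l x) + card {r \<in> ramp_present l. x < r} = l div (p - 1) + 1"
proof -
  let ?z = "ramp_node l x"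
  let ?A = "{r \<in> ramp_rows l. x < r \<and> r \<notin> ramp_present l}"
  have z: "?z \<in> diagram lam" "x \<in> ramp_rows l" using x by (auto simp: ramp_present_def)
  have zr: "?z \<in> ramp p l" using z by (simp add: ramp_eq)
  have un: "(\<exists>k. ?z \<in> ramp p k \<and> w \<in> ramp p k) \<longleftrightarrow> w \<in> ramp p l" for w
  proof -
    have "k = l" if "?z \<in> ramp p k" for k using that zr by (auto simp: ramp_def)
    then show ?thesis using zr by blast
  qed
  have "{w. x < fst w \<and> w \<in> ramp p l \<and> w \<notin> diagram lam} = ramp_node l ` ?A"
    by (auto simp: ramp_eq ramp_present_def ramp_node_def)
  then have "card {w. x < fst w \<and> w \<in> ramp p l \<and> w \<notin> diagram lam} = card ?A"
    by (simp add: card_image[OF inj_ramp_node])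
  moreover have "{(x', y'). x < x' \<and> (\<exists>k. ?z \<in> ramp p k \<and> (x', y') \<in> ramp p k) \<and> (x', y') \<notin> diagram lam}
      = {w. x < fst w \<and> w \<in> ramp p l \<and> w \<notin> diagram lam}"
    unfolding un by auto
  ultimately have Re: "Re_tableau p lam ?z = x + card ?A"
    using z(1) by (simp add: Re_tableau_def ramp_node_def)
  have "{x<..l div (p - 1) + 1} = ?A \<union> {r \<in> ramp_present l. x < r}"
    using z(2) by (auto simp: ramp_present_def ramp_rows_def)
  moreover have "card (?A \<union> {r \<in> ramp_present l. x < r}) = card ?A + card {r \<in> ramp_present l. x < r}"
    by (rule card_Un_disjoint) (auto simp: ramp_present_def ramp_rows_def)
  ultimately have "l div (p - 1) + 1 - x = card ?A + card {r \<in> ramp_present l. x < r}"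
    by (metis card_greaterThanAtMost)
  moreover have "x \<le> l div (p - 1) + 1" using z(2) by (simp add: ramp_rows_def)
  ultimately show ?thesis unfolding Re by linarith
qed

text \<open>
  The ramps whose nodes, once moved to the left, occupy row \<open>i\<close>.  These ramps index both the
  nodes of row \<open>i\<close> of the restrictisation (\<open>rest_diagram_row\<close>) and the entries \<open>i\<close> of \<open>Re(\<lambda>)\<close>
  (\<open>Re_entries_eq\<close>).
\<close>
definition ramps_reaching :: "nat \<Rightarrow> nat set" where
  "ramps_reaching i = {l. i \<in> ramp_rows l \<and> l div (p - 1) + 1 - i < card (ramp_present l)}"

lemma finite_ramp_present: "finite (ramp_present l)"
  by (simp add: ramp_present_def ramp_rows_def)

lemma rest_diagram_row:
  "{c. (i, c) \<in> rest_diagram p lam} = (\<lambda>l. snd (ramp_node l i)) ` ramps_reaching i"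
proof -
  have crd: "card {z \<in> ramp p l. snd z < snd (ramp_node l i)} = l div (p - 1) + 1 - i" if i: "i \<in> ramp_rows l" for l
  proof -
    have "{z \<in> ramp p l. snd z < snd (ramp_node l i)} = ramp_node l ` {r \<in> ramp_rows l. i < r}"
      using ramp_node_col_less[OF i] by (auto simp: ramp_eq)
    moreover have "{r \<in> ramp_rows l. i < r} = {i<..l div (p - 1) + 1}"
      using i by (auto simp: ramp_rows_def)
    ultimately show ?thesis by (simp add: card_image[OF inj_ramp_node])
  qed
  show ?thesis
  proof (intro equalityI subsetI)
    fix c assume "c \<in> {c. (i, c) \<in> rest_diagram p lam}"
    then obtain l where l: "(i, c) \<in> ramp p l" "card {z \<in> ramp p l. snd z < c} < card (ramp p l \<inter> diagram lam)"
      by (auto simp: rest_diagram_def)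
    then have i: "i \<in> ramp_rows l" "c = snd (ramp_node l i)" by (auto simp: ramp_eq ramp_node_def)
    then have "l \<in> ramps_reaching i" using l(2) crd[OF i(1)] by (simp add: ramps_reaching_def card_ramp_diagram)
    then show "c \<in> (\<lambda>l. snd (ramp_node l i)) ` ramps_reaching i" using i(2) by blast
  next
    fix c assume "c \<in> (\<lambda>l. snd (ramp_node l i)) ` ramps_reaching i"
    then obtain l where l: "c = snd (ramp_node l i)" "i \<in> ramp_rows l" "l div (p - 1) + 1 - i < card (ramp_present l)"
      by (auto simp: ramps_reaching_def)
    then have "(i, c) \<in> ramp p l" by (auto simp: ramp_eq ramp_node_def)
    moreover have "card {z \<in> ramp p l. snd z < c} < card (ramp p l \<inter> diagram lam)"
      using l crd[OF l(2)] by (simp add: card_ramp_diagram)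
    ultimately show "c \<in> {c. (i, c) \<in> rest_diagram p lam}" by (auto simp: rest_diagram_def)
  qed
qed

lemma restrictisation_eq: "restrictisation p lam i = card (ramps_reaching i)"
proof -
  have "inj_on (\<lambda>l. snd (ramp_node l i)) (ramps_reaching i)"
  proof (rule inj_onI)
    fix l l' assume "l \<in> ramps_reaching i" "l' \<in> ramps_reaching i" "snd (ramp_node l i) = snd (ramp_node l' i)"
    then have "(p - 1) * (i - 1) \<le> l" "(p - 1) * (i - 1) \<le> l'"
      "l + 1 - (p - 1) * (i - 1) = l' + 1 - (p - 1) * (i - 1)"
      by (auto simp: ramps_reaching_def ramp_rows_iff ramp_node_def)
    moreover have "l = l'" if "b \<le> l" "b \<le> l'" "l + 1 - b = l' + 1 - b" for b using that by linarith
    ultimately show "l = l'" by blast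
  qed
  then show ?thesis by (simp add: restrictisation_def rest_diagram_row card_image)
qed

lemma Re_entries_eq:
  "{z \<in> diagram lam. Re_tableau p lam z = i} =
   (\<lambda>l. ramp_node l (THE x. x \<in> ramp_present l \<and> card {r \<in> ramp_present l. x < r} = l div (p - 1) + 1 - i)) ` ramps_reaching i"
  (is "?Z = ?h ` _") if i: "1 \<le> i"
proof -
  have the: "(THE x. x \<in> ramp_present l \<and> card {r \<in> ramp_present l. x < r} = j) = x"
    if "x \<in> ramp_present l" "card {r \<in> ramp_present l. x < r} = j" for l x j
    by (rule the_equality) (use that rank_inj[OF finite_ramp_present] in auto)
  show ?thesis
  proof (intro equalityI subsetI)
    fix z assume z: "z \<in> ?Z"
    obtain x y where xy: "z = (x, y)" by (cases z)
    define l where "l = (y - 1) + (p - 1) * (x - 1)"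
    have "z \<in> ramp p l" using z xy by (auto simp: ramp_def diagram_def l_def)
    then obtain x' where "x' \<in> ramp_rows l" "z = ramp_node l x'" by (auto simp: ramp_eq)
    then have x: "x \<in> ramp_rows l" "z = ramp_node l x" using xy by (auto simp: ramp_node_def)
    then have P: "x \<in> ramp_present l" using z by (simp add: ramp_present_def)
    have R: "i + card {r \<in> ramp_present l. x < r} = l div (p - 1) + 1"
      using Re_ramp_node[OF P] z x by simp
    then have j: "card {r \<in> ramp_present l. x < r} = l div (p - 1) + 1 - i" by simp
    have "card {r \<in> ramp_present l. x < r} < card (ramp_present l)"
      by (rule psubset_card_mono[OF finite_ramp_present]) (use P in auto)
    then have "l \<in> ramps_reaching i" using j R i by (simp add: ramps_reaching_def ramp_rows_def)
    moreover have "z = ?h l" unfolding the[OF P j] by (rule x(2))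
    ultimately show "z \<in> ?h ` ramps_reaching i" by (rule rev_image_eqI)
  next
    fix z assume "z \<in> ?h ` ramps_reaching i"
    then obtain l where l: "l \<in> ramps_reaching i" "z = ?h l" by blast
    obtain x where x: "x \<in> ramp_present l" "card {r \<in> ramp_present l. x < r} = l div (p - 1) + 1 - i"
      using ex_rank[OF finite_ramp_present, of _ l] l(1) by (auto simp: ramps_reaching_def)
    have "z = ramp_node l x" using l(2) the[OF x] by simp
    moreover have "i \<le> l div (p - 1) + 1" using l(1) by (simp add: ramps_reaching_def ramp_rows_def)
    ultimately show "z \<in> ?Z" using Re_ramp_node[OF x(1)] x by (simp add: ramp_present_def)
  qed
qed

lemma card_Re_entries:
  assumes i: "1 \<le> i"
  shows "card {z \<in> diagram lam. Re_tableau p lam z = i} = restrictisation p lam i"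
proof -
  let ?h = "\<lambda>l. ramp_node l (THE x. x \<in> ramp_present l \<and> card {r \<in> ramp_present l. x < r} = l div (p - 1) + 1 - i)"
  have "?h l \<in> ramp p l" if l: "l \<in> ramps_reaching i" for l
  proof -
    obtain x where x: "x \<in> ramp_present l" "card {r \<in> ramp_present l. x < r} = l div (p - 1) + 1 - i"
      using ex_rank[OF finite_ramp_present, of _ l] l by (auto simp: ramps_reaching_def)
    have "(THE x. x \<in> ramp_present l \<and> card {r \<in> ramp_present l. x < r} = l div (p - 1) + 1 - i) = x"
      by (rule the_equality) (use x rank_inj[OF finite_ramp_present] in auto)
    then show ?thesis using x by (simp add: ramp_eq ramp_present_def)
  qed
  moreover have "l = l'" if "z \<in> ramp p l" "z \<in> ramp p l'" for z l l' using that by (auto simp: ramp_def)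
  ultimately have "inj_on ?h (ramps_reaching i)" by (metis (no_types, lifting) inj_onI)
  then show ?thesis unfolding Re_entries_eq[OF i] restrictisation_eq by (rule card_image)
qed

lemma Re_of_type_rest: "tableau_of_type lam (restrictisation p lam) (Re_tableau p lam)"
  unfolding tableau_of_type_def
proof (intro conjI ballI allI impI)
  fix z assume z: "z \<in> diagram lam"
  then show "1 \<le> Re_tableau p lam z" by (cases z) (auto simp: Re_tableau_def diagram_def)
next
  fix z assume "z \<notin> diagram lam"
  then show "Re_tableau p lam z = 0" by (cases z) (simp add: Re_tableau_def)
qed (rule card_Re_entries)

text \<open>
  Since the rows of a partition get shorter, a missing node remains missing when it is moved to
  the right or down.  Hence the number of missing nodes weakly increases along rows and down
  columns.
\<close>
lemma Re_semistandard:
  assumes part: "is_partition lam" shows "semistandard lam (Re_tableau p lam)"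
proof -
  let ?q = "p - 1"
  have fin: "finite (missing_below ?q lam x y)" for x y
    by (rule finite_missing_below) (use p2 in simp)
  have "Re_tableau p lam (x, y) \<le> Re_tableau p lam (x, y')"
    if "(x, y) \<in> diagram lam" "(x, y') \<in> diagram lam" "y \<le> y'" for x y y'
  proof -
    have "missing_below ?q lam x y \<subseteq> missing_below ?q lam x y'"
      using that by (auto simp: missing_below_def)
    then have "card (missing_below ?q lam x y) \<le> card (missing_below ?q lam x y')" by (rule card_mono[OF fin])
    then show ?thesis using that by (simp add: Re_tableau_eq diagram_def)
  qed
  moreover have "Re_tableau p lam (x, y) < Re_tableau p lam (x', y)"
    if xy: "(x, y) \<in> diagram lam" "(x', y) \<in> diagram lam" "x < x'" for x x' y
  proof -
    let ?s = "\<lambda>z. z + (x' - x)"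
    have "?s ` missing_below ?q lam x y \<subseteq> missing_below ?q lam x' y"
    proof (rule image_subsetI)
      fix z assume z: "z \<in> missing_below ?q lam x y"
      then have xz: "x < z" "lam z + (z - x) * ?q < y" by (auto simp: missing_below_def)
      have "lam (?s z) \<le> lam z" by (rule partition_antimono[OF part]) (use xz xy in \<open>auto simp: diagram_def\<close>)
      moreover have "?s z - x' = z - x" "x' < ?s z" using xz xy(3) by auto
      ultimately show "?s z \<in> missing_below ?q lam x' y" using xz(2) by (simp add: missing_below_def)
    qed
    then have "card (missing_below ?q lam x y) \<le> card (missing_below ?q lam x' y)"
      by (intro card_inj_on_le[OF _ _ fin]) (auto simp: inj_on_def)
    then show ?thesis using xy by (simp add: Re_tableau_eq diagram_def)
  qed
  ultimately show ?thesis unfolding semistandard_def row_standard_def column_strict_def by blast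
qed

end

section \<open>The coefficients of a magic homomorphism\<close>

lemma magic_outside: "magic p lam T \<Longrightarrow> z \<notin> diagram lam \<Longrightarrow> T z = 0"
  by (induction rule: magic.cases) (auto simp: tplus_def split: prod.splits)

lemma ex_filling:
  assumes "is_composition lam" obtains t where "filling lam t"
proof -
  obtain h where "bij_betw h (diagram lam) {0..<card (diagram lam)}"
    using ex_bij_betw_finite_nat[OF finite_diagram[OF assms]] by blast
  moreover have "bij_betw Suc {0..<card (diagram lam)} {1..csize lam}"
    by (auto simp: bij_betw_def csize_def image_Suc_atLeastLessThan)
  ultimately have "filling lam (Suc \<circ> h)" unfolding filling_def by (rule bij_betw_trans)
  then show ?thesis by (rule that)
qed

theorem proposition6p6:
  fixes p :: nat and lam :: "nat \<Rightarrow> nat" and T :: tableau and a :: "tableau \<Rightarrow> 'f::field"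
  assumes "prime p" and "CHAR('f) = p"
    and "is_partition lam"
    and "magic p lam T"
    and "Theta_hat lam T =
           (\<lambda>v\<in>specht lam. \<Sum>S\<in>semistandard_tableaux lam (restrictisation p lam).
              a S *\<^sub>t Theta_hat lam S v)"
  shows "(a (Re_tableau p lam) = 1 \<or> a (Re_tableau p lam) = - 1) \<and>
         (\<forall>S\<in>semistandard_tableaux lam (restrictisation p lam).
            a S \<noteq> 0 \<longrightarrow> dominates lam S (Re_tableau p lam))"
proof -
  let ?R = "Re_tableau p lam"
  let ?SST = "semistandard_tableaux lam (restrictisation p lam)"
  let ?dom = "dominates lam"
  have p2: "2 \<le> p" using assms(1) by (rule prime_ge_2_nat)
  have comp: "is_composition lam" using assms(3) by (simp add: is_partition_def)
  note dom_iff = dominates_iff_ncount[OF comp]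
  have finSST: "finite ?SST" by (rule finite_semistandard_tableaux[OF comp])
  have R: "?R \<in> ?SST"
    using Re_of_type_rest[OF p2] Re_semistandard[OF p2 assms(3)] by (simp add: semistandard_tableaux_def)
  have cs: "column_strict lam S" and rs: "row_standard lam S" and out: "\<And>z. z \<notin> diagram lam \<Longrightarrow> S z = 0"
    if "S \<in> ?SST" for S
    using that by (auto simp: semistandard_tableaux_def semistandard_def tableau_of_type_def)
  obtain t where t: "filling lam t" using ex_filling[OF comp] .
  define \<Phi> where "\<Phi> W N = (of_int (alt_count lam t W N) :: 'f)" for W N
  \<comment> \<open>The given expansion, evaluated at a polytabloid and read off at one tabloid.\<close>
  have expand: "\<Phi> W (rows_of lam T) = (\<Sum>S\<in>?SST. a S * \<Phi> W (rows_of lam S))" for W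
  proof -
    let ?e = "polytabloid lam t :: 'f tvec" and ?X = "transfer_tabloid lam t W"
    have e: "?e \<in> specht lam" unfolding specht_def by (rule tvec.span_base) (use t in blast)
    have "Theta_hat lam T ?e ?X = (\<Sum>S\<in>?SST. a S *\<^sub>t Theta_hat lam S ?e) ?X"
      unfolding assms(5) using e by simp
    then have "Theta lam T ?e ?X = (\<Sum>S\<in>?SST. a S * Theta lam S ?e ?X)"
      using e by (simp add: Theta_hat_def tvec_sum_apply tscale_def)
    also have "\<dots> = (\<Sum>S\<in>?SST. a S * \<Phi> W (rows_of lam S))"
    proof (rule sum.cong[OF refl])
      fix S assume "S \<in> ?SST"
      then have "Theta lam S ?e ?X = \<Phi> W (rows_of lam S)"
        unfolding \<Phi>_def by (intro Theta_polytabloid_coefficient[OF comp t] out)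
      then show "a S * Theta lam S ?e ?X = a S * \<Phi> W (rows_of lam S)" by simp
    qed
    finally show ?thesis
      using Theta_polytabloid_coefficient[OF comp t magic_outside[OF assms(4)], where W = W and 'f = 'f]
      by (simp add: \<Phi>_def)
  qed
  have low: "ncount N l r \<le> ncount (rows_of lam W) l r" if "W \<in> ?SST" "\<Phi> W N \<noteq> 0" for W N l r
    by (rule alt_count_nonzero_ncount[OF comp t cs[OF that(1)]]) (use that(2) in \<open>auto simp: \<Phi>_def\<close>)
  have self: "\<Phi> W (rows_of lam W) = 1" if "W \<in> ?SST" for W
    using alt_count_self[OF comp t cs[OF that]] by (simp add: \<Phi>_def)
  have garnir: "garnir lam (\<Phi> W)" for W
    unfolding \<Phi>_def by (rule garnir_alt_count[OF assms(3) t])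
  note magic_Re = magic_value[OF assms(1,2,4) garnir]
  have zero: "\<Phi> W (rows_of lam T) = 0" if W: "W \<in> ?SST" "\<not> ?dom W ?R" for W
  proof -
    have z: "\<Phi> W N = 0" if "\<And>l r. ncount (rows_of lam ?R) l r \<le> ncount N l r" for N
      using low[OF W(1), of N] that W(2) unfolding dom_iff by (meson order_trans)
    have "\<Phi> W (rows_of lam T) = \<Phi> W (rows_of lam ?R) \<or> \<Phi> W (rows_of lam T) = - \<Phi> W (rows_of lam ?R)"
      by (rule magic_Re) (use z in \<open>auto simp: dominating_rows_def\<close>)
    moreover have "\<Phi> W (rows_of lam ?R) = 0" by (rule z) simp
    ultimately show ?thesis by auto
  qed
  have one: "\<Phi> ?R (rows_of lam T) = 1 \<or> \<Phi> ?R (rows_of lam T) = - 1"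
  proof -
    have "\<Phi> ?R N = 0" if N: "dominating_rows lam (rows_of lam ?R) N" "N \<noteq> rows_of lam ?R" for N
    proof (rule ccontr)
      assume "\<Phi> ?R N \<noteq> 0"
      then have "ncount N l r = ncount (rows_of lam ?R) l r" for l r
        using low[OF R] N(1) by (intro antisym) (auto simp: dominating_rows_def)
      then show False using ncount_antisym N(2) by blast
    qed
    then show ?thesis using magic_Re[of ?R] self[OF R] by metis
  qed
  have antisym: "S = U" if "S \<in> ?SST" "U \<in> ?SST" "?dom S U" "?dom U S" for S U
  proof (rule row_standard_rows_inject[OF comp rs[OF that(1)] rs[OF that(2)]])
    show "rows_of lam S = rows_of lam U"
      by (rule ncount_antisym) (use that(3,4) in \<open>auto simp: dom_iff intro: antisym\<close>)
  qed (use out[OF that(1)] out[OF that(2)] in auto)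
  have tri: "?dom W S" if "W \<in> ?SST" "\<Phi> W (rows_of lam S) \<noteq> 0" for W S
    using low[OF that] by (simp add: dom_iff)
  \<comment> \<open>Row \<open>W\<close> of the unitriangular system, if no smaller tableau contributes.\<close>
  have coeff: "\<Phi> W (rows_of lam T) = a W" if W: "W \<in> ?SST"
    and others: "\<And>S. S \<in> ?SST \<Longrightarrow> S \<noteq> W \<Longrightarrow> ?dom W S \<Longrightarrow> a S = 0" for W
  proof -
    have "(\<Sum>S\<in>?SST. a S * \<Phi> W (rows_of lam S)) = (\<Sum>S\<in>?SST. if S = W then a W else 0)"
      by (rule sum.cong[OF refl]) (use others tri[OF W] self[OF W] in auto)
    then show ?thesis using expand[of W] W finSST by simp
  qed
  have dom: "?dom S ?R" if S: "S \<in> ?SST" "a S \<noteq> 0" for S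
  proof (rule ccontr)
    assume nd: "\<not> ?dom S ?R"
    \<comment> \<open>A minimal counterexample violates \<open>zero\<close>.\<close>
    let ?Bad = "{S \<in> ?SST. a S \<noteq> 0 \<and> \<not> ?dom S ?R}"
    let ?less = "\<lambda>U S. ?dom S U \<and> U \<noteq> S"
    have trans: "?dom S V" if "?dom S U" "?dom U V" for S U V
      using that unfolding dom_iff by (meson order_trans)
    have "\<exists>W\<in>?Bad. \<forall>U\<in>?Bad. U \<noteq> W \<longrightarrow> \<not> ?less U W"
    proof (rule Finite_Set.bex_min_element)
      show "finite ?Bad" using finSST by simp
      show "asymp_on ?Bad ?less" using antisym by (intro asymp_onI) auto
      show "transp_on ?Bad ?less"
      proof (rule transp_onI)
        fix U V X
        assume B: "U \<in> ?Bad" "V \<in> ?Bad" and UV: "?less U V" and VX: "?less V X"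
        have "U \<noteq> X"
        proof
          assume "U = X"
          then have "U = V" using B UV VX by (intro antisym) auto
          then show False using UV by simp
        qed
        then show "?less U X" using trans[of X V U] UV VX by simp
      qed
      show "?Bad \<noteq> {}" using S nd by auto
    qed
    then obtain W where W: "W \<in> ?Bad" "\<And>U. U \<in> ?Bad \<Longrightarrow> U \<noteq> W \<Longrightarrow> \<not> ?dom W U" by blast
    have "a U = 0" if "U \<in> ?SST" "U \<noteq> W" "?dom W U" for U
    proof (rule ccontr)
      assume "a U \<noteq> 0"
      moreover have "\<not> ?dom U ?R" using trans[OF that(3)] W(1) by blast
      ultimately show False using W(2)[of U] that by blast
    qed
    then have "\<Phi> W (rows_of lam T) = a W" using W(1) by (intro coeff) auto
    then show False using zero[of W] W(1) by simp
  qed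
  have "\<Phi> ?R (rows_of lam T) = a ?R"
    by (rule coeff[OF R]) (use dom antisym[OF R] in blast)
  then show ?thesis using one dom by simp
qed

end
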